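(* Consider sequences, indexed by $n$, of $p,k\in\mathbb{N}$ (with $1\le k\le p$), $\sigma>0$, $\tau>0$. For each $n$, let $(y_i,x_i)_{i=1}^n$ be i.i.d. from the model $y_i=x_i^T\beta+\sigma z_i$ with $x_i\sim\mathcal{N}(0,\frac1n I_p)$, $z_i\sim\mathcal{N}(0,1)$ independent of $x_i$, and $\beta\in\mathbb{R}^p$ fixed. Let $$\Theta(k,\tau)=\{\beta\in\mathbb{R}^p:\|\beta\|_0\le k,\ \|\beta\|_2^2\le k\tau^2\},\qquad R(\Theta(k,\tau),\sigma)=\inf_{\hat\beta}\sup_{\beta\in\Theta(k,\tau)}\mathbb{E}_\beta\|\hat\beta-\beta\|_2^2,$$ and $\mu=\tau/\sigma$. Suppose that $k/p\to0$ and $(k\log p)/n\to0$. Then: Regime (I): if $\mu\to0$, then $R(\Theta(k,\tau),\sigma)=k\tau^2(1+o(1))$. Regime (II): if $\mu\to\infty$ and $\mu=o(\sqrt{\log(p/k)})$, then $R(\Theta(k,\tau),\sigma)=k\tau^2(1+o(1))$. Regime (III): if $\mu=\omega(\sqrt{\log(p/k)})$, then $R(\Theta(k,\tau),\sigma)=2\sigma^2k\log(p/k)\,(1+o(1))$.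
   Context: All asymptotics are as $n\to\infty$ and $p\to\infty$; the quantities $k,p,\sigma,\tau$ may all depend on $n$. $\|\beta\|_0$ is the number of nonzero entries of $\beta$, $\|\cdot\|_2$ is the Euclidean norm. $\mathbb{E}_\beta$ denotes expectation under the model with true parameter $\beta$. The infimum is over all estimators $\hat\beta$, i.e. measurable functions of the data $(y_i,x_i)_{i=1}^n$ with values in $\mathbb{R}^p$ (allowed to depend on $k,\tau,\sigma$). $a_n=o(b_n)$ means $a_n/b_n\to0$; $a_n=\omega(b_n)$ means $b_n=o(a_n)$. *)

theory Defs
  imports "HOL-Probability.Probability" "HOL-Library.Landau_Symbols"
begin

text \<open>
  Since the dimension \<open>p\<close> varies with the sample size \<open>n\<close>, vectors in \<open>\<real>\<^sup>p\<close> are functions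
  in \<open>{..<p} \<rightarrow>\<^sub>E UNIV\<close>, the underlying set of the product measurable space \<open>vec_space p\<close>.
\<close>

definition vec_space :: "nat \<Rightarrow> (nat \<Rightarrow> real) measure" where
  "vec_space p = (\<Pi>\<^sub>M j\<in>{..<p}. borel)"

definition normal_distribution :: "real \<Rightarrow> real \<Rightarrow> real measure" where
  "normal_distribution m v = density lborel (\<lambda>t. ennreal (normal_density m (sqrt v) t))"

text \<open>A single observation is the pair \<open>(y, x)\<close>; the data are \<open>n\<close> of them.\<close>

definition obs_space :: "nat \<Rightarrow> (real \<times> (nat \<Rightarrow> real)) measure" where
  "obs_space p = borel \<Otimes>\<^sub>M vec_space p"

definition data_space :: "nat \<Rightarrow> nat \<Rightarrow> (nat \<Rightarrow> real \<times> (nat \<Rightarrow> real)) measure" where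
  "data_space n p = (\<Pi>\<^sub>M i\<in>{..<n}. obs_space p)"

text \<open>
  The isotropic Gaussian law \<open>N(0, I/n)\<close> on \<open>\<real>\<^sup>p\<close> is the product of \<open>p\<close> copies of \<open>N(0, 1/n)\<close>.
\<close>

definition design_law :: "nat \<Rightarrow> nat \<Rightarrow> (nat \<Rightarrow> real) measure" where
  "design_law n p = (\<Pi>\<^sub>M j\<in>{..<p}. normal_distribution 0 (1 / real n))"

definition obs_law ::
  "nat \<Rightarrow> nat \<Rightarrow> real \<Rightarrow> (nat \<Rightarrow> real) \<Rightarrow> (real \<times> (nat \<Rightarrow> real)) measure" where
  "obs_law n p \<sigma> \<beta> =
     distr (design_law n p \<Otimes>\<^sub>M normal_distribution 0 1) (obs_space p)
       (\<lambda>(x, z). ((\<Sum>j<p. x j * \<beta> j) + \<sigma> * z, x))"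

definition data_law ::
  "nat \<Rightarrow> nat \<Rightarrow> real \<Rightarrow> (nat \<Rightarrow> real) \<Rightarrow> (nat \<Rightarrow> real \<times> (nat \<Rightarrow> real)) measure" where
  "data_law n p \<sigma> \<beta> = (\<Pi>\<^sub>M i\<in>{..<n}. obs_law n p \<sigma> \<beta>)"

definition l0_norm :: "nat \<Rightarrow> (nat \<Rightarrow> real) \<Rightarrow> nat" where
  "l0_norm p \<beta> = card {j \<in> {..<p}. \<beta> j \<noteq> 0}"

definition l2_norm :: "nat \<Rightarrow> (nat \<Rightarrow> real) \<Rightarrow> real" where
  "l2_norm p \<beta> = L2_set \<beta> {..<p}"

definition sparse_params :: "nat \<Rightarrow> nat \<Rightarrow> real \<Rightarrow> (nat \<Rightarrow> real) set" where
  "sparse_params p k \<tau> =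
     {\<beta> \<in> {..<p} \<rightarrow>\<^sub>E UNIV. l0_norm p \<beta> \<le> k \<and> (l2_norm p \<beta>)\<^sup>2 \<le> real k * \<tau>\<^sup>2}"

definition estimators ::
  "nat \<Rightarrow> nat \<Rightarrow> ((nat \<Rightarrow> real \<times> (nat \<Rightarrow> real)) \<Rightarrow> nat \<Rightarrow> real) set" where
  "estimators n p = data_space n p \<rightarrow>\<^sub>M vec_space p"

text \<open>
  The risk of an estimator may be infinite, so it is an extended nonnegative real.
\<close>

definition risk ::
  "nat \<Rightarrow> nat \<Rightarrow> real \<Rightarrow> ((nat \<Rightarrow> real \<times> (nat \<Rightarrow> real)) \<Rightarrow> nat \<Rightarrow> real) \<Rightarrow>
   (nat \<Rightarrow> real) \<Rightarrow> ennreal" where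
  "risk n p \<sigma> est \<beta> =
     (\<integral>\<^sup>+ d. ennreal ((l2_norm p (\<lambda>j. est d j - \<beta> j))\<^sup>2) \<partial>data_law n p \<sigma> \<beta>)"

definition minimax_risk :: "nat \<Rightarrow> nat \<Rightarrow> real \<Rightarrow> (nat \<Rightarrow> real) set \<Rightarrow> ennreal" where
  "minimax_risk n p \<sigma> \<Theta> = (INF est\<in>estimators n p. SUP \<beta>\<in>\<Theta>. risk n p \<sigma> est \<beta>)"

text \<open>
  The form \<open>R = a (1 + o(1))\<close>. The minimax risk is kept in \<open>ennreal\<close>, so that finiteness for
  all large \<open>n\<close> is part of the claim.
\<close>

definition one_plus_o1_times :: "(nat \<Rightarrow> ennreal) \<Rightarrow> (nat \<Rightarrow> real) \<Rightarrow> bool" where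
  "one_plus_o1_times R a \<longleftrightarrow>
     (\<exists>\<epsilon>. \<epsilon> \<in> o(\<lambda>_. 1 :: real) \<and>
       (\<forall>\<^sub>F n in sequentially. R n = ennreal (a n * (1 + \<epsilon> n))))"

end

theory Submission
  imports Defs "HOL-Real_Asymp.Real_Asymp"
begin

text \<open>
  Lower bound: the prior puts one spike of height \<open>\<tau>\<close> at a uniform position in each of \<open>k\<close> blocks of
  \<open>q = p div k\<close> coordinates. Revealing all other blocks, each block becomes the problem of locating
  one spike. If \<open>\<tau> \<le> c \<sigma> sqrt (2 ln (p / k))\<close> with \<open>c < 1\<close>, then given the noise and the true column
  the other columns are independent, and each of them fits the data at least as well as the true one
  with probability about \<open>(p / k) powr (- c\<^sup>2)\<close>, hence many of them do. The true position therefore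
  has small posterior probability and almost all of the energy \<open>k \<tau>\<^sup>2\<close> is lost. In regime III one
  first shrinks \<open>\<tau>\<close> to \<open>c \<sigma> sqrt (2 ln (p / k))\<close>.

  Upper bound: in regimes I and II the zero estimator suffices. In regime III \<open>\<tau>\<close> may be arbitrarily
  large, so a pilot estimate whose risk is small compared with \<open>n \<sigma>\<^sup>2\<close>, uniformly in \<open>\<tau>\<close>, is needed. A small fraction of
  the observations is spent on least squares over a finite lattice of \<open>k\<close>-sparse vectors, where a
  Chernoff bound for the comparison of two residual sums of squares beats the size of the lattice
  at all scales. On the other observations the pilot is corrected by the correlations of the columns
  with its residuals. Outside the two supports these correlations are exactly Gaussian given the
  residuals, so soft thresholding at \<open>sqrt (2 ln (p / k))\<close> of their standard deviations costs
  \<open>2 \<sigma>\<^sup>2 k ln (p / k)\<close> on the true support and only \<open>O(\<sigma>\<^sup>2 k)\<close> elsewhere.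
\<close>

section \<open>Gaussian measures\<close>

text \<open>Both bounds rest on \<open>ln (p / k) \<le> ln p \<le> k * ln p = o(n)\<close>. In the
  lower bound it makes the norm of a column concentrate with an error below any power of
  \<open>k / p\<close>, so the tail \<open>(p / k) powr (- c\<^sup>2)\<close> of one competitor is
  not masked. Counting competitors avoids second moments of likelihood ratios: the posterior weight
  of a candidate is at most the inverse of the number of candidates, itself included, that are at
  least as likely. In the upper bound it makes the entropy of the lattice, of order
  \<open>k * ln p\<close>, negligible against any fixed fraction of the \<open>n\<close>
  observations. The pilot \<open>b\<close> acts on the second stage only through the residual
  variance, \<open>\<sigma>\<^sup>2\<close> plus the squared error of \<open>b\<close> over
  \<open>n\<close>; this is why an error small against \<open>n * \<sigma>\<^sup>2\<close> is
  enough. The split makes the pilot independent of the correlations. The lattice is finite, but its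
  width grows with \<tau>; a union bound with constant terms would feel this, while weights decaying
  like an inverse square are summable over all integers. Finally \<open>k / p\<close> tending to 0
  sends \<open>ln (p / k)\<close> to infinity, so errors of order
  \<open>\<sigma>\<^sup>2 * k\<close> are negligible.\<close>

lemma sets_normal_distribution [measurable_cong, simp]: "sets (normal_distribution m v) = sets borel"
  by (simp add: normal_distribution_def)

lemma space_normal_distribution [simp]: "space (normal_distribution m v) = UNIV"
  by (simp add: normal_distribution_def)

lemma prob_space_normal_distribution: "0 < v \<Longrightarrow> prob_space (normal_distribution m v)"
  unfolding normal_distribution_def by (rule prob_space_normal_density) simp

lemma nn_integral_normal_distribution:
  assumes [measurable]: "f \<in> borel_measurable borel"
  shows "(\<integral>\<^sup>+t. f t \<partial>normal_distribution m v) = (\<integral>\<^sup>+t. ennreal (normal_density m (sqrt v) t) * f t \<partial>lborel)"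
  unfolding normal_distribution_def by (subst nn_integral_density) auto

lemma distributed_normal_distribution:
  assumes "distributed M lborel X (normal_density m s)" "0 \<le> s"
  shows "distr M borel X = normal_distribution m (s\<^sup>2)"
proof -
  have "distr M borel X = distr M lborel X" by (rule distr_cong) auto
  then show ?thesis
    using assms unfolding distributed_def normal_distribution_def by simp
qed

text \<open>The tilt by \<open>exp (c * t\<^sup>2)\<close> turns the density of variance
  \<open>v\<close> into a multiple of the density of variance \<open>w\<close>, since precisions
  subtract: \<open>1 / w = 1 / v - 2 * c\<close>. All Chernoff bounds below come from this
  formula.\<close>

lemma nn_integral_exp_square_normal:
  assumes v: "0 < v" and c: "2 * c * v < 1"
  shows "(\<integral>\<^sup>+t. ennreal (exp (c * t\<^sup>2)) \<partial>normal_distribution 0 v) = ennreal (1 / sqrt (1 - 2 * c * v))"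
proof -
  define w where "w = v / (1 - 2 * c * v)"
  have w: "0 < w" using v c by (simp add: w_def)
  have inv: "1 / w = 1 / v - 2 * c" using v c by (simp add: w_def field_simps)
  have eq: "normal_density 0 (sqrt v) t * exp (c * t\<^sup>2)
      = 1 / sqrt (1 - 2 * c * v) * normal_density 0 (sqrt w) t" for t
  proof -
    have "- (t\<^sup>2) / (2 * v) + c * t\<^sup>2 = - (t\<^sup>2) / 2 * (1 / v - 2 * c)"
      using v by (simp add: field_simps)
    also have "\<dots> = - (t\<^sup>2) / (2 * w)" by (subst inv [symmetric]) simp
    finally have e: "exp (- (t\<^sup>2) / (2 * v)) * exp (c * t\<^sup>2) = exp (- (t\<^sup>2) / (2 * w))"
      by (simp add: exp_add [symmetric])
    have s: "sqrt v * sqrt (1 / (1 - 2 * c * v)) = sqrt w"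
      by (simp add: w_def real_sqrt_mult [symmetric])
    have "1 / sqrt (2 * pi * v) = 1 / sqrt (1 - 2 * c * v) * (1 / sqrt (2 * pi * w))"
    proof -
      have "sqrt (1 - 2 * c * v) * sqrt (2 * pi * w) = sqrt (2 * pi * v)"
        using c v by (simp add: w_def real_sqrt_mult [symmetric] field_simps)
      then show ?thesis by simp
    qed
    then show ?thesis using v w e by (simp add: normal_density_def)
  qed
  have "(\<integral>\<^sup>+t. ennreal (exp (c * t\<^sup>2)) \<partial>normal_distribution 0 v)
      = (\<integral>\<^sup>+t. ennreal (1 / sqrt (1 - 2 * c * v)) * ennreal (normal_density 0 (sqrt w) t) \<partial>lborel)"
    using c by (subst nn_integral_normal_distribution)
      (auto intro!: nn_integral_cong simp: ennreal_mult [symmetric] eq)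
  also have "\<dots> = ennreal (1 / sqrt (1 - 2 * c * v)) * (\<integral>\<^sup>+t. ennreal (normal_density 0 (sqrt w) t) \<partial>lborel)"
    by (rule nn_integral_cmult) simp
  also have "(\<integral>\<^sup>+t. ennreal (normal_density 0 (sqrt w) t) \<partial>lborel) = 1"
    using w by (subst nn_integral_eq_integral) auto
  finally show ?thesis by simp
qed

lemma nn_integral_normal_even_moment:
  assumes v: "0 < v"
  shows "(\<integral>\<^sup>+t. ennreal (t ^ (2 * k)) \<partial>normal_distribution 0 v)
    = ennreal (fact (2 * k) / ((2 / v) ^ k * fact k))"
proof -
  have m: "has_bochner_integral lborel (\<lambda>t. normal_density 0 (sqrt v) t * t ^ (2 * k))
      (fact (2 * k) / ((2 / v) ^ k * fact k))"
    using normal_moment_even [of "sqrt v" 0 k] v by simp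
  have "(\<integral>\<^sup>+t. ennreal (t ^ (2 * k)) \<partial>normal_distribution 0 v)
      = (\<integral>\<^sup>+t. ennreal (normal_density 0 (sqrt v) t * t ^ (2 * k)) \<partial>lborel)"
    by (subst nn_integral_normal_distribution)
      (auto intro!: nn_integral_cong simp: ennreal_mult' [symmetric] power_mult)
  also have "\<dots> = ennreal (fact (2 * k) / ((2 / v) ^ k * fact k))"
    using m by (subst nn_integral_eq_integral)
      (auto simp: has_bochner_integral_iff power_mult intro!: mult_nonneg_nonneg)
  finally show ?thesis .
qed

lemma nn_integral_normal_square:
  "0 < v \<Longrightarrow> (\<integral>\<^sup>+t. ennreal (t\<^sup>2) \<partial>normal_distribution 0 v) = ennreal v"
  using nn_integral_normal_even_moment [of v 1] by simp

lemma nn_integral_normal_fourth: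
  "0 < v \<Longrightarrow> (\<integral>\<^sup>+t. ennreal (t ^ 4) \<partial>normal_distribution 0 v) = ennreal (3 * v\<^sup>2)"
  using nn_integral_normal_even_moment [of v 2]
  by (simp add: fact_numeral power_divide)

lemma nn_integral_lborel_shift:
  fixes f :: "real \<Rightarrow> ennreal"
  assumes "f \<in> borel_measurable borel"
  shows "(\<integral>\<^sup>+t. f (t + c) \<partial>lborel) = (\<integral>\<^sup>+t. f t \<partial>lborel)"
  using nn_integral_real_affine [of f 1 c] assms by (simp add: add.commute)

text \<open>If \<open>r * s\<close> is nonnegative, then \<open>(r + s)\<^sup>2\<close> is at least
  \<open>r\<^sup>2 + s\<^sup>2\<close>. Moving each tail to the origin therefore costs the factor
  \<open>exp (- (L\<^sup>2) / 2)\<close>, and \<open>F\<close> and \<open>G\<close>, the two halves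
  of the second moment, add up to \<open>v\<close>. With \<open>L\<^sup>2 = 2 * ln (p / k)\<close>
  the total over \<open>p\<close> coordinates is of order \<open>k\<close>.\<close>

lemma normal_excess_bound:
  assumes v: "0 < v" and L: "0 \<le> L"
  shows "(\<integral>\<^sup>+t. ennreal ((max 0 (\<bar>t\<bar> - L * sqrt v))\<^sup>2) \<partial>normal_distribution 0 v)
    \<le> ennreal (v * exp (- (L\<^sup>2) / 2))"
proof -
  define l where "l = L * sqrt v"
  have l: "0 \<le> l" using L v by (simp add: l_def)
  have l2: "l\<^sup>2 / (2 * v) = L\<^sup>2 / 2" using v by (simp add: l_def power_mult_distrib)
  define \<phi> where "\<phi> = normal_density 0 (sqrt v)"
  have \<phi>0: "0 \<le> \<phi> t" for t by (simp add: \<phi>_def)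
  have [measurable]: "\<phi> \<in> borel_measurable borel" by (simp add: \<phi>_def)
  define F where "F = (\<lambda>r. ennreal (r\<^sup>2 * \<phi> r) * indicator {0..} r)"
  define G where "G = (\<lambda>r. ennreal (r\<^sup>2 * \<phi> r) * indicator {..<0} r)"
  have [measurable]: "F \<in> borel_measurable borel" "G \<in> borel_measurable borel"
    by (simp_all add: F_def G_def)
  have shrink: "\<phi> (r + s) \<le> exp (- (L\<^sup>2) / 2) * \<phi> r" if "s\<^sup>2 = l\<^sup>2" "0 \<le> r * s" for r s
  proof -
    have "(r\<^sup>2 + s\<^sup>2) / (2 * v) \<le> (r + s)\<^sup>2 / (2 * v)"
      using that v by (intro divide_right_mono) (auto simp: power2_sum)
    then have "- ((r + s)\<^sup>2) / (2 * v) \<le> - (L\<^sup>2) / 2 + - (r\<^sup>2) / (2 * v)"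
      using that(1) l2 v by (simp add: add_divide_distrib)
    then have "exp (- ((r + s)\<^sup>2) / (2 * v)) \<le> exp (- (L\<^sup>2) / 2) * exp (- (r\<^sup>2) / (2 * v))"
      by (simp add: exp_add [symmetric])
    then have "1 / sqrt (2 * pi * v) * exp (- ((r + s)\<^sup>2) / (2 * v))
        \<le> 1 / sqrt (2 * pi * v) * (exp (- (L\<^sup>2) / 2) * exp (- (r\<^sup>2) / (2 * v)))"
      using v by (intro mult_left_mono) auto
    then show ?thesis using v by (simp add: \<phi>_def normal_density_def mult_ac)
  qed
  have pw: "ennreal (\<phi> t * (max 0 (\<bar>t\<bar> - l))\<^sup>2)
      \<le> ennreal (exp (- (L\<^sup>2) / 2)) * (F (t + - l) + G (t + l))" for t
  proof -
    consider "l \<le> t" | "t < - l" | "\<bar>t\<bar> \<le> l" by linarith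
    then show ?thesis
    proof cases
      case 1
      have "\<phi> t * (max 0 (\<bar>t\<bar> - l))\<^sup>2 \<le> exp (- (L\<^sup>2) / 2) * ((t - l)\<^sup>2 * \<phi> (t - l))"
        using mult_left_mono [OF shrink [of l "t - l"], of "(t - l)\<^sup>2"] 1 l
        by (simp add: max_def mult_ac)
      then have "ennreal (\<phi> t * (max 0 (\<bar>t\<bar> - l))\<^sup>2) \<le> ennreal (exp (- (L\<^sup>2) / 2)) * F (t + - l)"
        using 1 \<phi>0 by (simp add: F_def ennreal_mult [symmetric] ennreal_leI)
      also have "\<dots> \<le> ennreal (exp (- (L\<^sup>2) / 2)) * (F (t + - l) + G (t + l))"
        by (intro mult_left_mono) auto
      finally show ?thesis .
    next
      case 2
      have "0 \<le> (t + l) * (- l)" using 2 l by (auto simp: mult_le_0_iff)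
      then have "\<phi> t * (max 0 (\<bar>t\<bar> - l))\<^sup>2 \<le> exp (- (L\<^sup>2) / 2) * ((t + l)\<^sup>2 * \<phi> (t + l))"
        using mult_left_mono [OF shrink [of "- l" "t + l"], of "(t + l)\<^sup>2"] 2 l
          power2_commute [of "- t" l]
        by (simp add: max_def mult_ac add.commute)
      then have "ennreal (\<phi> t * (max 0 (\<bar>t\<bar> - l))\<^sup>2) \<le> ennreal (exp (- (L\<^sup>2) / 2)) * G (t + l)"
        using 2 \<phi>0 by (simp add: G_def ennreal_mult [symmetric] ennreal_leI)
      also have "\<dots> \<le> ennreal (exp (- (L\<^sup>2) / 2)) * (F (t + - l) + G (t + l))"
        by (intro mult_left_mono) auto
      finally show ?thesis .
    qed (simp add: max_def)
  qed
  have "(\<integral>\<^sup>+t. ennreal ((max 0 (\<bar>t\<bar> - L * sqrt v))\<^sup>2) \<partial>normal_distribution 0 v)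
      = (\<integral>\<^sup>+t. ennreal (\<phi> t * (max 0 (\<bar>t\<bar> - l))\<^sup>2) \<partial>lborel)"
    by (subst nn_integral_normal_distribution)
      (auto intro!: nn_integral_cong simp: ennreal_mult' [symmetric] \<phi>_def l_def)
  also have "\<dots> \<le> (\<integral>\<^sup>+t. ennreal (exp (- (L\<^sup>2) / 2)) * (F (t + - l) + G (t + l)) \<partial>lborel)"
    by (rule nn_integral_mono) (rule pw)
  also have "\<dots> = ennreal (exp (- (L\<^sup>2) / 2)) * ((\<integral>\<^sup>+t. F (t + - l) \<partial>lborel) + (\<integral>\<^sup>+t. G (t + l) \<partial>lborel))"
    by (simp add: nn_integral_cmult nn_integral_add)
  also have "(\<integral>\<^sup>+t. F (t + - l) \<partial>lborel) = (\<integral>\<^sup>+t. F t \<partial>lborel)"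
    by (rule nn_integral_lborel_shift) simp
  also have "(\<integral>\<^sup>+t. G (t + l) \<partial>lborel) = (\<integral>\<^sup>+t. G t \<partial>lborel)"
    by (rule nn_integral_lborel_shift) simp
  also have "(\<integral>\<^sup>+t. F t \<partial>lborel) + (\<integral>\<^sup>+t. G t \<partial>lborel) = (\<integral>\<^sup>+t. F t + G t \<partial>lborel)"
    by (simp add: nn_integral_add)
  also have "(\<integral>\<^sup>+t. F t + G t \<partial>lborel) = (\<integral>\<^sup>+t. ennreal (t\<^sup>2) \<partial>normal_distribution 0 v)"
    by (subst nn_integral_normal_distribution)
      (auto intro!: nn_integral_cong simp: F_def G_def ennreal_mult' [symmetric] \<phi>_def mult_ac
        split: split_indicator)
  also have "\<dots> = ennreal v" by (rule nn_integral_normal_square [OF v])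
  finally show ?thesis using v by (simp add: ennreal_mult [symmetric] mult.commute)
qed

text \<open>On one interval of length \<open>sqrt v\<close> the density is at least its value at the
  far end. Using this interval instead of the whole tail turns \<open>s\<close> into
  \<open>s + 1\<close>, which is of lower order for large \<open>s\<close>.\<close>

lemma normal_tail_lower:
  assumes v: "0 < v" and s: "0 \<le> s"
  shows "ennreal (exp (- ((s + 1)\<^sup>2) / 2) / sqrt (2 * pi))
    \<le> emeasure (normal_distribution 0 v) {t. s * sqrt v \<le> t}"
proof -
  let ?I = "{s * sqrt v .. (s + 1) * sqrt v}"
  have len: "emeasure lborel ?I = ennreal (sqrt v)"
    using v s by (subst emeasure_lborel_Icc) (auto simp: algebra_simps)
  define c where "c = exp (- ((s + 1)\<^sup>2) / 2) / sqrt (2 * pi * v)"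
  have c0: "0 \<le> c" using v by (simp add: c_def)
  have dens: "c \<le> normal_density 0 (sqrt v) t" if "t \<in> ?I" for t
  proof -
    have t: "0 \<le> t" using that s v by (auto intro: order_trans [rotated])
    have "t\<^sup>2 \<le> ((s + 1) * sqrt v)\<^sup>2" using that t by (intro power_mono) auto
    then have "t\<^sup>2 \<le> (s + 1)\<^sup>2 * v" using v by (simp only: power_mult_distrib) simp
    then have "t\<^sup>2 / (2 * v) \<le> (s + 1)\<^sup>2 / 2" using v by (simp add: pos_divide_le_eq mult.commute)
    then have "exp (- ((s + 1)\<^sup>2) / 2) \<le> exp (- (t\<^sup>2) / (2 * v))" by simp
    then have "c \<le> exp (- (t\<^sup>2) / (2 * v)) / sqrt (2 * pi * v)"
      unfolding c_def using v by (intro divide_right_mono) auto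
    then show ?thesis using v by (simp add: normal_density_def)
  qed
  have "ennreal (exp (- ((s + 1)\<^sup>2) / 2) / sqrt (2 * pi)) = ennreal c * ennreal (sqrt v)"
    using v by (simp add: c_def ennreal_mult' [symmetric] real_sqrt_mult)
  also have "\<dots> = (\<integral>\<^sup>+t. ennreal c * indicator ?I t \<partial>lborel)"
    by (subst nn_integral_cmult_indicator) (auto simp: len)
  also have "\<dots> \<le> (\<integral>\<^sup>+t. ennreal (normal_density 0 (sqrt v) t) * indicator {t. s * sqrt v \<le> t} t \<partial>lborel)"
    using dens by (intro nn_integral_mono) (auto split: split_indicator intro: ennreal_leI)
  also have "\<dots> = emeasure (normal_distribution 0 v) {t. s * sqrt v \<le> t}"
    unfolding normal_distribution_def by (subst emeasure_density) auto
  finally show ?thesis .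
qed

section \<open>Standard Gaussian families over an arbitrary index set\<close>

definition gauss :: "'i set \<Rightarrow> ('i \<Rightarrow> real) measure" where
  "gauss I = (\<Pi>\<^sub>M i\<in>I. normal_distribution 0 1)"

lemma prob_space_std_normal: "prob_space (normal_distribution 0 1)"
  by (rule prob_space_normal_distribution) simp

lemma prob_space_gauss: "prob_space (gauss I)"
  unfolding gauss_def by (rule prob_space_PiM) (rule prob_space_std_normal)

lemma sets_gauss [measurable_cong]: "sets (gauss I) = sets (\<Pi>\<^sub>M i\<in>I. borel)"
  unfolding gauss_def by (rule sets_PiM_cong) auto

lemma measurable_gauss_component [measurable (raw)]:
  "i \<in> I \<Longrightarrow> (\<lambda>\<omega>. \<omega> i) \<in> borel_measurable (gauss I)"
  using measurable_component_singleton [of i I "\<lambda>_. normal_distribution 0 1"]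
  by (simp add: gauss_def cong: measurable_cong_sets)

lemma space_gauss: "space (gauss I) = (\<Pi>\<^sub>E i\<in>I. UNIV)"
  by (simp add: gauss_def space_PiM)

lemma indep_vars_gauss: "prob_space.indep_vars (gauss I) (\<lambda>_. borel) (\<lambda>i \<omega>. \<omega> i) I"
proof (cases "I = {}")
  case True
  interpret prob_space "gauss I" by (rule prob_space_gauss)
  show ?thesis unfolding indep_vars_def2 indep_sets_def using True by simp
next
  case False
  interpret prob_space "gauss I" by (rule prob_space_gauss)
  have "distr (gauss I) (\<Pi>\<^sub>M i\<in>I. borel) (\<lambda>x. \<lambda>i\<in>I. x i) = distr (gauss I) (gauss I) (\<lambda>x. x)"
    by (rule distr_cong) (auto simp: sets_gauss space_gauss)
  also have "\<dots> = gauss I" by (rule distr_id)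
  also have "\<dots> = (\<Pi>\<^sub>M i\<in>I. distr (gauss I) borel (\<lambda>x. x i))"
    unfolding gauss_def
  proof (rule PiM_cong [OF refl])
    fix i assume i: "i \<in> I"
    have "distr (\<Pi>\<^sub>M i\<in>I. normal_distribution 0 1) borel (\<lambda>x. x i)
        = distr (\<Pi>\<^sub>M i\<in>I. normal_distribution 0 1) (normal_distribution 0 1) (\<lambda>x. x i)"
      by (rule distr_cong) auto
    then show "normal_distribution 0 1 = distr (\<Pi>\<^sub>M i\<in>I. normal_distribution 0 1) borel (\<lambda>x. x i)"
      using distr_PiM_component [OF prob_space_std_normal i] by simp
  qed
  finally show ?thesis
    by (subst indep_vars_iff_distr_eq_PiM' [OF False]) auto
qed

lemma distributed_gauss_component:
  assumes "i \<in> I"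
  shows "distributed (gauss I) lborel (\<lambda>\<omega>. \<omega> i) std_normal_density"
proof -
  have "distr (gauss I) lborel (\<lambda>\<omega>. \<omega> i) = distr (gauss I) (normal_distribution 0 1) (\<lambda>\<omega>. \<omega> i)"
    by (rule distr_cong) auto
  also have "\<dots> = normal_distribution 0 1"
    unfolding gauss_def by (rule distr_PiM_component [OF prob_space_std_normal assms])
  finally show ?thesis
    using assms by (auto simp: distributed_def normal_distribution_def)
qed

lemma distr_gauss_linear:
  assumes I: "finite I" and pos: "0 < (\<Sum>i\<in>I. (c i)\<^sup>2)"
  shows "distr (gauss I) borel (\<lambda>\<omega>. \<Sum>i\<in>I. c i * \<omega> i) = normal_distribution 0 (\<Sum>i\<in>I. (c i)\<^sup>2)"
proof -
  interpret prob_space "gauss I" by (rule prob_space_gauss)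
  \<comment> \<open>\<open>sum_indep_normal\<close> asks for positive standard deviations, so the
    zero coefficients are dropped.\<close>
  define J where "J = {i\<in>I. c i \<noteq> 0}"
  have J: "finite J" "J \<subseteq> I" using I by (auto simp: J_def)
  have sq: "(\<Sum>i\<in>I. (c i)\<^sup>2) = (\<Sum>i\<in>J. (c i)\<^sup>2)"
    using I unfolding J_def by (intro sum.mono_neutral_right) auto
  have J0: "J \<noteq> {}" using pos sq by auto
  have lin: "(\<Sum>i\<in>I. c i * \<omega> i) = (\<Sum>i\<in>J. c i * \<omega> i)" for \<omega>
    using I unfolding J_def by (intro sum.mono_neutral_right) auto
  have ind: "indep_vars (\<lambda>_. borel) (\<lambda>i \<omega>. c i * \<omega> i) J"
    by (rule indep_vars_compose2 [OF indep_vars_subset [OF indep_vars_gauss J(2)]]) simp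
  have "distributed (gauss I) lborel (\<lambda>\<omega>. \<Sum>i\<in>J. c i * \<omega> i)
      (normal_density (\<Sum>i\<in>J. 0) (sqrt (\<Sum>i\<in>J. \<bar>c i\<bar>\<^sup>2)))"
  proof (rule sum_indep_normal [OF J(1) J0 ind])
    fix i assume i: "i \<in> J"
    then show "0 < \<bar>c i\<bar>" by (simp add: J_def)
    show "distributed (gauss I) lborel (\<lambda>\<omega>. c i * \<omega> i) (normal_density 0 \<bar>c i\<bar>)"
      using normal_density_affine [of "\<lambda>\<omega>. \<omega> i" 0 1 "c i" 0] i J(2)
      by (auto simp: J_def intro!: distributed_gauss_component)
  qed
  from distributed_normal_distribution [OF this] show ?thesis
    by (simp add: lin sq sum_nonneg)
qed

lemma nn_integral_gauss_linear:
  assumes "finite I" "0 < (\<Sum>i\<in>I. (c i)\<^sup>2)" and [measurable]: "f \<in> borel_measurable borel"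
  shows "(\<integral>\<^sup>+\<omega>. f (\<Sum>i\<in>I. c i * \<omega> i) \<partial>gauss I)
    = (\<integral>\<^sup>+t. f t \<partial>normal_distribution 0 (\<Sum>i\<in>I. (c i)\<^sup>2))"
  by (subst distr_gauss_linear [OF assms(1,2), symmetric], subst nn_integral_distr) simp_all

lemma product_sigma_finite_gauss: "product_sigma_finite (\<lambda>_. normal_distribution 0 1)"
  unfolding product_sigma_finite_def
  using prob_space_std_normal prob_space_imp_sigma_finite by auto

lemma nn_integral_gauss_fold:
  assumes "I \<inter> J = {}" "finite I" "finite J" and "f \<in> borel_measurable (gauss (I \<union> J))"
  shows "(\<integral>\<^sup>+\<omega>. f \<omega> \<partial>gauss (I \<union> J))
    = (\<integral>\<^sup>+x. (\<integral>\<^sup>+y. f (merge I J (x, y)) \<partial>gauss J) \<partial>gauss I)"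
  using product_sigma_finite.product_nn_integral_fold [OF product_sigma_finite_gauss] assms
  unfolding gauss_def by blast

lemma distr_gauss_reindex:
  assumes "inj_on f I" "f \<in> I \<rightarrow> K"
  shows "distr (gauss K) (gauss I) (\<lambda>\<omega>. \<lambda>i\<in>I. \<omega> (f i)) = gauss I"
  using distr_PiM_reindex [of K "\<lambda>_. normal_distribution 0 1" f I] assms prob_space_std_normal
  unfolding gauss_def by auto

section \<open>The data as a function of independent standard normals\<close>

definition gauss_obs :: "nat \<Rightarrow> nat \<Rightarrow> real \<Rightarrow> (nat \<Rightarrow> real) \<Rightarrow> (nat \<Rightarrow> real) \<Rightarrow> real \<times> (nat \<Rightarrow> real)" where
  "gauss_obs n p \<sigma> \<beta> g =
     ((\<Sum>j<p. g j / sqrt (real n) * \<beta> j) + \<sigma> * g p, \<lambda>j\<in>{..<p}. g j / sqrt (real n))"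

text \<open>Column \<open>p\<close> of the Gaussian matrix holds the noise, the columns \<open>j < p\<close> the design.\<close>

definition gauss_data ::
  "nat \<Rightarrow> nat \<Rightarrow> real \<Rightarrow> (nat \<Rightarrow> real) \<Rightarrow> (nat \<times> nat \<Rightarrow> real) \<Rightarrow> nat \<Rightarrow> real \<times> (nat \<Rightarrow> real)" where
  "gauss_data n p \<sigma> \<beta> \<omega> = (\<lambda>i\<in>{..<n}. gauss_obs n p \<sigma> \<beta> (\<lambda>j. \<omega> (i, j)))"

lemma measurable_gauss_obs [measurable]: "gauss_obs n p \<sigma> \<beta> \<in> gauss {..p} \<rightarrow>\<^sub>M obs_space p"
  unfolding gauss_obs_def [abs_def] obs_space_def vec_space_def by measurable

lemma measurable_gauss_data [measurable]:
  "gauss_data n p \<sigma> \<beta> \<in> gauss ({..<n} \<times> {..p}) \<rightarrow>\<^sub>M data_space n p"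
  unfolding gauss_data_def [abs_def] data_space_def gauss_obs_def obs_space_def vec_space_def
  by measurable

lemma sets_design_law [simp]: "sets (design_law n p) = sets (vec_space p)"
  unfolding design_law_def vec_space_def by (rule sets_PiM_cong) auto

lemma design_law_eq_distr:
  assumes n: "0 < n" and p: "0 < p"
  shows "distr (gauss {..p}) (vec_space p) (\<lambda>g. \<lambda>j\<in>{..<p}. g j / sqrt (real n)) = design_law n p"
proof -
  interpret prob_space "gauss {..p}" by (rule prob_space_gauss)
  have ind: "indep_vars (\<lambda>_. borel) (\<lambda>j g. g j / sqrt (real n)) {..<p}"
    by (rule indep_vars_compose2 [OF indep_vars_subset [OF indep_vars_gauss]]) auto
  have dist: "distr (gauss {..p}) borel (\<lambda>g. g j / sqrt (real n)) = normal_distribution 0 (1 / real n)"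
    if "j \<in> {..<p}" for j
  proof -
    have "distributed (gauss {..p}) lborel (\<lambda>g. 0 + 1 / sqrt (real n) * g j)
        (normal_density (0 + 1 / sqrt (real n) * 0) (\<bar>1 / sqrt (real n)\<bar> * 1))"
      using n that by (intro normal_density_affine distributed_gauss_component) auto
    from distributed_normal_distribution [OF this] show ?thesis
      using n by (simp add: power_divide)
  qed
  have "distr (gauss {..p}) (vec_space p) (\<lambda>g. \<lambda>j\<in>{..<p}. g j / sqrt (real n))
      = (\<Pi>\<^sub>M j\<in>{..<p}. distr (gauss {..p}) borel (\<lambda>g. g j / sqrt (real n)))"
    using ind p unfolding vec_space_def
    by (subst (asm) indep_vars_iff_distr_eq_PiM') auto
  also have "\<dots> = design_law n p"
    unfolding design_law_def by (rule PiM_cong) (auto simp: dist)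
  finally show ?thesis .
qed

lemma obs_law_eq_distr:
  assumes n: "0 < n" and p: "0 < p"
  shows "obs_law n p \<sigma> \<beta> = distr (gauss {..p}) (obs_space p) (gauss_obs n p \<sigma> \<beta>)"
proof -
  interpret prob_space "gauss {..p}" by (rule prob_space_gauss)
  let ?X = "\<lambda>g::nat \<Rightarrow> real. \<lambda>j\<in>{..<p}. g j / sqrt (real n)"
  let ?Z = "\<lambda>g::nat \<Rightarrow> real. \<lambda>j\<in>{p}. g j"
  have "indep_var (vec_space p) ((\<lambda>g. \<lambda>j\<in>{..<p}. g j / sqrt (real n)) \<circ> (\<lambda>g. restrict (\<lambda>j. g j) {..<p}))
      (\<Pi>\<^sub>M j\<in>{p}. borel) ((\<lambda>g. g) \<circ> (\<lambda>g. restrict (\<lambda>j. g j) {p}))"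
    by (rule indep_var_compose [OF indep_var_restrict [OF indep_vars_gauss, of "{..<p}" "{p}"]])
      (auto simp: vec_space_def)
  then have ind: "indep_var (vec_space p) ?X (\<Pi>\<^sub>M j\<in>{p}. borel) ?Z"
    by (simp add: comp_def restrict_def cong: if_cong)
  have [measurable]: "?X \<in> gauss {..p} \<rightarrow>\<^sub>M vec_space p" using ind by (rule indep_var_rv1)
  have noise: "distr (gauss {..p}) borel (\<lambda>g. g p) = normal_distribution 0 1"
    using distributed_normal_distribution [OF distributed_gauss_component [of p "{..p}"]] by simp
  have "design_law n p \<Otimes>\<^sub>M normal_distribution 0 1
      = distr (gauss {..p}) (vec_space p \<Otimes>\<^sub>M borel) (\<lambda>g. (?X g, g p))"
  proof (rule pair_measure_eqI)
    show "sigma_finite_measure (design_law n p)"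
      unfolding design_law_eq_distr [OF n p, symmetric]
      by (intro prob_space_imp_sigma_finite prob_space_distr) simp
    show "sigma_finite_measure (normal_distribution 0 1)"
      by (rule prob_space_imp_sigma_finite [OF prob_space_std_normal])
    show "sets (design_law n p \<Otimes>\<^sub>M normal_distribution 0 1)
        = sets (distr (gauss {..p}) (vec_space p \<Otimes>\<^sub>M borel) (\<lambda>g. (?X g, g p)))"
      unfolding sets_distr by (rule sets_pair_measure_cong) simp_all
    fix A B assume "A \<in> sets (design_law n p)" and "B \<in> sets (normal_distribution 0 1)"
    then have A [measurable]: "A \<in> sets (vec_space p)" and B [measurable]: "B \<in> sets borel"
      by simp_all
    \<comment> \<open>Independence is available for restrictions to index sets, so the event for the
      noise is carried over to functions on the one-point set \<open>{p}\<close>.\<close>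
    let ?B = "{f \<in> space (\<Pi>\<^sub>M j\<in>{p}. borel :: real measure). f p \<in> B}"
    have B': "?B \<in> sets (\<Pi>\<^sub>M j\<in>{p}. borel :: real measure)" by measurable
    have "emeasure (distr (gauss {..p}) (vec_space p \<Otimes>\<^sub>M borel) (\<lambda>g. (?X g, g p))) (A \<times> B)
        = emeasure (gauss {..p}) ((\<lambda>g. (?X g, g p)) -` (A \<times> B) \<inter> space (gauss {..p}))"
      by (rule emeasure_distr) measurable
    also have "(\<lambda>g. (?X g, g p)) -` (A \<times> B) \<inter> space (gauss {..p})
        = (\<lambda>g. (?X g, ?Z g)) -` (A \<times> ?B) \<inter> space (gauss {..p})"
      by (auto simp: space_PiM)
    also have "emeasure (gauss {..p}) \<dots>
        = ennreal (prob (?X -` A \<inter> space (gauss {..p})) * prob (?Z -` ?B \<inter> space (gauss {..p})))"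
      using indep_varD [OF ind A B'] by (simp add: emeasure_eq_measure)
    also have "?Z -` ?B \<inter> space (gauss {..p}) = (\<lambda>g. g p) -` B \<inter> space (gauss {..p})"
      by (auto simp: space_PiM)
    also have "ennreal (prob (?X -` A \<inter> space (gauss {..p})) * prob ((\<lambda>g. g p) -` B \<inter> space (gauss {..p})))
        = emeasure (design_law n p) A * emeasure (normal_distribution 0 1) B"
      unfolding noise [symmetric] design_law_eq_distr [OF n p, symmetric]
      by (subst (1 2) emeasure_distr) (simp_all add: emeasure_eq_measure ennreal_mult)
    finally show "emeasure (design_law n p) A * emeasure (normal_distribution 0 1) B
        = emeasure (distr (gauss {..p}) (vec_space p \<Otimes>\<^sub>M borel) (\<lambda>g. (?X g, g p))) (A \<times> B)" ..
  qed
  then have "obs_law n p \<sigma> \<beta> = distr (distr (gauss {..p}) (vec_space p \<Otimes>\<^sub>M borel) (\<lambda>g. (?X g, g p)))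
      (obs_space p) (\<lambda>(x, z). ((\<Sum>j<p. x j * \<beta> j) + \<sigma> * z, x))"
    by (simp add: obs_law_def)
  also have "\<dots> = distr (gauss {..p}) (obs_space p)
      ((\<lambda>(x, z). ((\<Sum>j<p. x j * \<beta> j) + \<sigma> * z, x)) \<circ> (\<lambda>g. (?X g, g p)))"
    by (rule distr_distr) (unfold vec_space_def obs_space_def, measurable)
  also have "\<dots> = distr (gauss {..p}) (obs_space p) (gauss_obs n p \<sigma> \<beta>)"
    by (rule distr_cong) (auto simp: gauss_obs_def)
  finally show ?thesis .
qed

lemma sets_obs_law [measurable_cong, simp]: "sets (obs_law n p \<sigma> \<beta>) = sets (obs_space p)"
  by (simp add: obs_law_def)

lemma prob_space_obs_law: "0 < n \<Longrightarrow> 0 < p \<Longrightarrow> prob_space (obs_law n p \<sigma> \<beta>)"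
  unfolding obs_law_eq_distr
  by (rule prob_space.prob_space_distr [OF prob_space_gauss]) measurable

lemma sets_data_law [measurable_cong, simp]: "sets (data_law n p \<sigma> \<beta>) = sets (data_space n p)"
  unfolding data_law_def data_space_def by (rule sets_PiM_cong) auto

text \<open>The model is a product over observations, while the main arguments condition on columns.
  One Gaussian matrix allows both readings: its rows use disjoint sets of entries and are therefore
  independent.\<close>

lemma data_law_eq_distr:
  assumes n: "0 < n" and p: "0 < p"
  shows "data_law n p \<sigma> \<beta> = distr (gauss ({..<n} \<times> {..p})) (data_space n p) (gauss_data n p \<sigma> \<beta>)"
proof -
  let ?G = "gauss ({..<n} \<times> {..p}) :: (nat \<times> nat \<Rightarrow> real) measure"
  interpret prob_space ?G by (rule prob_space_gauss)
  let ?row = "\<lambda>i \<omega>. gauss_obs n p \<sigma> \<beta> (\<lambda>j. \<omega> (i, j))"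
  have disj: "disjoint_family_on (\<lambda>i. {i} \<times> {..p}) {..<n}" by (auto simp: disjoint_family_on_def)
  have ind0: "indep_vars (\<lambda>i. \<Pi>\<^sub>M c\<in>{i} \<times> {..p}. borel)
      (\<lambda>i \<omega>. restrict (\<lambda>c. \<omega> c) ({i} \<times> {..p})) {..<n}"
    by (rule indep_vars_restrict [OF indep_vars_gauss _ disj]) auto
  have m: "?row i \<in> (\<Pi>\<^sub>M c\<in>{i} \<times> {..p}. borel) \<rightarrow>\<^sub>M obs_space p" for i
    unfolding gauss_obs_def [abs_def] obs_space_def vec_space_def by measurable
  have "indep_vars (\<lambda>_. obs_space p)
      (\<lambda>i \<omega>. ?row i (restrict (\<lambda>c. \<omega> c) ({i} \<times> {..p}))) {..<n}"
    by (rule indep_vars_compose2 [OF ind0 m])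
  also have "(\<lambda>i \<omega>. ?row i (restrict (\<lambda>c. \<omega> c) ({i} \<times> {..p}))) = ?row"
    by (simp add: fun_eq_iff gauss_obs_def restrict_def)
  finally have ind: "indep_vars (\<lambda>_. obs_space p) ?row {..<n}" .
  have rv: "random_variable (obs_space p) (?row i)" if "i \<in> {..<n}" for i
    using ind that by (auto simp: indep_vars_def)
  have row_law: "distr ?G (obs_space p) (?row i) = obs_law n p \<sigma> \<beta>" if i: "i \<in> {..<n}" for i
  proof -
    have "obs_law n p \<sigma> \<beta> = distr (distr ?G (gauss {..p}) (\<lambda>\<omega>. \<lambda>j\<in>{..p}. \<omega> (i, j)))
        (obs_space p) (gauss_obs n p \<sigma> \<beta>)"
      using i by (subst distr_gauss_reindex) (auto simp: inj_on_def obs_law_eq_distr [OF n p])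
    also have "\<dots> = distr ?G (obs_space p) (gauss_obs n p \<sigma> \<beta> \<circ> (\<lambda>\<omega>. \<lambda>j\<in>{..p}. \<omega> (i, j)))"
      using i by (intro distr_distr) (auto simp: gauss_def intro!: measurable_restrict)
    also have "\<dots> = distr ?G (obs_space p) (?row i)"
      by (rule distr_cong) (auto simp: gauss_obs_def fun_eq_iff restrict_def)
    finally show ?thesis ..
  qed
  have "data_law n p \<sigma> \<beta> = (\<Pi>\<^sub>M i\<in>{..<n}. distr ?G (obs_space p) (?row i))"
    unfolding data_law_def by (rule PiM_cong) (auto simp: row_law)
  also have "\<dots> = distr ?G (\<Pi>\<^sub>M i\<in>{..<n}. obs_space p) (\<lambda>\<omega>. \<lambda>i\<in>{..<n}. ?row i \<omega>)"
    using ind n by (subst (asm) indep_vars_iff_distr_eq_PiM' [OF _ rv]) auto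
  finally show ?thesis by (simp add: data_space_def gauss_data_def [abs_def])
qed

lemma prob_space_data_law: "0 < n \<Longrightarrow> 0 < p \<Longrightarrow> prob_space (data_law n p \<sigma> \<beta>)"
  unfolding data_law_eq_distr
  by (rule prob_space.prob_space_distr [OF prob_space_gauss]) measurable

lemma nn_integral_data_law:
  assumes "0 < n" "0 < p" and [measurable]: "f \<in> borel_measurable (data_space n p)"
  shows "(\<integral>\<^sup>+d. f d \<partial>data_law n p \<sigma> \<beta>)
    = (\<integral>\<^sup>+\<omega>. f (gauss_data n p \<sigma> \<beta> \<omega>) \<partial>gauss ({..<n} \<times> {..p}))"
  unfolding data_law_eq_distr [OF assms(1,2)] by (rule nn_integral_distr) measurable

text \<open>Inserting the model for the response leaves a linear form in the normals, with
  coefficient \<open>(a * \<beta> j + c j) / sqrt n\<close> at design coordinate \<open>j\<close>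
  and \<open>a * \<sigma>\<close> at the noise. The choice \<open>a = 0\<close> gives a single
  design coordinate, \<open>a = 1\<close> and \<open>c = - b\<close> the residual at
  \<open>b\<close>; adding a unit vector to \<open>- b\<close> serves the polarization
  below.\<close>

lemma nn_integral_obs_law_linear:
  assumes n: "0 < n" and p: "0 < p" and [measurable]: "f \<in> borel_measurable borel"
    and v: "v = (a * \<sigma>)\<^sup>2 + (\<Sum>j<p. (a * \<beta> j + c j)\<^sup>2) / real n" and pos: "0 < v"
  shows "(\<integral>\<^sup>+r. f (a * fst r + (\<Sum>j<p. snd r j * c j)) \<partial>obs_law n p \<sigma> \<beta>)
    = (\<integral>\<^sup>+t. f t \<partial>normal_distribution 0 v)"
proof -
  define e where "e j = (if j = p then a * \<sigma> else (a * \<beta> j + c j) / sqrt (real n))" for j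
  have ve: "v = (\<Sum>j\<in>{..p}. (e j)\<^sup>2)"
    using n by (simp add: lessThan_Suc_atMost [symmetric] e_def v power_divide sum_divide_distrib)
  have lin: "a * fst (gauss_obs n p \<sigma> \<beta> g) + (\<Sum>j<p. snd (gauss_obs n p \<sigma> \<beta> g) j * c j)
      = (\<Sum>j\<in>{..p}. e j * g j)" for g
  proof -
    have "(\<Sum>j\<in>{..p}. e j * g j) = (\<Sum>j<p. (a * \<beta> j + c j) / sqrt (real n) * g j) + a * \<sigma> * g p"
      by (simp add: lessThan_Suc_atMost [symmetric] e_def)
    also have "(\<Sum>j<p. (a * \<beta> j + c j) / sqrt (real n) * g j)
        = a * (\<Sum>j<p. g j / sqrt (real n) * \<beta> j) + (\<Sum>j<p. g j / sqrt (real n) * c j)"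
      by (simp add: sum_distrib_left sum.distrib [symmetric] add_divide_distrib algebra_simps)
    finally show ?thesis by (simp add: gauss_obs_def algebra_simps)
  qed
  have [measurable]: "(\<lambda>r. f (a * fst r + (\<Sum>j<p. snd r j * c j))) \<in> borel_measurable (obs_space p)"
    unfolding obs_space_def vec_space_def by measurable
  have "(\<integral>\<^sup>+r. f (a * fst r + (\<Sum>j<p. snd r j * c j)) \<partial>obs_law n p \<sigma> \<beta>)
      = (\<integral>\<^sup>+g. f (\<Sum>j\<in>{..p}. e j * g j) \<partial>gauss {..p})"
    unfolding obs_law_eq_distr [OF n p] by (subst nn_integral_distr) (simp_all add: lin)
  also have "\<dots> = (\<integral>\<^sup>+t. f t \<partial>normal_distribution 0 v)"
    unfolding ve by (rule nn_integral_gauss_linear) (use pos ve in auto)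
  finally show ?thesis .
qed

section \<open>Concentration\<close>

text \<open>Injectivity of \<open>e\<close> makes the blocks disjoint, hence independent copies of
  \<open>gauss C\<close>. The use is one block per competing column, so that an expectation for one
  column is raised to the number of columns.\<close>

lemma nn_integral_gauss_blocks:
  assumes L: "finite L" and inj: "inj_on e (L \<times> C)" and e: "e \<in> L \<times> C \<rightarrow> I"
    and h [measurable]: "h \<in> borel_measurable (gauss C)"
  shows "(\<integral>\<^sup>+\<omega>. (\<Prod>l\<in>L. h (\<lambda>c\<in>C. \<omega> (e (l, c)))) \<partial>gauss I) = (\<integral>\<^sup>+g. h g \<partial>gauss C) ^ card L"
proof -
  interpret prob_space "gauss I" by (rule prob_space_gauss)
  let ?K = "\<lambda>l. e ` ({l} \<times> C)"
  have disj: "disjoint_family_on ?K L"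
    using inj by (auto simp: disjoint_family_on_def inj_on_def)
  have ind0: "indep_vars (\<lambda>l. \<Pi>\<^sub>M c\<in>?K l. borel) (\<lambda>l \<omega>. restrict (\<lambda>c. \<omega> c) (?K l)) L"
    by (rule indep_vars_restrict [OF indep_vars_gauss _ disj]) (use e in auto)
  have sel: "(\<lambda>g. \<lambda>c\<in>C. g (e (l, c))) \<in> (\<Pi>\<^sub>M c\<in>?K l. borel) \<rightarrow>\<^sub>M gauss C" for l
    unfolding gauss_def by (rule measurable_restrict) simp
  have m: "(\<lambda>g. h (\<lambda>c\<in>C. g (e (l, c)))) \<in> borel_measurable (\<Pi>\<^sub>M c\<in>?K l. borel)" for l
    by (rule measurable_compose [OF sel h])
  have "indep_vars (\<lambda>_. borel) (\<lambda>l \<omega>. h (\<lambda>c\<in>C. restrict (\<lambda>c. \<omega> c) (?K l) (e (l, c)))) L"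
    by (rule indep_vars_compose2 [OF ind0 m])
  also have "(\<lambda>l \<omega>. h (\<lambda>c\<in>C. restrict (\<lambda>c. \<omega> c) (?K l) (e (l, c)))) = (\<lambda>l \<omega>. h (\<lambda>c\<in>C. \<omega> (e (l, c))))"
    by (intro ext arg_cong [of _ _ h]) (auto simp: restrict_def)
  finally have ind: "indep_vars (\<lambda>_. borel) (\<lambda>l \<omega>. h (\<lambda>c\<in>C. \<omega> (e (l, c)))) L" .
  have "(\<integral>\<^sup>+\<omega>. (\<Prod>l\<in>L. h (\<lambda>c\<in>C. \<omega> (e (l, c)))) \<partial>gauss I)
      = (\<Prod>l\<in>L. (\<integral>\<^sup>+\<omega>. h (\<lambda>c\<in>C. \<omega> (e (l, c))) \<partial>gauss I))"
    by (rule indep_vars_nn_integral [OF L ind]) simp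
  also have "\<dots> = (\<Prod>l\<in>L. (\<integral>\<^sup>+g. h g \<partial>gauss C))"
  proof (rule prod.cong [OF refl])
    fix l assume l: "l \<in> L"
    have "(\<integral>\<^sup>+g. h g \<partial>gauss C) = (\<integral>\<^sup>+g. h g \<partial>distr (gauss I) (gauss C) (\<lambda>\<omega>. \<lambda>c\<in>C. \<omega> (e (l, c))))"
      using l e inj by (subst distr_gauss_reindex) (auto simp: inj_on_def)
    also have "\<dots> = (\<integral>\<^sup>+\<omega>. h (\<lambda>c\<in>C. \<omega> (e (l, c))) \<partial>gauss I)"
      using l e by (intro nn_integral_distr)
        (auto simp: gauss_def intro!: measurable_restrict measurable_component_singleton)
    finally show "(\<integral>\<^sup>+\<omega>. h (\<lambda>c\<in>C. \<omega> (e (l, c))) \<partial>gauss I) = (\<integral>\<^sup>+g. h g \<partial>gauss C)" ..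
  qed
  finally show ?thesis by simp
qed

lemma product_sigma_finite_prob: "prob_space M \<Longrightarrow> product_sigma_finite (\<lambda>_. M)"
  unfolding product_sigma_finite_def by (auto intro: prob_space_imp_sigma_finite)

lemma nn_integral_PiM_prod:
  assumes "prob_space M" "finite I" and "h \<in> borel_measurable M"
  shows "(\<integral>\<^sup>+x. (\<Prod>i\<in>I. h (x i)) \<partial>PiM I (\<lambda>_. M)) = (\<integral>\<^sup>+y. h y \<partial>M) ^ card I"
  using product_sigma_finite.product_nn_integral_prod
    [OF product_sigma_finite_prob [OF assms(1)] assms(2), of "\<lambda>_. h"] assms(3) by simp

lemma nn_integral_exp_square_rv:
  assumes l [measurable]: "l \<in> borel_measurable M" and law: "distr M borel l = normal_distribution 0 v"
    and v: "0 < v" and c: "2 * c * v < 1"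
  shows "(\<integral>\<^sup>+y. ennreal (exp (c * (l y)\<^sup>2)) \<partial>M) = ennreal (1 / sqrt (1 - 2 * c * v))"
  using nn_integral_exp_square_normal [OF v c] unfolding law [symmetric]
  by (subst (asm) nn_integral_distr) simp_all

text \<open>Leaving the sign of \<open>c\<close> open lets one Markov inequality serve both tails:
  for positive \<open>c\<close> the event is an excess over \<open>a\<close> per summand, for
  negative \<open>c\<close> a deficit.\<close>

lemma chernoff_sum_squares:
  assumes M: "prob_space M" and I: "finite I"
    and l [measurable]: "l \<in> borel_measurable M" and law: "distr M borel l = normal_distribution 0 v"
    and v: "0 < v" and c: "2 * c * v < 1"
  shows "emeasure (PiM I (\<lambda>_. M)) {x \<in> space (PiM I (\<lambda>_. M)). c * a * real (card I) \<le> c * (\<Sum>i\<in>I. (l (x i))\<^sup>2)}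
    \<le> ennreal (exp (- c * a) / sqrt (1 - 2 * c * v)) ^ card I"
proof -
  let ?P = "PiM I (\<lambda>_. M)"
  have [measurable]: "(\<lambda>x. l (x i)) \<in> borel_measurable ?P" if "i \<in> I" for i
    using that by measurable
  have [measurable]: "{x \<in> space ?P. c * a * real (card I) \<le> c * (\<Sum>i\<in>I. (l (x i))\<^sup>2)} \<in> sets ?P"
    using I by measurable
  have "emeasure ?P {x \<in> space ?P. c * a * real (card I) \<le> c * (\<Sum>i\<in>I. (l (x i))\<^sup>2)}
      = (\<integral>\<^sup>+x. indicator {x \<in> space ?P. c * a * real (card I) \<le> c * (\<Sum>i\<in>I. (l (x i))\<^sup>2)} x \<partial>?P)"
    by (rule nn_integral_indicator [symmetric]) measurable
  also have "\<dots> \<le> (\<integral>\<^sup>+x. (\<Prod>i\<in>I. ennreal (exp (- c * a)) * ennreal (exp (c * (l (x i))\<^sup>2))) \<partial>?P)"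
  proof (rule nn_integral_mono)
    fix x
    have "(\<Prod>i\<in>I. ennreal (exp (- c * a)) * ennreal (exp (c * (l (x i))\<^sup>2)))
        = ennreal (exp (c * (\<Sum>i\<in>I. (l (x i))\<^sup>2) - c * a * real (card I)))"
      using I by (simp add: ennreal_mult [symmetric] exp_add [symmetric] prod_ennreal exp_sum [symmetric]
          sum.distrib sum_distrib_left sum_subtractf algebra_simps)
    then show "indicator {x \<in> space ?P. c * a * real (card I) \<le> c * (\<Sum>i\<in>I. (l (x i))\<^sup>2)} x
        \<le> (\<Prod>i\<in>I. ennreal (exp (- c * a)) * ennreal (exp (c * (l (x i))\<^sup>2)))"
      by (auto split: split_indicator simp: ennreal_1 [symmetric] simp del: ennreal_1 intro!: ennreal_leI)
  qed
  also have "\<dots> = (\<integral>\<^sup>+y. ennreal (exp (- c * a)) * ennreal (exp (c * (l y)\<^sup>2)) \<partial>M) ^ card I"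
    by (rule nn_integral_PiM_prod [OF M I]) measurable
  also have "(\<integral>\<^sup>+y. ennreal (exp (- c * a)) * ennreal (exp (c * (l y)\<^sup>2)) \<partial>M)
      = ennreal (exp (- c * a) / sqrt (1 - 2 * c * v))"
    using c by (subst nn_integral_cmult)
      (simp_all add: nn_integral_exp_square_rv [OF l law v c] ennreal_mult' [symmetric])
  finally show ?thesis .
qed

text \<open>The Cramer factor per summand for the chi-square law: its logarithm is
  \<open>- (\<delta> - ln (1 + \<delta>)) / 2\<close>, the negative large deviation rate at
  \<open>1 + \<delta>\<close>. Negative arguments encode the lower tail.\<close>

definition chisq_rate :: "real \<Rightarrow> real" where
  "chisq_rate \<delta> = sqrt ((1 + \<delta>) * exp (- \<delta>))"

lemma chisq_upper:
  assumes M: "prob_space M" and I: "finite I"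
    and l: "l \<in> borel_measurable M" and law: "distr M borel l = normal_distribution 0 v"
    and v: "0 < v" and d: "0 < \<delta>"
  shows "emeasure (PiM I (\<lambda>_. M))
      {x \<in> space (PiM I (\<lambda>_. M)). (1 + \<delta>) * v * real (card I) \<le> (\<Sum>i\<in>I. (l (x i))\<^sup>2)}
    \<le> ennreal (chisq_rate \<delta> ^ card I)"
proof -
  \<comment> \<open>The minimizer of
    \<open>exp (- c * (1 + \<delta>) * v) / sqrt (1 - 2 * c * v)\<close>, characterized by
    \<open>1 - 2 * c * v = 1 / (1 + \<delta>)\<close>. The lower tail uses the same formula at
    \<open>- \<delta>\<close>.\<close>
  define c where "c = \<delta> / (2 * v * (1 + \<delta>))"
  have c: "0 < c" "2 * c * v = \<delta> / (1 + \<delta>)" using v d by (simp_all add: c_def)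
  have c1: "2 * c * v < 1" using d by (simp add: c)
  have ca: "c * ((1 + \<delta>) * v) = \<delta> / 2" using v d by (simp add: c_def)
  have "1 - 2 * c * v = 1 / (1 + \<delta>)" unfolding c(2) using d by (simp add: field_simps)
  moreover have "- c * ((1 + \<delta>) * v) = - \<delta> / 2" using ca by linarith
  ultimately have "exp (- c * ((1 + \<delta>) * v)) / sqrt (1 - 2 * c * v) = exp (- \<delta> / 2) * sqrt (1 + \<delta>)"
    by (simp add: real_sqrt_divide)
  also have "exp (- \<delta> / 2) = sqrt (exp (- \<delta>))"
    by (rule real_sqrt_unique [symmetric]) (auto simp: power2_eq_square exp_add [symmetric])
  finally have rate: "exp (- c * ((1 + \<delta>) * v)) / sqrt (1 - 2 * c * v) = chisq_rate \<delta>"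
    by (simp add: chisq_rate_def real_sqrt_mult [symmetric] mult.commute)
  have r0: "0 \<le> chisq_rate \<delta>" using d by (simp add: chisq_rate_def)
  show ?thesis
    using chernoff_sum_squares [OF M I l law v c1, of "(1 + \<delta>) * v"] c(1) r0
    unfolding rate by (simp add: ennreal_power mult.assoc)
qed

lemma chisq_lower:
  assumes M: "prob_space M" and I: "finite I"
    and l: "l \<in> borel_measurable M" and law: "distr M borel l = normal_distribution 0 v"
    and v: "0 < v" and d: "0 < \<delta>" "\<delta> < 1"
  shows "emeasure (PiM I (\<lambda>_. M))
      {x \<in> space (PiM I (\<lambda>_. M)). (\<Sum>i\<in>I. (l (x i))\<^sup>2) \<le> (1 - \<delta>) * v * real (card I)}
    \<le> ennreal (chisq_rate (- \<delta>) ^ card I)"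
proof -
  define c where "c = - (\<delta> / (2 * v * (1 - \<delta>)))"
  have c: "c < 0" "2 * c * v = - (\<delta> / (1 - \<delta>))" using v d by (simp_all add: c_def)
  have c1: "2 * c * v < 1"
  proof -
    have "2 * c * v \<le> 0" unfolding c(2) using d by simp
    then show ?thesis by simp
  qed
  have ca: "c * ((1 - \<delta>) * v) = - \<delta> / 2" using v d by (simp add: c_def)
  have "1 - 2 * c * v = 1 / (1 - \<delta>)" unfolding c(2) using d by (simp add: field_simps)
  moreover have "- c * ((1 - \<delta>) * v) = \<delta> / 2" using ca by linarith
  ultimately have "exp (- c * ((1 - \<delta>) * v)) / sqrt (1 - 2 * c * v) = exp (\<delta> / 2) * sqrt (1 - \<delta>)"
    by (simp add: real_sqrt_divide)
  also have "exp (\<delta> / 2) = sqrt (exp \<delta>)"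
    by (rule real_sqrt_unique [symmetric]) (auto simp: power2_eq_square exp_add [symmetric])
  finally have rate: "exp (- c * ((1 - \<delta>) * v)) / sqrt (1 - 2 * c * v) = chisq_rate (- \<delta>)"
    by (simp add: chisq_rate_def real_sqrt_mult [symmetric] mult.commute)
  have r0: "0 \<le> chisq_rate (- \<delta>)" using d by (simp add: chisq_rate_def)
  show ?thesis
    using chernoff_sum_squares [OF M I l law v c1, of "(1 - \<delta>) * v"] c(1) r0
    unfolding rate by (simp add: ennreal_power mult.assoc)
qed

lemma chisq_rate_nonneg: "- 1 \<le> \<delta> \<Longrightarrow> 0 \<le> chisq_rate \<delta>"
  by (simp add: chisq_rate_def)

lemma chisq_rate_less_1:
  assumes "- 1 \<le> \<delta>" "\<delta> \<noteq> 0"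
  shows "chisq_rate \<delta> < 1"
proof -
  \<comment> \<open>The surplus \<open>\<delta>\<^sup>2 / 4\<close> provides strictness; the weak
    exponential bound is then needed only at \<open>\<delta> / 2\<close>, where
    \<open>1 + \<delta> / 2\<close> is nonnegative and can be squared.\<close>
  have "1 + \<delta> < (1 + \<delta> / 2)\<^sup>2" using assms by (simp add: power2_sum power_divide)
  also have "\<dots> \<le> (exp (\<delta> / 2))\<^sup>2" using assms by (intro power_mono exp_ge_add_one_self) auto
  also have "\<dots> = exp \<delta>" by (simp add: exp_double [symmetric])
  finally have "1 + \<delta> < exp \<delta>" .
  then have "(1 + \<delta>) * exp (- \<delta>) < exp \<delta> * exp (- \<delta>)" by simp
  then show ?thesis by (simp add: chisq_rate_def exp_minus)
qed

section \<open>Second moments of centered sums and of correlations with residuals\<close>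

lemma nn_integral_square_shift:
  assumes M: "prob_space M" and f: "integrable M f" "integral\<^sup>L M f = 0"
    and f2: "integrable M (\<lambda>y. (f y)\<^sup>2)"
  shows "(\<integral>\<^sup>+y. ennreal ((s + f y)\<^sup>2) \<partial>M) = ennreal (s\<^sup>2) + (\<integral>\<^sup>+y. ennreal ((f y)\<^sup>2) \<partial>M)"
proof -
  interpret prob_space M by fact
  have eq: "(\<lambda>y. (s + f y)\<^sup>2) = (\<lambda>y. s\<^sup>2 + 2 * s * f y + (f y)\<^sup>2)" by (simp add: power2_sum fun_eq_iff)
  have i: "integrable M (\<lambda>y. (s + f y)\<^sup>2)" unfolding eq using f f2 by simp
  have "integral\<^sup>L M (\<lambda>y. (s + f y)\<^sup>2) = s\<^sup>2 + integral\<^sup>L M (\<lambda>y. (f y)\<^sup>2)"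
    unfolding eq using f f2 by (simp add: prob_space)
  then show ?thesis
    using i f2 by (simp add: nn_integral_eq_integral ennreal_plus)
qed

lemma nn_integral_centered_sum_square:
  assumes M: "prob_space M" and f: "integrable M f" "integral\<^sup>L M f = 0"
    and f2: "integrable M (\<lambda>y. (f y)\<^sup>2)" and I: "finite I"
  shows "(\<integral>\<^sup>+x. ennreal ((\<Sum>i\<in>I. f (x i))\<^sup>2) \<partial>PiM I (\<lambda>_. M))
    = of_nat (card I) * (\<integral>\<^sup>+y. ennreal ((f y)\<^sup>2) \<partial>M)"
  using I
proof induction
  case empty
  then show ?case by simp
next
  case (insert j I)
  have [measurable]: "f \<in> borel_measurable M" using f by auto
  have "(\<integral>\<^sup>+x. ennreal ((\<Sum>i\<in>insert j I. f (x i))\<^sup>2) \<partial>PiM (insert j I) (\<lambda>_. M))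
      = (\<integral>\<^sup>+x. (\<integral>\<^sup>+y. ennreal ((\<Sum>i\<in>insert j I. f ((x(j := y)) i))\<^sup>2) \<partial>M) \<partial>PiM I (\<lambda>_. M))"
    using insert.hyps
    by (intro product_sigma_finite.product_nn_integral_insert [OF product_sigma_finite_prob [OF M]]) measurable
  also have "\<dots> = (\<integral>\<^sup>+x. (\<integral>\<^sup>+y. ennreal (((\<Sum>i\<in>I. f (x i)) + f y)\<^sup>2) \<partial>M) \<partial>PiM I (\<lambda>_. M))"
  proof -
    have "(\<Sum>i\<in>insert j I. f ((x(j := y)) i)) = (\<Sum>i\<in>I. f (x i)) + f y" for x :: "'b \<Rightarrow> 'a" and y
    proof -
      have "(\<Sum>i\<in>I. f ((x(j := y)) i)) = (\<Sum>i\<in>I. f (x i))"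
        using insert.hyps by (intro sum.cong) auto
      then show ?thesis using insert.hyps by simp
    qed
    then show ?thesis by simp
  qed
  also have "\<dots> = (\<integral>\<^sup>+x. ennreal ((\<Sum>i\<in>I. f (x i))\<^sup>2) + (\<integral>\<^sup>+y. ennreal ((f y)\<^sup>2) \<partial>M) \<partial>PiM I (\<lambda>_. M))"
    by (simp add: nn_integral_square_shift [OF M f f2])
  also have "\<dots> = (\<integral>\<^sup>+x. ennreal ((\<Sum>i\<in>I. f (x i))\<^sup>2) \<partial>PiM I (\<lambda>_. M)) + (\<integral>\<^sup>+y. ennreal ((f y)\<^sup>2) \<partial>M)"
    using insert.hyps prob_space.emeasure_space_1 [OF prob_space_PiM [of I "\<lambda>_. M"]] M
    by (subst nn_integral_add) auto
  finally show ?case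
    using insert by (simp add: algebra_simps)
qed

lemma measurable_obs_linear [measurable]:
  "(\<lambda>r. a * fst r + (\<Sum>j<p. snd r j * c j)) \<in> borel_measurable (obs_space p)"
  unfolding obs_space_def vec_space_def by measurable

lemma measurable_obs_coord: "j < p \<Longrightarrow> (\<lambda>r. snd r j) \<in> borel_measurable (obs_space p)"
  unfolding obs_space_def vec_space_def by measurable

lemma distr_obs_law_linear:
  assumes n: "0 < n" and p: "0 < p"
    and v: "v = (a * \<sigma>)\<^sup>2 + (\<Sum>j<p. (a * \<beta> j + c j)\<^sup>2) / real n" and pos: "0 < v"
  shows "distr (obs_law n p \<sigma> \<beta>) borel (\<lambda>r. a * fst r + (\<Sum>j<p. snd r j * c j)) = normal_distribution 0 v"
proof (rule measure_eqI)
  fix A assume "A \<in> sets (distr (obs_law n p \<sigma> \<beta>) borel (\<lambda>r. a * fst r + (\<Sum>j<p. snd r j * c j)))"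
  then have A [measurable]: "A \<in> sets borel" by simp
  have "emeasure (distr (obs_law n p \<sigma> \<beta>) borel (\<lambda>r. a * fst r + (\<Sum>j<p. snd r j * c j))) A
      = (\<integral>\<^sup>+t. indicator A t \<partial>distr (obs_law n p \<sigma> \<beta>) borel (\<lambda>r. a * fst r + (\<Sum>j<p. snd r j * c j)))"
    by simp
  also have "\<dots> = (\<integral>\<^sup>+r. indicator A (a * fst r + (\<Sum>j<p. snd r j * c j)) \<partial>obs_law n p \<sigma> \<beta>)"
    by (rule nn_integral_distr) simp_all
  also have "\<dots> = (\<integral>\<^sup>+t. indicator A t \<partial>normal_distribution 0 v)"
    by (rule nn_integral_obs_law_linear [OF n p _ v pos]) simp
  finally show "emeasure (distr (obs_law n p \<sigma> \<beta>) borel (\<lambda>r. a * fst r + (\<Sum>j<p. snd r j * c j))) A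
      = emeasure (normal_distribution 0 v) A"
    by simp
qed simp

lemma distr_obs_law_coord:
  assumes n: "0 < n" and p: "0 < p" and j: "j < p"
  shows "distr (obs_law n p \<sigma> \<beta>) borel (\<lambda>r. snd r j) = normal_distribution 0 (1 / real n)"
proof -
  have "(\<Sum>l<p. snd r l * (if l = j then 1 else 0)) = snd r j" for r :: "real \<times> (nat \<Rightarrow> real)"
    using j by (simp add: if_distrib [of "\<lambda>x. _ * x"] sum.delta cong: if_cong)
  moreover have "(\<Sum>l<p. (if l = j then 1 else 0 :: real)\<^sup>2) = 1"
    using j by (simp add: if_distrib [of "\<lambda>x. x\<^sup>2"] sum.delta cong: if_cong)
  ultimately show ?thesis
    using distr_obs_law_linear [OF n p, of "1 / real n" 0 \<sigma> \<beta> "\<lambda>l. if l = j then 1 else 0"] n by simp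
qed

lemma normal_rv_moments:
  assumes X [measurable]: "X \<in> borel_measurable M" and law: "distr M borel X = normal_distribution 0 v"
    and v: "0 < v"
  shows "integrable M (\<lambda>y. (X y)\<^sup>2)" "integral\<^sup>L M (\<lambda>y. (X y)\<^sup>2) = v"
    "(\<integral>\<^sup>+y. ennreal ((X y)\<^sup>2) \<partial>M) = ennreal v"
    "integrable M (\<lambda>y. (X y) ^ 4)" "integral\<^sup>L M (\<lambda>y. (X y) ^ 4) = 3 * v\<^sup>2"
proof -
  show 2: "(\<integral>\<^sup>+y. ennreal ((X y)\<^sup>2) \<partial>M) = ennreal v"
    using nn_integral_normal_square [OF v] unfolding law [symmetric]
    by (subst (asm) nn_integral_distr) simp_all
  have 4: "(\<integral>\<^sup>+y. ennreal ((X y) ^ 4) \<partial>M) = ennreal (3 * v\<^sup>2)"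
    using nn_integral_normal_fourth [OF v] unfolding law [symmetric]
    by (subst (asm) nn_integral_distr) simp_all
  show "integrable M (\<lambda>y. (X y)\<^sup>2)" "integrable M (\<lambda>y. (X y) ^ 4)"
    using 2 4 by (auto intro!: integrableI_nonneg)
  show "integral\<^sup>L M (\<lambda>y. (X y)\<^sup>2) = v" "integral\<^sup>L M (\<lambda>y. (X y) ^ 4) = 3 * v\<^sup>2"
    using v 2 4 by (auto intro!: integral_eq_nn_integral [THEN trans])
qed

text \<open>Polarization reduces the moments of a product of jointly Gaussian variables to univariate ones.\<close>

lemma normal_product_moments:
  assumes M: "prob_space M"
    and X [measurable]: "X \<in> borel_measurable M" and W [measurable]: "W \<in> borel_measurable M"
    and lawX: "distr M borel X = normal_distribution 0 u"
    and lawW: "distr M borel W = normal_distribution 0 v"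
    and lawXW: "distr M borel (\<lambda>y. X y + W y) = normal_distribution 0 (u + v + 2 * m)"
    and pos: "0 < u" "0 < v" "0 < u + v + 2 * m"
  shows "integrable M (\<lambda>y. X y * W y - m)" "integral\<^sup>L M (\<lambda>y. X y * W y - m) = 0"
    "integrable M (\<lambda>y. (X y * W y - m)\<^sup>2)"
    "(\<integral>\<^sup>+y. ennreal ((X y * W y - m)\<^sup>2) \<partial>M) \<le> ennreal (3 * u * v)"
proof -
  interpret prob_space M by fact
  note mX = normal_rv_moments [OF X lawX pos(1)]
  note mW = normal_rv_moments [OF W lawW pos(2)]
  have XW: "(\<lambda>y. X y + W y) \<in> borel_measurable M" by measurable
  note mS = normal_rv_moments [OF XW lawXW pos(3)]
  have pol: "(\<lambda>y. X y * W y) = (\<lambda>y. ((X y + W y)\<^sup>2 - (X y)\<^sup>2 - (W y)\<^sup>2) / 2)"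
    by (simp add: fun_eq_iff power2_sum)
  have i1: "integrable M (\<lambda>y. X y * W y)" unfolding pol using mX mW mS by simp
  have e1: "integral\<^sup>L M (\<lambda>y. X y * W y) = m" unfolding pol using mX mW mS by simp
  show "integrable M (\<lambda>y. X y * W y - m)" "integral\<^sup>L M (\<lambda>y. X y * W y - m) = 0"
    using i1 e1 by (simp_all add: prob_space)
  \<comment> \<open>A weighted arithmetic-geometric mean majorant of
    \<open>(X y * W y)\<^sup>2\<close>. The weights \<open>v / u\<close> and \<open>u / v\<close>
    give both terms the same mean \<open>3 * u * v\<close>.\<close>
  let ?B = "\<lambda>y. (v / u * (X y) ^ 4 + u / v * (W y) ^ 4) / 2"
  have iB: "integrable M ?B" using mX mW by simp
  have eB: "integral\<^sup>L M ?B = 3 * u * v"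
    using mX mW pos by (simp add: power2_eq_square)
  have le: "(X y * W y)\<^sup>2 \<le> ?B y" for y
  proof -
    have "0 \<le> (sqrt (v / u) * (X y)\<^sup>2 - sqrt (u / v) * (W y)\<^sup>2)\<^sup>2" by simp
    also have "\<dots> = v / u * (X y) ^ 4 + u / v * (W y) ^ 4 - 2 * (sqrt (v / u) * sqrt (u / v)) * (X y * W y)\<^sup>2"
      using pos by (simp add: power2_diff power_mult_distrib power_mult [symmetric] mult_ac)
    also have "sqrt (v / u) * sqrt (u / v) = 1" using pos by (simp add: real_sqrt_mult [symmetric])
    finally show ?thesis by simp
  qed
  have i2: "integrable M (\<lambda>y. (X y * W y)\<^sup>2)"
  proof (rule Bochner_Integration.integrable_bound [OF iB])
    show "AE y in M. norm ((X y * W y)\<^sup>2) \<le> norm (?B y)"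
      using le by (intro AE_I2) (metis abs_ge_self norm_power order_trans power2_abs real_norm_def)
  qed measurable
  have sq: "(\<lambda>y. (X y * W y - m)\<^sup>2) = (\<lambda>y. (X y * W y)\<^sup>2 - 2 * m * (X y * W y) + m\<^sup>2)"
    by (simp add: fun_eq_iff power2_diff algebra_simps)
  show i3: "integrable M (\<lambda>y. (X y * W y - m)\<^sup>2)" unfolding sq using i1 i2 by simp
  have "integral\<^sup>L M (\<lambda>y. (X y * W y - m)\<^sup>2) = integral\<^sup>L M (\<lambda>y. (X y * W y)\<^sup>2) - m\<^sup>2"
    unfolding sq using i1 i2 e1 by (simp add: prob_space power2_eq_square)
  also have "\<dots> \<le> integral\<^sup>L M ?B"
    using integral_mono [OF i2 iB le] zero_le_power2 [of m] by linarith
  finally have "integral\<^sup>L M (\<lambda>y. (X y * W y - m)\<^sup>2) \<le> 3 * u * v" unfolding eB .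
  then show "(\<integral>\<^sup>+y. ennreal ((X y * W y - m)\<^sup>2) \<partial>M) \<le> ennreal (3 * u * v)"
    using i3 by (simp add: nn_integral_eq_integral ennreal_leI)
qed

text \<open>Column \<open>j\<close> and the residual at \<open>b\<close> are jointly Gaussian with
  covariance \<open>(\<beta> j - b j) / n\<close>, so \<open>n\<close> times their average product
  is an unbiased estimate of \<open>\<beta> j - b j\<close>. Polarization needs the law of their
  sum, which is again a linear form, with coefficients \<open>?e l - b l\<close>.\<close>

lemma obs_correlation_moments:
  fixes \<beta> b :: "nat \<Rightarrow> real"
  assumes n: "0 < n" and j: "j < p" and \<sigma>: "0 < \<sigma>"
    and v: "v = \<sigma>\<^sup>2 + (\<Sum>l<p. (\<beta> l - b l)\<^sup>2) / real n"
  defines "\<xi> \<equiv> \<lambda>r. snd r j * (fst r - (\<Sum>l<p. snd r l * b l)) - (\<beta> j - b j) / real n"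
  shows "integrable (obs_law n p \<sigma> \<beta>) \<xi>" "integral\<^sup>L (obs_law n p \<sigma> \<beta>) \<xi> = 0"
    "integrable (obs_law n p \<sigma> \<beta>) (\<lambda>r. (\<xi> r)\<^sup>2)"
    "(\<integral>\<^sup>+r. ennreal ((\<xi> r)\<^sup>2) \<partial>obs_law n p \<sigma> \<beta>) \<le> ennreal (3 * v / real n)"
proof -
  have p: "0 < p" using j by simp
  let ?L = "obs_law n p \<sigma> \<beta>"
  let ?X = "\<lambda>r :: real \<times> (nat \<Rightarrow> real). snd r j"
  let ?W = "\<lambda>r :: real \<times> (nat \<Rightarrow> real). fst r - (\<Sum>l<p. snd r l * b l)"
  let ?m = "(\<beta> j - b j) / real n"
  let ?e = "\<lambda>l. if l = j then 1 else 0 :: real"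
  have v0: "0 < v" unfolding v using \<sigma>
    by (intro add_pos_nonneg divide_nonneg_nonneg sum_nonneg) auto
  have Wm: "?W \<in> borel_measurable ?L"
    using measurable_obs_linear [where a=1 and p=p and c="\<lambda>l. - b l"] by (simp add: sum_negf cong: measurable_cong_sets)
  have Xm: "?X \<in> borel_measurable ?L"
    using measurable_obs_coord [OF j] by (simp cong: measurable_cong_sets)
  have lawX: "distr ?L borel ?X = normal_distribution 0 (1 / real n)"
    by (rule distr_obs_law_coord [OF n p j])
  have lawW: "distr ?L borel ?W = normal_distribution 0 v"
    using distr_obs_law_linear [OF n p, of v 1 \<sigma> \<beta> "\<lambda>l. - b l"] v v0 by (simp add: sum_negf)
  have v': "1 / real n + v + 2 * ?m = \<sigma>\<^sup>2 + (\<Sum>l<p. (\<beta> l + (?e l - b l))\<^sup>2) / real n"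
  proof -
    have "(\<Sum>l<p. (\<beta> l + (?e l - b l))\<^sup>2) = (\<Sum>l<p. (\<beta> l - b l)\<^sup>2 + (if l = j then 2 * (\<beta> l - b l) + 1 else 0))"
      by (rule sum.cong) (auto simp: power2_eq_square algebra_simps)
    also have "\<dots> = (\<Sum>l<p. (\<beta> l - b l)\<^sup>2) + (2 * (\<beta> j - b j) + 1)"
      using j by (simp add: sum.distrib)
    finally show ?thesis by (simp add: v add_divide_distrib)
  qed
  have v'0: "0 < 1 / real n + v + 2 * ?m"
    unfolding v' using \<sigma> by (intro add_pos_nonneg divide_nonneg_nonneg sum_nonneg) auto
  have lin: "(\<Sum>l<p. snd r l * (?e l - b l)) = snd r j - (\<Sum>l<p. snd r l * b l)" for r :: "real \<times> (nat \<Rightarrow> real)"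
    using j by (simp add: right_diff_distrib sum_subtractf if_distrib [of "\<lambda>x. _ * x"] cong: if_cong)
  have lawXW: "distr ?L borel (\<lambda>r. ?X r + ?W r) = normal_distribution 0 (1 / real n + v + 2 * ?m)"
  proof -
    have "(\<lambda>r. ?X r + ?W r) = (\<lambda>r. 1 * fst r + (\<Sum>l<p. snd r l * (?e l - b l)))"
      unfolding lin by (simp add: fun_eq_iff)
    then show ?thesis
      using distr_obs_law_linear [OF n p _ v'0, of 1 \<sigma> \<beta> "\<lambda>l. ?e l - b l"] v' by simp
  qed
  have n1: "0 < 1 / real n" using n by simp
  note * = normal_product_moments [OF prob_space_obs_law [OF n p] Xm Wm lawX lawW lawXW n1 v0 v'0]
  show "integrable ?L \<xi>" "integral\<^sup>L ?L \<xi> = 0" "integrable ?L (\<lambda>r. (\<xi> r)\<^sup>2)"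
    unfolding \<xi>_def by (rule *)+
  show "(\<integral>\<^sup>+r. ennreal ((\<xi> r)\<^sup>2) \<partial>?L) \<le> ennreal (3 * v / real n)"
    using *(4) unfolding \<xi>_def by (simp add: mult_ac)
qed

section \<open>A spike cannot be told apart from its competitors\<close>

text \<open>The bound of \<open>normal_tail_lower\<close> at the level a competitor has to reach,
  minus the probability that the competing column is too long. \<open>K\<close> bounds the
  correlation of noise and true column, \<delta> the relative deviations of the norms.\<close>

definition confusion_prob :: "nat \<Rightarrow> real \<Rightarrow> real \<Rightarrow> real \<Rightarrow> real" where
  "confusion_prob n \<mu> K \<delta> =
     exp (- (((K + \<mu> * (1 + \<delta>)) / sqrt (1 - \<delta>) + 1)\<^sup>2) / 2) / sqrt (2 * pi) - chisq_rate \<delta> ^ n"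

text \<open>Noise \<open>z\<close> and true column \<open>x\<close> are fixed, only the competitor
  \<open>w\<close> is random. With \<open>r = z + \<mu> * x\<close> the residual after the swap is
  \<open>\<sigma>\<close> times \<open>r - \<mu> * w / sqrt n\<close>. Expanding the squares, the
  swap fits as well once the inner product of \<open>r\<close> with \<open>w / sqrt n\<close>
  reaches \<open>K + \<mu> * (1 + \<delta>)\<close> and \<open>w\<close> is not too long. That inner
  product is centered normal with variance \<open>V\<close>, which is at least
  \<open>1 - \<delta>\<close>.\<close>

lemma confusion_prob_le:
  fixes z x :: "nat \<Rightarrow> real"
  assumes n: "0 < n" and \<sigma>: "0 < \<sigma>" and \<tau>: "0 < \<tau>" and \<mu>: "\<mu> = \<tau> / \<sigma>" and d: "0 < \<delta>" "\<delta> < 1" and K: "0 \<le> K"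
    and good: "(\<Sum>i<n. z i * x i) \<le> K" "(\<Sum>i<n. (x i)\<^sup>2) \<le> 1 + \<delta>"
      "(1 - \<delta>) * real n \<le> (\<Sum>i<n. (z i + \<mu> * x i)\<^sup>2)"
  shows "ennreal (confusion_prob n \<mu> K \<delta>) \<le> emeasure (gauss {..<n})
    {w \<in> space (gauss {..<n}). (\<Sum>i<n. (\<sigma> * z i + \<tau> * (x i - w i / sqrt (real n)))\<^sup>2) \<le> (\<Sum>i<n. (\<sigma> * z i)\<^sup>2)}"
    (is "_ \<le> emeasure _ ?E")
proof -
  interpret prob_space "gauss {..<n}" by (rule prob_space_gauss)
  let ?S = "space (gauss {..<n})"
  define r where "r i = z i + \<mu> * x i" for i
  define V where "V = (\<Sum>i<n. (r i / sqrt (real n))\<^sup>2)"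
  define s where "s = (K + \<mu> * (1 + \<delta>)) / sqrt (1 - \<delta>)"
  have \<mu>0: "0 < \<mu>" using \<sigma> \<tau> by (simp add: \<mu>)
  have s0: "0 \<le> s" using K d \<mu>0 by (simp add: s_def)
  have Veq: "V = (\<Sum>i<n. (r i)\<^sup>2) / real n" by (simp add: V_def power_divide sum_divide_distrib)
  have V1: "1 - \<delta> \<le> V" using good(3) n by (simp add: Veq r_def pos_le_divide_eq)
  then have V0: "0 < V" using d by simp
  let ?A = "{w \<in> ?S. s * sqrt V \<le> (\<Sum>i<n. r i / sqrt (real n) * w i)}"
  let ?B = "{w \<in> ?S. (1 + \<delta>) * 1 * real (card {..<n}) \<le> (\<Sum>i<n. (w i)\<^sup>2)}"
  have [measurable]: "?A \<in> events" "?B \<in> events" "?E \<in> events" by measurable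
  have tail: "ennreal (exp (- ((s + 1)\<^sup>2) / 2) / sqrt (2 * pi)) \<le> emeasure (gauss {..<n}) ?A"
  proof -
    have "emeasure (gauss {..<n}) ?A = emeasure (distr (gauss {..<n}) borel (\<lambda>w. \<Sum>i<n. r i / sqrt (real n) * w i)) {t. s * sqrt V \<le> t}"
      by (subst emeasure_distr) (auto intro!: arg_cong2 [of _ _ _ _ emeasure])
    also have "\<dots> = emeasure (normal_distribution 0 V) {t. s * sqrt V \<le> t}"
      unfolding V_def by (subst distr_gauss_linear) (use V0 V_def in auto)
    finally show ?thesis using normal_tail_lower [OF V0 s0] by simp
  qed
  have large: "emeasure (gauss {..<n}) ?B \<le> ennreal (chisq_rate \<delta> ^ n)"
    using chisq_upper [OF prob_space_std_normal, of "{..<n}" "\<lambda>x. x" 1 \<delta>] d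
    by (simp add: gauss_def distr_id2)
  have sub: "?A \<subseteq> ?E \<union> ?B"
  proof (rule subsetI)
    fix w assume w: "w \<in> ?A"
    show "w \<in> ?E \<union> ?B"
    proof (cases "w \<in> ?B")
      case False
      with w have w2: "(\<Sum>i<n. (w i)\<^sup>2) / real n \<le> 1 + \<delta>"
        using n by (simp add: pos_divide_le_eq)
      have "K + \<mu> * (1 + \<delta>) = s * sqrt (1 - \<delta>)" using d by (simp add: s_def)
      also have "\<dots> \<le> s * sqrt V" using s0 V1 by (intro mult_left_mono) auto
      also have "\<dots> \<le> (\<Sum>i<n. r i / sqrt (real n) * w i)" using w by simp
      finally have rw: "K + \<mu> * (1 + \<delta>) \<le> (\<Sum>i<n. r i * (w i / sqrt (real n)))" by simp
      have e1: "(\<Sum>i<n. (\<sigma> * z i + \<tau> * (x i - w i / sqrt (real n)))\<^sup>2)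
          = \<sigma>\<^sup>2 * (\<Sum>i<n. (r i - \<mu> * (w i / sqrt (real n)))\<^sup>2)"
      proof -
        have "\<sigma> * z i + \<tau> * (x i - w i / sqrt (real n)) = \<sigma> * (r i - \<mu> * (w i / sqrt (real n)))" for i
          using \<sigma> by (simp add: r_def \<mu> field_simps)
        then show ?thesis by (simp only: power_mult_distrib sum_distrib_left)
      qed
      have e2: "(\<Sum>i<n. (r i - \<mu> * (w i / sqrt (real n)))\<^sup>2)
          = (\<Sum>i<n. (r i)\<^sup>2) - 2 * \<mu> * (\<Sum>i<n. r i * (w i / sqrt (real n))) + \<mu>\<^sup>2 * ((\<Sum>i<n. (w i)\<^sup>2) / real n)"
        by (simp add: power2_diff power_mult_distrib power_divide sum.distrib sum_subtractf sum_distrib_left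
            sum_divide_distrib mult_ac)
      have e3: "(\<Sum>i<n. (r i)\<^sup>2) = (\<Sum>i<n. (z i)\<^sup>2) + 2 * \<mu> * (\<Sum>i<n. z i * x i) + \<mu>\<^sup>2 * (\<Sum>i<n. (x i)\<^sup>2)"
        by (simp add: r_def power2_sum power_mult_distrib sum.distrib sum_distrib_left mult_ac)
      have "2 * \<mu> * (\<Sum>i<n. z i * x i) \<le> 2 * \<mu> * K" using good(1) \<mu>0 by (intro mult_left_mono) auto
      moreover have "\<mu>\<^sup>2 * (\<Sum>i<n. (x i)\<^sup>2) \<le> \<mu>\<^sup>2 * (1 + \<delta>)" using good(2) by (intro mult_left_mono) auto
      moreover have "\<mu>\<^sup>2 * ((\<Sum>i<n. (w i)\<^sup>2) / real n) \<le> \<mu>\<^sup>2 * (1 + \<delta>)" using w2 by (intro mult_left_mono) auto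
      moreover have "2 * \<mu> * (K + \<mu> * (1 + \<delta>)) \<le> 2 * \<mu> * (\<Sum>i<n. r i * (w i / sqrt (real n)))"
        using rw \<mu>0 by (intro mult_left_mono) auto
      ultimately have "(\<Sum>i<n. (r i - \<mu> * (w i / sqrt (real n)))\<^sup>2) \<le> (\<Sum>i<n. (z i)\<^sup>2)"
        unfolding e2 e3 by (simp add: algebra_simps power2_eq_square)
      then have "\<sigma>\<^sup>2 * (\<Sum>i<n. (r i - \<mu> * (w i / sqrt (real n)))\<^sup>2) \<le> \<sigma>\<^sup>2 * (\<Sum>i<n. (z i)\<^sup>2)"
        by (intro mult_left_mono) auto
      also have "\<dots> = (\<Sum>i<n. (\<sigma> * z i)\<^sup>2)" by (simp add: power_mult_distrib sum_distrib_left)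
      finally show ?thesis using w e1 by simp
    qed simp
  qed
  have "ennreal (exp (- ((s + 1)\<^sup>2) / 2) / sqrt (2 * pi)) \<le> emeasure (gauss {..<n}) (?E \<union> ?B)"
    by (rule order_trans [OF tail]) (rule emeasure_mono [OF sub], measurable)
  also have "\<dots> \<le> emeasure (gauss {..<n}) ?E + emeasure (gauss {..<n}) ?B"
    by (rule emeasure_subadditive) measurable
  also have "\<dots> \<le> emeasure (gauss {..<n}) ?E + ennreal (chisq_rate \<delta> ^ n)"
    using large by (rule add_left_mono)
  finally have *: "ennreal (exp (- ((s + 1)\<^sup>2) / 2) / sqrt (2 * pi))
      \<le> emeasure (gauss {..<n}) ?E + ennreal (chisq_rate \<delta> ^ n)" .
  have r0: "0 \<le> chisq_rate \<delta> ^ n" using d by (simp add: chisq_rate_nonneg)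
  from * have "exp (- ((s + 1)\<^sup>2) / 2) / sqrt (2 * pi) \<le> prob ?E + chisq_rate \<delta> ^ n"
    using r0 by (simp add: emeasure_eq_measure ennreal_plus [symmetric] ennreal_le_iff del: ennreal_plus)
  then show ?thesis
    unfolding confusion_prob_def s_def [symmetric] emeasure_eq_measure by (intro ennreal_leI) simp
qed

text \<open>With zero coefficients and unit noise the response is the noise itself, so the sum is
  the inner product of noise and column \<open>a\<close>. Its summands are centered with second
  moments at most \<open>3 / n\<close>, and Chebyshev applies.\<close>

lemma emeasure_correlation_large:
  assumes n: "0 < n" and a: "a < p" and K: "0 < K"
  shows "emeasure (data_law n p 1 (\<lambda>_. 0))
    {d \<in> space (data_law n p 1 (\<lambda>_. 0)). K \<le> (\<Sum>i<n. fst (d i) * snd (d i) a)} \<le> ennreal (3 / K\<^sup>2)"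
proof -
  let ?L = "obs_law n p 1 (\<lambda>_. 0)" and ?D = "data_law n p 1 (\<lambda>_. 0)"
  let ?\<xi> = "\<lambda>r :: real \<times> (nat \<Rightarrow> real). snd r a * fst r"
  have p: "0 < p" using a by simp
  note mom = obs_correlation_moments [OF n a, of 1 1 "\<lambda>_. 0" "\<lambda>_. 0", simplified]
  have D: "?D = PiM {..<n} (\<lambda>_. ?L)" by (simp add: data_law_def)
  have [measurable]: "?\<xi> \<in> borel_measurable ?L" using mom(1) by auto
  have [measurable]: "(\<lambda>d. \<Sum>i<n. ?\<xi> (d i)) \<in> borel_measurable ?D" unfolding D by measurable
  have eq: "{d \<in> space ?D. K \<le> (\<Sum>i<n. fst (d i) * snd (d i) a)} = {d \<in> space ?D. K \<le> (\<Sum>i<n. ?\<xi> (d i))}"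
    by (simp add: mult.commute)
  have "emeasure ?D {d \<in> space ?D. K \<le> (\<Sum>i<n. ?\<xi> (d i))}
      = (\<integral>\<^sup>+d. indicator {d \<in> space ?D. K \<le> (\<Sum>i<n. ?\<xi> (d i))} d \<partial>?D)"
    by (rule nn_integral_indicator [symmetric]) measurable
  also have "\<dots> \<le> (\<integral>\<^sup>+d. ennreal (1 / K\<^sup>2) * ennreal ((\<Sum>i<n. ?\<xi> (d i))\<^sup>2) \<partial>?D)"
  proof (rule nn_integral_mono)
    fix d
    show "indicator {d \<in> space ?D. K \<le> (\<Sum>i<n. ?\<xi> (d i))} d
        \<le> ennreal (1 / K\<^sup>2) * ennreal ((\<Sum>i<n. ?\<xi> (d i))\<^sup>2)"
    proof (cases "K \<le> (\<Sum>i<n. ?\<xi> (d i))")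
      case True
      then have "K\<^sup>2 \<le> (\<Sum>i<n. ?\<xi> (d i))\<^sup>2" using K by (intro power_mono) auto
      then have "1 \<le> 1 / K\<^sup>2 * (\<Sum>i<n. ?\<xi> (d i))\<^sup>2" using K by (simp add: field_simps)
      then have "1 \<le> ennreal (1 / K\<^sup>2) * ennreal ((\<Sum>i<n. ?\<xi> (d i))\<^sup>2)"
        by (simp add: ennreal_mult [symmetric] ennreal_1 [symmetric] ennreal_leI del: ennreal_1)
      then show ?thesis by (auto split: split_indicator)
    qed simp
  qed
  also have "\<dots> = ennreal (1 / K\<^sup>2) * (\<integral>\<^sup>+d. ennreal ((\<Sum>i<n. ?\<xi> (d i))\<^sup>2) \<partial>?D)"
    by (rule nn_integral_cmult) measurable
  also have "(\<integral>\<^sup>+d. ennreal ((\<Sum>i<n. ?\<xi> (d i))\<^sup>2) \<partial>?D) = of_nat n * (\<integral>\<^sup>+r. ennreal ((?\<xi> r)\<^sup>2) \<partial>?L)"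
    unfolding D using nn_integral_centered_sum_square [OF prob_space_obs_law [OF n p] mom(1-3), of "{..<n}"]
    by simp
  also have "\<dots> \<le> of_nat n * ennreal (3 / real n)"
    using mom(4) by (intro mult_left_mono) auto
  also have "of_nat n * ennreal (3 / real n) = ennreal 3"
    using n by (simp add: ennreal_of_nat_eq_real_of_nat ennreal_mult [symmetric])
  finally have "emeasure ?D {d \<in> space ?D. K \<le> (\<Sum>i<n. ?\<xi> (d i))} \<le> ennreal (1 / K\<^sup>2) * ennreal 3"
    by (simp add: mult_left_mono)
  also have "ennreal (1 / K\<^sup>2) * ennreal 3 = ennreal (3 / K\<^sup>2)"
    by (subst ennreal_mult [symmetric]) auto
  finally show ?thesis unfolding eq .
qed

lemma half_power_card:
  assumes "finite B"
  shows "(\<Prod>b\<in>B. if P b then 1 / 2 else 1 :: real) = (1 / 2) ^ card {b\<in>B. P b}"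
  using assms
proof induction
  case (insert b B)
  have "{c \<in> insert b B. P c} = (if P b then insert b {c\<in>B. P c} else {c\<in>B. P c})" by auto
  then show ?case using insert by simp
qed simp

text \<open>Either \<open>N\<close> has reached the cutoff \<open>M\<close>, or
  \<open>2 ^ (M - N)\<close> is at least 1. The reciprocal of a count is thus traded for an
  exponential of it, whose expectation factorizes over independent columns.\<close>

lemma inverse_Suc_le:
  assumes "1 \<le> M"
  shows "1 / (1 + real N) \<le> 1 / real M + 2 ^ M * (1 / 2) ^ N"
proof (cases "M \<le> N")
  case True
  then have "1 / (1 + real N) \<le> 1 / real M" using assms by (intro divide_left_mono) auto
  then show ?thesis by (simp add: add_increasing2)
next
  case False
  then have "(2 ^ M * (1 / 2) ^ N :: real) = 2 ^ (M - N)"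
    by (simp add: power_diff power_divide)
  moreover have "(1 :: real) \<le> 2 ^ (M - N)" by simp
  moreover have "1 / (1 + real N) \<le> 1" by simp
  ultimately show ?thesis using assms by (smt (verit) divide_nonneg_nonneg of_nat_0_le_iff)
qed

text \<open>Column \<open>p\<close> is the noise, so the right side is the residual sum of squares
  at the truth and the left side the one after moving a spike of height \<tau> from \<open>a\<close>
  to \<open>b\<close>. All other coefficients cancel.\<close>

definition confused :: "nat \<Rightarrow> nat \<Rightarrow> real \<Rightarrow> real \<Rightarrow> nat \<Rightarrow> nat \<Rightarrow> (nat \<times> nat \<Rightarrow> real) \<Rightarrow> bool" where
  "confused n p \<sigma> \<tau> a b \<omega> \<longleftrightarrow>
     (\<Sum>i<n. (\<sigma> * \<omega> (i, p) + \<tau> * (\<omega> (i, a) / sqrt (real n) - \<omega> (i, b) / sqrt (real n)))\<^sup>2)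
       \<le> (\<Sum>i<n. (\<sigma> * \<omega> (i, p))\<^sup>2)"

text \<open>The terms stand for: noise and true column too correlated, true column too long,
  \<open>z + \<mu> * x\<close> too short, a reciprocal count beyond the cutoff \<open>M\<close>, and
  too few of the \<open>m\<close> competitors confused.\<close>

definition confusion_bound :: "nat \<Rightarrow> nat \<Rightarrow> real \<Rightarrow> real \<Rightarrow> real \<Rightarrow> nat \<Rightarrow> real" where
  "confusion_bound n m \<mu> K \<delta> M =
     3 / K\<^sup>2 + chisq_rate \<delta> ^ n + chisq_rate (- \<delta>) ^ n + 1 / real M
       + 2 ^ M * exp (- (real m * confusion_prob n \<mu> K \<delta> / 2))"

lemma confusion_bound_nonneg: "0 < \<delta> \<Longrightarrow> \<delta> < 1 \<Longrightarrow> 0 \<le> confusion_bound n m \<mu> K \<delta> M"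
  unfolding confusion_bound_def by (simp add: chisq_rate_nonneg)

text \<open>The three bad events depend only on the noise and on column \<open>a\<close>. Outside
  them, given all columns not in \<open>B\<close>, the competitors are independent, so the mean of
  \<open>(1 / 2) ^ count\<close> is a product whose factors are at most
  \<open>1 - \<pi> / 2\<close>, with \<pi> bounded below by \<open>confusion_prob\<close>.\<close>

lemma nn_integral_confused_le:
  assumes n: "0 < n" and \<sigma>: "0 < \<sigma>" and \<tau>: "0 < \<tau>" and \<mu>: "\<mu> = \<tau> / \<sigma>" and d: "0 < \<delta>" "\<delta> < 1"
    and K: "0 < K" and M: "1 \<le> M" and a: "a < p" and B: "B \<subseteq> {..<p} - {a}"
  shows "(\<integral>\<^sup>+\<omega>. ennreal (1 / (1 + real (card {b\<in>B. confused n p \<sigma> \<tau> a b \<omega>}))) \<partial>gauss ({..<n} \<times> {..p}))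
    \<le> ennreal (confusion_bound n (card B) \<mu> K \<delta> M)"
proof -
  let ?I = "{..<n} \<times> {..p}" and ?J = "{..<n} \<times> ({..p} - B)" and ?K = "{..<n} \<times> B"
  have p: "0 < p" using a by simp
  have finB: "finite B" using B by (rule finite_subset) simp
  have \<mu>0: "0 < \<mu>" using \<sigma> \<tau> by (simp add: \<mu>)
  have IJ: "?J \<inter> ?K = {}" "finite ?J" "finite ?K" "?J \<union> ?K = ?I"
    using finB B by auto
  define z where "z = (\<lambda>\<omega> :: nat \<times> nat \<Rightarrow> real. \<lambda>i. \<omega> (i, p))"
  define x where "x = (\<lambda>\<omega> :: nat \<times> nat \<Rightarrow> real. \<lambda>i. \<omega> (i, a) / sqrt (real n))"
  define bad1 where "bad1 \<omega> \<longleftrightarrow> K \<le> (\<Sum>i<n. z \<omega> i * x \<omega> i)" for \<omega>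
  define bad2 where "bad2 \<omega> \<longleftrightarrow> 1 + \<delta> \<le> (\<Sum>i<n. (x \<omega> i)\<^sup>2)" for \<omega>
  define bad3 where "bad3 \<omega> \<longleftrightarrow> (\<Sum>i<n. (z \<omega> i + \<mu> * x \<omega> i)\<^sup>2) \<le> (1 - \<delta>) * real n" for \<omega>
  define E where "E b \<omega> \<longleftrightarrow> confused n p \<sigma> \<tau> a b \<omega>" for b \<omega>
  let ?G = "gauss ?I :: (nat \<times> nat \<Rightarrow> real) measure"
  let ?D = "data_law n p 1 (\<lambda>_. 0)"
  have zm [measurable]: "(\<lambda>\<omega>. z \<omega> i) \<in> borel_measurable ?G" if "i < n" for i
    using that unfolding z_def by (intro measurable_gauss_component) auto
  have xm [measurable]: "(\<lambda>\<omega>. x \<omega> i) \<in> borel_measurable ?G" if "i < n" for i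
  proof -
    have [measurable]: "(\<lambda>\<omega>. \<omega> (i, a)) \<in> borel_measurable ?G"
      using that a by (intro measurable_gauss_component) auto
    show ?thesis unfolding x_def by measurable
  qed
  have Em [measurable]: "Measurable.pred ?G (E b)" if "b \<in> B" for b
  proof -
    have c: "(\<lambda>\<omega>. \<omega> (i, l)) \<in> borel_measurable ?G" if "i \<in> {..<n}" "l \<le> p" for i l
      using that by (intro measurable_gauss_component) auto
    have b: "b \<le> p" "a \<le> p" using that B a by auto
    have *:
      "(\<lambda>\<omega>. \<Sum>i<n. (\<sigma> * \<omega> (i, p) + \<tau> * (\<omega> (i, a) / sqrt (real n) - \<omega> (i, b) / sqrt (real n)))\<^sup>2)
         \<in> borel_measurable ?G"
      "(\<lambda>\<omega>. \<Sum>i<n. (\<sigma> * \<omega> (i, p))\<^sup>2) \<in> borel_measurable ?G"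
      using b by (auto intro!: borel_measurable_sum borel_measurable_power borel_measurable_add
        borel_measurable_times borel_measurable_diff borel_measurable_divide borel_measurable_const c)
    show ?thesis unfolding E_def confused_def pred_def by (rule borel_measurable_le [OF *])
  qed
  have bm [measurable]: "Measurable.pred ?G bad1" "Measurable.pred ?G bad2" "Measurable.pred ?G bad3"
    unfolding bad1_def bad2_def bad3_def by measurable

  \<comment> \<open>Data with zero coefficients and unit noise merely display the noise and the
    design, so the bad events can be estimated by the results on \<open>data_law\<close>.\<close>
  have data_eq: "fst (gauss_data n p 1 (\<lambda>_. 0) \<omega> i) = z \<omega> i"
      "snd (gauss_data n p 1 (\<lambda>_. 0) \<omega> i) a = x \<omega> i" if "i < n" for \<omega> i
    using that a by (simp_all add: gauss_data_def gauss_obs_def z_def x_def)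
  have D: "?D = PiM {..<n} (\<lambda>_. obs_law n p 1 (\<lambda>_. 0))" by (simp add: data_law_def)
  have pull: "emeasure ?G {\<omega> \<in> space ?G. P (gauss_data n p 1 (\<lambda>_. 0) \<omega>)}
      = emeasure ?D {d \<in> space ?D. P d}" if "{d \<in> space ?D. P d} \<in> sets ?D" for P
    using that measurable_space [OF measurable_gauss_data]
    unfolding data_law_eq_distr [OF n p] by (subst emeasure_distr) (auto intro!: arg_cong2 [of _ _ _ _ emeasure])
  have fm [measurable]: "fst \<in> borel_measurable (obs_law n p 1 (\<lambda>_. 0))"
    by (simp add: obs_space_def cong: measurable_cong_sets)
  have sm [measurable]: "(\<lambda>r. snd r a) \<in> borel_measurable (obs_law n p 1 (\<lambda>_. 0))"
    using measurable_obs_coord [OF a] by (simp cong: measurable_cong_sets)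
  have P: "prob_space (obs_law n p 1 (\<lambda>_. 0))" by (rule prob_space_obs_law [OF n p])

  have e1: "emeasure ?G {\<omega> \<in> space ?G. bad1 \<omega>} \<le> ennreal (3 / K\<^sup>2)"
  proof -
    have "emeasure ?G {\<omega> \<in> space ?G. bad1 \<omega>}
        = emeasure ?D {d \<in> space ?D. K \<le> (\<Sum>i<n. fst (d i) * snd (d i) a)}"
      by (subst pull [symmetric]) (unfold D bad1_def, measurable, simp add: data_eq)
    then show ?thesis using emeasure_correlation_large [OF n a K] by simp
  qed
  have e2: "emeasure ?G {\<omega> \<in> space ?G. bad2 \<omega>} \<le> ennreal (chisq_rate \<delta> ^ n)"
  proof -
    have "emeasure ?G {\<omega> \<in> space ?G. bad2 \<omega>}
        = emeasure ?D {d \<in> space ?D. 1 + \<delta> \<le> (\<Sum>i<n. (snd (d i) a)\<^sup>2)}"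
      by (subst pull [symmetric]) (unfold D bad2_def, measurable, simp add: data_eq)
    also have "\<dots> \<le> ennreal (chisq_rate \<delta> ^ n)"
      using chisq_upper [OF P _ sm distr_obs_law_coord [OF n p a] _ d(1), of "{..<n}"] n
      unfolding D by simp
    finally show ?thesis .
  qed
  have e3: "emeasure ?G {\<omega> \<in> space ?G. bad3 \<omega>} \<le> ennreal (chisq_rate (- \<delta>) ^ n)"
  proof -
    let ?l = "\<lambda>r :: real \<times> (nat \<Rightarrow> real). fst r + \<mu> * snd r a"
    define v where "v = 1 + \<mu>\<^sup>2 / real n"
    have v1: "1 \<le> v" by (simp add: v_def)
    have lin: "(\<Sum>l<p. snd r l * (if l = a then \<mu> else 0)) = \<mu> * snd r a" for r :: "real \<times> (nat \<Rightarrow> real)"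
      using a by (simp add: if_distrib [of "\<lambda>x. _ * x"] cong: if_cong)
    have sq: "(\<Sum>l<p. (if l = a then \<mu> else 0)\<^sup>2) = \<mu>\<^sup>2"
      using a by (simp add: if_distrib [of "\<lambda>x. x\<^sup>2"] cong: if_cong)
    have law: "distr (obs_law n p 1 (\<lambda>_. 0)) borel ?l = normal_distribution 0 v"
      using distr_obs_law_linear [OF n p, of v 1 1 "\<lambda>_. 0" "\<lambda>l. if l = a then \<mu> else 0"] v1
      by (simp add: lin sq v_def [symmetric])
    have "emeasure ?G {\<omega> \<in> space ?G. bad3 \<omega>}
        = emeasure ?D {d \<in> space ?D. (\<Sum>i<n. (?l (d i))\<^sup>2) \<le> (1 - \<delta>) * real n}"
      by (subst pull [symmetric]) (unfold D bad3_def, measurable, simp add: data_eq)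
    \<comment> \<open>The summands have variance \<open>v\<close>, which is at least 1. Raising the
      level from variance 1 to variance \<open>v\<close> enlarges the event and brings it into the
      form of \<open>chisq_lower\<close>.\<close>
    also have "\<dots> \<le> emeasure ?D {d \<in> space ?D. (\<Sum>i<n. (?l (d i))\<^sup>2) \<le> (1 - \<delta>) * v * real (card {..<n})}"
    proof (rule emeasure_mono)
      have "(1 - \<delta>) * real n \<le> (1 - \<delta>) * v * real n"
        using v1 d by (intro mult_right_mono) (auto simp: mult_le_cancel_left1)
      then show "{d \<in> space ?D. (\<Sum>i<n. (?l (d i))\<^sup>2) \<le> (1 - \<delta>) * real n}
          \<subseteq> {d \<in> space ?D. (\<Sum>i<n. (?l (d i))\<^sup>2) \<le> (1 - \<delta>) * v * real (card {..<n})}"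
        by auto
      show "{d \<in> space ?D. (\<Sum>i<n. (?l (d i))\<^sup>2) \<le> (1 - \<delta>) * v * real (card {..<n})} \<in> sets ?D"
        unfolding D by measurable
    qed
    also have "\<dots> \<le> ennreal (chisq_rate (- \<delta>) ^ n)"
      using chisq_lower [OF P _ _ law _ d, of "{..<n}"] v1 unfolding D by simp
    finally show ?thesis .
  qed

  let ?good = "\<lambda>\<omega>. \<not> bad1 \<omega> \<and> \<not> bad2 \<omega> \<and> \<not> bad3 \<omega>"
  let ?h = "\<lambda>\<omega>. ennreal (\<Prod>b\<in>B. if E b \<omega> then 1 / 2 else 1)"
  let ?\<pi> = "confusion_prob n \<mu> K \<delta>"
  have hm [measurable]: "?h \<in> borel_measurable ?G"
  proof -
    have "(\<lambda>\<omega>. if E b \<omega> then 1 / 2 else 1 :: real) \<in> borel_measurable ?G" if "b \<in> B" for b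
      using Em [OF that] by measurable
    then show ?thesis by (intro measurable_compose [OF _ measurable_ennreal] borel_measurable_prod) auto
  qed
  have cond: "(\<integral>\<^sup>+\<omega>. indicator {\<omega>. ?good \<omega>} \<omega> * ?h \<omega> \<partial>?G) \<le> ennreal (exp (- (real (card B) * ?\<pi> / 2)))"
  proof -
    have fm: "(\<lambda>\<omega>. indicator {\<omega>. ?good \<omega>} \<omega> * ?h \<omega>) \<in> borel_measurable (gauss (?J \<union> ?K))"
      unfolding IJ(4) by measurable
    have "(\<integral>\<^sup>+\<omega>. indicator {\<omega>. ?good \<omega>} \<omega> * ?h \<omega> \<partial>?G)
        = (\<integral>\<^sup>+u. (\<integral>\<^sup>+w. indicator {\<omega>. ?good \<omega>} (merge ?J ?K (u, w)) * ?h (merge ?J ?K (u, w)) \<partial>gauss ?K) \<partial>gauss ?J)"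
      using nn_integral_gauss_fold [OF IJ(1-3) fm] unfolding IJ(4) .
    also have "\<dots> \<le> (\<integral>\<^sup>+u. ennreal (exp (- (real (card B) * ?\<pi> / 2))) \<partial>gauss ?J)"
    proof (rule nn_integral_mono)
      fix u :: "nat \<times> nat \<Rightarrow> real" assume u: "u \<in> space (gauss ?J)"
      have aB: "a \<notin> B" "p \<notin> B" "a \<le> p" using a B by auto
      have mz: "z (merge ?J ?K (u, w)) i = z u i" and mx: "x (merge ?J ?K (u, w)) i = x u i"
        if "i < n" for w i
        using that aB IJ(1) by (auto simp: z_def x_def merge_def)
      \<comment> \<open>The competitors \<open>w\<close> do not enter the bad events, so the inner
        integral is either zero or a plain product over the columns.\<close>
      have gd: "?good (merge ?J ?K (u, w)) = ?good u" for w
        by (simp add: bad1_def bad2_def bad3_def mz mx)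
      show "(\<integral>\<^sup>+w. indicator {\<omega>. ?good \<omega>} (merge ?J ?K (u, w)) * ?h (merge ?J ?K (u, w)) \<partial>gauss ?K)
          \<le> ennreal (exp (- (real (card B) * ?\<pi> / 2)))"
      proof (cases "?good u")
        case True
        define H where "H g \<longleftrightarrow> (\<Sum>i<n. (\<sigma> * z u i + \<tau> * (x u i - g i / sqrt (real n)))\<^sup>2)
            \<le> (\<Sum>i<n. (\<sigma> * z u i)\<^sup>2)" for g :: "nat \<Rightarrow> real"
        define k where "k g = ennreal (if H g then 1 / 2 else 1)" for g
        have Hm [measurable]: "Measurable.pred (gauss {..<n}) H"
          unfolding H_def by measurable
        have km [measurable]: "k \<in> borel_measurable (gauss {..<n})"
          unfolding k_def by measurable
        have Eeq: "E b (merge ?J ?K (u, w)) = H (\<lambda>i\<in>{..<n}. w (i, b))" if b: "b \<in> B" for b w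
        proof -
          have mb: "merge ?J ?K (u, w) (i, b) = w (i, b)" if "i < n" for i
            using that b by (simp add: merge_def)
          show ?thesis
            using mz [of _ w] mx [of _ w]
            by (simp add: E_def confused_def H_def z_def x_def mb)
        qed
        have "(\<integral>\<^sup>+w. indicator {\<omega>. ?good \<omega>} (merge ?J ?K (u, w)) * ?h (merge ?J ?K (u, w)) \<partial>gauss ?K)
            = (\<integral>\<^sup>+w. (\<Prod>b\<in>B. k (\<lambda>i\<in>{..<n}. w ((\<lambda>(b, i). (i, b)) (b, i)))) \<partial>gauss ?K)"
        proof (rule nn_integral_cong)
          fix w
          have "?h (merge ?J ?K (u, w)) = (\<Prod>b\<in>B. ennreal (if E b (merge ?J ?K (u, w)) then 1 / 2 else 1))"
            by (rule prod_ennreal [symmetric]) auto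
          also have "\<dots> = (\<Prod>b\<in>B. k (\<lambda>i\<in>{..<n}. w (i, b)))"
            unfolding k_def by (rule prod.cong) (simp_all add: Eeq)
          finally show "indicator {\<omega>. ?good \<omega>} (merge ?J ?K (u, w)) * ?h (merge ?J ?K (u, w))
              = (\<Prod>b\<in>B. k (\<lambda>i\<in>{..<n}. w ((\<lambda>(b, i). (i, b)) (b, i))))"
            using True gd [of w] by simp
        qed
        also have "\<dots> = (\<integral>\<^sup>+g. k g \<partial>gauss {..<n}) ^ card B"
          by (rule nn_integral_gauss_blocks [OF finB]) (auto simp: inj_on_def)
        also have "\<dots> \<le> ennreal (exp (- (?\<pi> / 2))) ^ card B"
        proof (rule power_mono)
          interpret prob_space "gauss {..<n}" by (rule prob_space_gauss)
          let ?E = "{w \<in> space (gauss {..<n}). H w}"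
          have EE [measurable]: "?E \<in> events" by measurable
          have iE: "integrable (gauss {..<n}) (indicator ?E :: _ \<Rightarrow> real)"
            by (rule integrable_real_indicator [OF EE]) (simp add: emeasure_eq_measure)
          have "ennreal ?\<pi> \<le> emeasure (gauss {..<n}) ?E"
            unfolding H_def
            by (rule confusion_prob_le [OF n \<sigma> \<tau> \<mu> d])
              (use True K in \<open>auto simp: bad1_def bad2_def bad3_def\<close>)
          then have \<pi>: "?\<pi> \<le> prob ?E"
            by (simp add: emeasure_eq_measure measure_nonneg)
          have "(\<integral>\<^sup>+g. k g \<partial>gauss {..<n}) = (\<integral>\<^sup>+g. ennreal (1 - 1 / 2 * indicator ?E g) \<partial>gauss {..<n})"
            by (rule nn_integral_cong) (auto simp: k_def split: split_indicator)
          also have "\<dots> = ennreal (\<integral>g. 1 - 1 / 2 * indicator ?E g \<partial>gauss {..<n})"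
            by (rule nn_integral_eq_integral)
              (use iE in \<open>auto split: split_indicator\<close>)
          also have "(\<integral>g. 1 - 1 / 2 * indicator ?E g \<partial>gauss {..<n}) = 1 - prob ?E / 2"
            using iE by (simp add: prob_space)
          also have "ennreal \<dots> \<le> ennreal (exp (- (?\<pi> / 2)))"
          proof (rule ennreal_leI)
            have "1 - prob ?E / 2 \<le> 1 + - (?\<pi> / 2)" using \<pi> by simp
            also have "\<dots> \<le> exp (- (?\<pi> / 2))" by (rule exp_ge_add_one_self)
            finally show "1 - prob ?E / 2 \<le> exp (- (?\<pi> / 2))" .
          qed
          finally show "(\<integral>\<^sup>+g. k g \<partial>gauss {..<n}) \<le> ennreal (exp (- (?\<pi> / 2)))" .
        qed simp
        also have "\<dots> = ennreal (exp (- (real (card B) * ?\<pi> / 2)))"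
          by (simp add: ennreal_power exp_of_nat_mult [symmetric])
        finally show ?thesis .
      next
        case False
        then show ?thesis using gd by simp
      qed
    qed
    also have "\<dots> = ennreal (exp (- (real (card B) * ?\<pi> / 2)))"
      by (simp add: prob_space.emeasure_space_1 [OF prob_space_gauss])
    finally show ?thesis .
  qed

  have pw: "ennreal (1 / (1 + real (card {b\<in>B. confused n p \<sigma> \<tau> a b \<omega>})))
      \<le> indicator {\<omega> \<in> space ?G. bad1 \<omega>} \<omega> + indicator {\<omega> \<in> space ?G. bad2 \<omega>} \<omega>
        + indicator {\<omega> \<in> space ?G. bad3 \<omega>} \<omega> + ennreal (1 / real M)
        + ennreal (2 ^ M) * (indicator {\<omega>. ?good \<omega>} \<omega> * ?h \<omega>)" (is "?L \<le> ?R")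
    if \<omega>: "\<omega> \<in> space ?G" for \<omega>
  proof (cases "?good \<omega>")
    case True
    have "?L \<le> ennreal (1 / real M + 2 ^ M * (\<Prod>b\<in>B. if E b \<omega> then 1 / 2 else 1))"
      unfolding half_power_card [OF finB] E_def by (intro ennreal_leI inverse_Suc_le M)
    also have "\<dots> = ennreal (1 / real M) + ennreal (2 ^ M) * (indicator {\<omega>. ?good \<omega>} \<omega> * ?h \<omega>)"
      using True by (simp add: ennreal_plus ennreal_mult prod_nonneg)
    also have "\<dots> \<le> ?R" by (simp add: add.assoc add_increasing)
    finally show ?thesis .
  next
    case False
    have "?L \<le> ennreal 1" by (intro ennreal_leI) simp
    also have "\<dots> \<le> indicator {\<omega> \<in> space ?G. bad1 \<omega>} \<omega> + indicator {\<omega> \<in> space ?G. bad2 \<omega>} \<omega>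
        + indicator {\<omega> \<in> space ?G. bad3 \<omega>} \<omega>"
      using False \<omega> by (auto split: split_indicator)
    also have "\<dots> \<le> ?R" by (simp add: add.assoc add_increasing2)
    finally show ?thesis .
  qed
  have "(\<integral>\<^sup>+\<omega>. ennreal (1 / (1 + real (card {b\<in>B. confused n p \<sigma> \<tau> a b \<omega>}))) \<partial>?G)
      \<le> (\<integral>\<^sup>+\<omega>. indicator {\<omega> \<in> space ?G. bad1 \<omega>} \<omega> + indicator {\<omega> \<in> space ?G. bad2 \<omega>} \<omega>
        + indicator {\<omega> \<in> space ?G. bad3 \<omega>} \<omega> + ennreal (1 / real M)
        + ennreal (2 ^ M) * (indicator {\<omega>. ?good \<omega>} \<omega> * ?h \<omega>) \<partial>?G)"
    by (rule nn_integral_mono) (rule pw)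
  also have "\<dots> = emeasure ?G {\<omega> \<in> space ?G. bad1 \<omega>} + emeasure ?G {\<omega> \<in> space ?G. bad2 \<omega>}
        + emeasure ?G {\<omega> \<in> space ?G. bad3 \<omega>} + ennreal (1 / real M)
        + ennreal (2 ^ M) * (\<integral>\<^sup>+\<omega>. indicator {\<omega>. ?good \<omega>} \<omega> * ?h \<omega> \<partial>?G)"
    by (simp add: nn_integral_add nn_integral_cmult prob_space.emeasure_space_1 [OF prob_space_gauss])
  also have "\<dots> \<le> ennreal (3 / K\<^sup>2) + ennreal (chisq_rate \<delta> ^ n) + ennreal (chisq_rate (- \<delta>) ^ n)
        + ennreal (1 / real M) + ennreal (2 ^ M) * ennreal (exp (- (real (card B) * ?\<pi> / 2)))"
    by (intro add_mono mult_left_mono e1 e2 e3 cond) auto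
  also have "\<dots> = ennreal (confusion_bound n (card B) \<mu> K \<delta> M)"
    using d by (simp add: confusion_bound_def ennreal_plus [symmetric] ennreal_mult [symmetric]
        chisq_rate_nonneg del: ennreal_plus)
  finally show ?thesis .
qed

section \<open>Lower bound by a block prior\<close>

lemma PiM_density:
  assumes M: "sigma_finite_measure M" and f [measurable]: "f \<in> borel_measurable M"
    and P: "prob_space (density M f)" and I: "finite I"
  shows "PiM I (\<lambda>_. density M f) = density (PiM I (\<lambda>_. M)) (\<lambda>x. \<Prod>i\<in>I. f (x i))"
proof -
  interpret D: product_sigma_finite "\<lambda>_. density M f"
    by (rule product_sigma_finite_prob [OF P])
  interpret P: product_sigma_finite "\<lambda>_. M"
    using M by (simp add: product_sigma_finite_def)
  have [measurable]: "(\<lambda>x. \<Prod>i\<in>I. f (x i)) \<in> borel_measurable (PiM I (\<lambda>_. M))" by measurable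
  show ?thesis
  proof (rule D.PiM_eqI [OF I, symmetric])
    show "sets (density (PiM I (\<lambda>_. M)) (\<lambda>x. \<Prod>i\<in>I. f (x i))) = sets (PiM I (\<lambda>_. density M f))"
      by (simp cong: sets_PiM_cong)
    fix A assume A: "\<And>i. i \<in> I \<Longrightarrow> A i \<in> sets (density M f)"
    then have A' [measurable]: "\<And>i. i \<in> I \<Longrightarrow> A i \<in> sets M" by simp
    have [measurable]: "Pi\<^sub>E I A \<in> sets (PiM I (\<lambda>_. M))" using A' I by measurable
    have "emeasure (density (PiM I (\<lambda>_. M)) (\<lambda>x. \<Prod>i\<in>I. f (x i))) (Pi\<^sub>E I A)
        = (\<integral>\<^sup>+x. (\<Prod>i\<in>I. f (x i)) * indicator (Pi\<^sub>E I A) x \<partial>PiM I (\<lambda>_. M))"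
      by (rule emeasure_density) measurable
    also have "\<dots> = (\<integral>\<^sup>+x. (\<Prod>i\<in>I. f (x i) * indicator (A i) (x i)) \<partial>PiM I (\<lambda>_. M))"
    proof (rule nn_integral_cong)
      fix x assume x: "x \<in> space (PiM I (\<lambda>_. M))"
      show "(\<Prod>i\<in>I. f (x i)) * indicator (Pi\<^sub>E I A) x = (\<Prod>i\<in>I. f (x i) * indicator (A i) (x i))"
      proof (cases "x \<in> Pi\<^sub>E I A")
        case True
        then show ?thesis by (auto simp: PiE_iff intro!: prod.cong)
      next
        case False
        then obtain i where "i \<in> I" "x i \<notin> A i" using x by (auto simp: space_PiM PiE_iff)
        then have "(\<Prod>i\<in>I. f (x i) * indicator (A i) (x i)) = 0"
          using I by (intro prod_zero) (auto intro!: bexI [of _ i])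
        then show ?thesis using False by simp
      qed
    qed
    also have "\<dots> = (\<Prod>i\<in>I. \<integral>\<^sup>+y. f y * indicator (A i) y \<partial>M)"
      by (rule P.product_nn_integral_prod [OF I]) measurable
    also have "\<dots> = (\<Prod>i\<in>I. emeasure (density M f) (A i))"
      by (rule prod.cong) (auto simp: emeasure_density)
    finally show "emeasure (density (PiM I (\<lambda>_. M)) (\<lambda>x. \<Prod>i\<in>I. f (x i))) (Pi\<^sub>E I A)
        = (\<Prod>i\<in>I. emeasure (density M f) (A i))" .
  qed
qed

text \<open>A measure dominating the laws for all \<beta> at once: the law of the design does not
  involve \<beta>, so only the response needs Lebesgue measure, and \<open>obs_density\<close> is
  the conditional density of the response.\<close>

definition obs_base :: "nat \<Rightarrow> nat \<Rightarrow> (real \<times> (nat \<Rightarrow> real)) measure" where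
  "obs_base n p = lborel \<Otimes>\<^sub>M design_law n p"

definition obs_density :: "nat \<Rightarrow> real \<Rightarrow> (nat \<Rightarrow> real) \<Rightarrow> real \<times> (nat \<Rightarrow> real) \<Rightarrow> real" where
  "obs_density p \<sigma> \<beta> r = normal_density (\<Sum>j<p. snd r j * \<beta> j) \<sigma> (fst r)"

lemma sets_obs_base [measurable_cong]: "sets (obs_base n p) = sets (obs_space p)"
  unfolding obs_base_def obs_space_def by (rule sets_pair_measure_cong) simp_all

lemma measurable_obs_density [measurable]: "obs_density p \<sigma> \<beta> \<in> borel_measurable (obs_space p)"
  unfolding obs_density_def [abs_def] normal_density_def obs_space_def vec_space_def by measurable

lemma sigma_finite_design_law: "0 < n \<Longrightarrow> 0 < p \<Longrightarrow> sigma_finite_measure (design_law n p)"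
  unfolding design_law_def
  by (rule prob_space_imp_sigma_finite, rule prob_space_PiM, rule prob_space_normal_distribution) simp

lemma sigma_finite_obs_base: "0 < n \<Longrightarrow> 0 < p \<Longrightarrow> sigma_finite_measure (obs_base n p)"
  unfolding obs_base_def
  by (intro sigma_finite_pair_measure sigma_finite_design_law sigma_finite_lborel)

lemma nn_integral_std_normal_affine:
  assumes \<sigma>: "0 < \<sigma>" and [measurable]: "f \<in> borel_measurable borel"
  shows "(\<integral>\<^sup>+z. f (m + \<sigma> * z) \<partial>normal_distribution 0 1)
    = (\<integral>\<^sup>+y. ennreal (normal_density m \<sigma> y) * f y \<partial>lborel)"
proof -
  interpret prob_space "normal_distribution 0 1" by (rule prob_space_std_normal)
  have "distr (normal_distribution 0 1) lborel (\<lambda>z. z) = distr (normal_distribution 0 1) (normal_distribution 0 1) (\<lambda>z. z)"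
    by (rule distr_cong) auto
  then have "distributed (normal_distribution 0 1) lborel (\<lambda>z. z) (normal_density 0 1)"
    by (simp add: distributed_def distr_id2 normal_distribution_def)
  from normal_density_affine [OF this _ _, of \<sigma> m] \<sigma>
  have d: "distributed (normal_distribution 0 1) lborel (\<lambda>z. m + \<sigma> * z) (normal_density m \<sigma>)"
    by simp
  show ?thesis using distributed_nn_integral [OF d, of f] by simp
qed

lemma obs_law_density:
  assumes n: "0 < n" and p: "0 < p" and \<sigma>: "0 < \<sigma>"
  shows "obs_law n p \<sigma> \<beta> = density (obs_base n p) (\<lambda>r. ennreal (obs_density p \<sigma> \<beta> r))"
proof (rule measure_eqI)
  show "sets (obs_law n p \<sigma> \<beta>) = sets (density (obs_base n p) (\<lambda>r. ennreal (obs_density p \<sigma> \<beta> r)))"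
    by (simp add: sets_obs_base)
  fix A assume "A \<in> sets (obs_law n p \<sigma> \<beta>)"
  then have A: "A \<in> sets (obs_space p)" by simp
  have Am [measurable]: "A \<in> sets (borel \<Otimes>\<^sub>M vec_space p)" using A by (simp add: obs_space_def)
  interpret X: sigma_finite_measure "design_law n p" by (rule sigma_finite_design_law [OF n p])
  interpret Z: prob_space "normal_distribution 0 1" by (rule prob_space_std_normal)
  interpret Y: pair_sigma_finite lborel "design_law n p" ..
  let ?T = "\<lambda>(x, z). ((\<Sum>j<p. x j * \<beta> j) + \<sigma> * z, x)"
  have T [measurable]: "?T \<in> design_law n p \<Otimes>\<^sub>M normal_distribution 0 1 \<rightarrow>\<^sub>M obs_space p"
    unfolding obs_space_def
    by (subst measurable_cong_sets [OF sets_pair_measure_cong [OF sets_design_law sets_normal_distribution] refl])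
      (unfold vec_space_def, measurable)
  have iA: "(\<lambda>q. indicator A (?T q) :: ennreal) \<in> borel_measurable (design_law n p \<Otimes>\<^sub>M normal_distribution 0 1)"
    using measurable_compose [OF T borel_measurable_indicator [OF A]] .
  have dm: "(\<lambda>r. ennreal (obs_density p \<sigma> \<beta> r)) \<in> borel_measurable (obs_base n p)" by measurable
  have Ab: "A \<in> sets (obs_base n p)" using A by (simp add: sets_obs_base)
  have "emeasure (obs_law n p \<sigma> \<beta>) A = (\<integral>\<^sup>+r. indicator A r \<partial>obs_law n p \<sigma> \<beta>)"
    using A by simp
  also have "\<dots> = (\<integral>\<^sup>+q. indicator A (?T q) \<partial>(design_law n p \<Otimes>\<^sub>M normal_distribution 0 1))"
    unfolding obs_law_def by (rule nn_integral_distr) (use A T in auto)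
  also have "\<dots> = (\<integral>\<^sup>+x. (\<integral>\<^sup>+z. indicator A (?T (x, z)) \<partial>normal_distribution 0 1) \<partial>design_law n p)"
    by (rule Z.nn_integral_fst [OF iA, symmetric])
  also have "\<dots> = (\<integral>\<^sup>+x. (\<integral>\<^sup>+y. ennreal (obs_density p \<sigma> \<beta> (y, x)) * indicator A (y, x) \<partial>lborel) \<partial>design_law n p)"
  proof (rule nn_integral_cong)
    fix x assume "x \<in> space (design_law n p)"
    then have x: "x \<in> space (vec_space p)" using sets_eq_imp_space_eq [OF sets_design_law] by simp
    have "(\<lambda>y. indicator A (y, x) :: ennreal) \<in> borel_measurable borel"
      using x by measurable
    from nn_integral_std_normal_affine [OF \<sigma> this, of "\<Sum>j<p. x j * \<beta> j"]
    show "(\<integral>\<^sup>+z. indicator A (?T (x, z)) \<partial>normal_distribution 0 1)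
        = (\<integral>\<^sup>+y. ennreal (obs_density p \<sigma> \<beta> (y, x)) * indicator A (y, x) \<partial>lborel)"
      by (simp add: obs_density_def)
  qed
  also have "\<dots> = (\<integral>\<^sup>+r. ennreal (obs_density p \<sigma> \<beta> r) * indicator A r \<partial>obs_base n p)"
    unfolding obs_base_def
    by (subst Y.nn_integral_snd [symmetric]) (use dm Ab in \<open>auto simp: obs_base_def\<close>)
  also have "\<dots> = emeasure (density (obs_base n p) (\<lambda>r. ennreal (obs_density p \<sigma> \<beta> r))) A"
    by (rule emeasure_density [OF dm Ab, symmetric])
  finally show "emeasure (obs_law n p \<sigma> \<beta>) A
      = emeasure (density (obs_base n p) (\<lambda>r. ennreal (obs_density p \<sigma> \<beta> r))) A" .
qed

definition data_density :: "nat \<Rightarrow> nat \<Rightarrow> real \<Rightarrow> (nat \<Rightarrow> real) \<Rightarrow> (nat \<Rightarrow> real \<times> (nat \<Rightarrow> real)) \<Rightarrow> real" where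
  "data_density n p \<sigma> \<beta> d = (\<Prod>i<n. obs_density p \<sigma> \<beta> (d i))"

definition data_base :: "nat \<Rightarrow> nat \<Rightarrow> (nat \<Rightarrow> real \<times> (nat \<Rightarrow> real)) measure" where
  "data_base n p = PiM {..<n} (\<lambda>_. obs_base n p)"

lemma sets_data_base [measurable_cong]: "sets (data_base n p) = sets (data_space n p)"
  unfolding data_base_def data_space_def by (rule sets_PiM_cong) (auto simp: sets_obs_base)

lemma measurable_data_density [measurable]: "data_density n p \<sigma> \<beta> \<in> borel_measurable (data_space n p)"
  unfolding data_density_def [abs_def] data_space_def by measurable

lemma data_density_pos: "0 < \<sigma> \<Longrightarrow> 0 < data_density n p \<sigma> \<beta> d"
  unfolding data_density_def obs_density_def by (intro prod_pos) (auto intro: normal_density_pos)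

lemma data_law_density:
  assumes n: "0 < n" and p: "0 < p" and \<sigma>: "0 < \<sigma>"
  shows "data_law n p \<sigma> \<beta> = density (data_base n p) (\<lambda>d. ennreal (data_density n p \<sigma> \<beta> d))"
proof -
  have "data_law n p \<sigma> \<beta> = PiM {..<n} (\<lambda>_. density (obs_base n p) (\<lambda>r. ennreal (obs_density p \<sigma> \<beta> r)))"
    by (simp add: data_law_def obs_law_density [OF n p \<sigma>])
  also have "\<dots> = density (data_base n p) (\<lambda>d. \<Prod>i<n. ennreal (obs_density p \<sigma> \<beta> (d i)))"
    unfolding data_base_def
    by (rule PiM_density [OF sigma_finite_obs_base [OF n p]])
      (use prob_space_obs_law [OF n p, of \<sigma> \<beta>] in \<open>auto simp: obs_law_density [OF n p \<sigma>]\<close>)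
  also have "\<dots> = density (data_base n p) (\<lambda>d. ennreal (data_density n p \<sigma> \<beta> d))"
    by (simp add: data_density_def prod_ennreal obs_density_def)
  finally show ?thesis .
qed

lemma nn_integral_data_law_density:
  assumes "0 < n" "0 < p" "0 < \<sigma>" and [measurable]: "f \<in> borel_measurable (data_space n p)"
  shows "(\<integral>\<^sup>+d. f d \<partial>data_law n p \<sigma> \<beta>)
    = (\<integral>\<^sup>+d. ennreal (data_density n p \<sigma> \<beta> d) * f d \<partial>data_base n p)"
  unfolding data_law_density [OF assms(1-3)] by (subst nn_integral_density) measurable

text \<open>For known \<sigma> the Gaussian likelihood depends on \<beta> only through the residual
  sum of squares, and decreases with it.\<close>

lemma data_density_mono:
  assumes \<sigma>: "0 < \<sigma>"
    and le: "(\<Sum>i<n. (fst (d i) - (\<Sum>j<p. snd (d i) j * \<beta>' j))\<^sup>2) \<le> (\<Sum>i<n. (fst (d i) - (\<Sum>j<p. snd (d i) j * \<beta> j))\<^sup>2)"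
  shows "data_density n p \<sigma> \<beta> d \<le> data_density n p \<sigma> \<beta>' d"
proof -
  have eq: "data_density n p \<sigma> \<beta> d
      = (1 / sqrt (2 * pi * \<sigma>\<^sup>2)) ^ n * exp (- (\<Sum>i<n. (fst (d i) - (\<Sum>j<p. snd (d i) j * \<beta> j))\<^sup>2) / (2 * \<sigma>\<^sup>2))" for \<beta>
    unfolding data_density_def obs_density_def normal_density_def
    by (simp add: prod_dividef prod.distrib exp_sum [symmetric] sum_negf sum_divide_distrib power_divide
        prod_constant)
  show ?thesis unfolding eq using le \<sigma> by (intro mult_left_mono) (auto simp: divide_right_mono)
qed

text \<open>Minimizing the posterior risk over \<open>v\<close> leaves the posterior weights \<open>f a / F\<close>, and
  \<open>F\<close> is at least \<open>f a\<close> times the number of candidates that fit as well as \<open>a\<close>.\<close>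

lemma spike_posterior_bound:
  fixes f v :: "nat \<Rightarrow> real"
  assumes f: "\<And>a. 0 < f a"
  shows "\<tau>\<^sup>2 * (\<Sum>a<q. f a)
    \<le> (\<Sum>a<q. f a * (\<Sum>c<q. (v c - (if c = a then \<tau> else 0))\<^sup>2))
      + \<tau>\<^sup>2 * (\<Sum>a<q. f a * (1 / (1 + real (card {b \<in> {..<q} - {a}. f a \<le> f b}))))"
proof (cases "q = 0")
  case False
  define F where "F = (\<Sum>a<q. f a)"
  have F: "0 < F" unfolding F_def using False f by (intro sum_pos) auto
  have rank: "f a * f a / F \<le> f a * (1 / (1 + real (card {b \<in> {..<q} - {a}. f a \<le> f b})))" if a: "a < q" for a
  proof -
    let ?S = "{b \<in> {..<q} - {a}. f a \<le> f b}"
    have "f a * (1 + real (card ?S)) = (\<Sum>b\<in>insert a ?S. f a)"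
      by (simp add: algebra_simps)
    also have "\<dots> \<le> (\<Sum>b\<in>insert a ?S. f b)" by (rule sum_mono) auto
    also have "\<dots> \<le> F" unfolding F_def using a f by (intro sum_mono2) (auto intro: less_imp_le)
    finally have "f a / F \<le> 1 / (1 + real (card ?S))"
      using F by (simp add: field_simps)
    then have "f a * (f a / F) \<le> f a * (1 / (1 + real (card ?S)))"
      using f [of a] by (intro mult_left_mono) auto
    then show ?thesis by simp
  qed
  have inner: "(\<Sum>c<q. (v c - (if c = a then \<tau> else 0))\<^sup>2) = (\<Sum>c<q. (v c)\<^sup>2) - 2 * \<tau> * v a + \<tau>\<^sup>2"
    if a: "a < q" for a
  proof -
    have "(\<Sum>c<q. (v c - (if c = a then \<tau> else 0))\<^sup>2) = (\<Sum>c<q. (v c)\<^sup>2 + (if c = a then \<tau>\<^sup>2 - 2 * \<tau> * v c else 0))"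
      by (rule sum.cong) (auto simp: power2_eq_square algebra_simps)
    then show ?thesis using a by (simp add: sum.distrib)
  qed
  have "(\<Sum>a<q. f a * (\<Sum>c<q. (v c - (if c = a then \<tau> else 0))\<^sup>2))
      = (\<Sum>a<q. f a * ((\<Sum>c<q. (v c)\<^sup>2) - 2 * \<tau> * v a + \<tau>\<^sup>2))"
    by (rule sum.cong) (auto simp: inner)
  also have "\<dots> = F * (\<Sum>c<q. (v c)\<^sup>2) - 2 * \<tau> * (\<Sum>a<q. v a * f a) + \<tau>\<^sup>2 * F"
  proof -
    have "(\<Sum>a<q. f a * (S - 2 * \<tau> * v a + \<tau>\<^sup>2)) = F * S - 2 * \<tau> * (\<Sum>a<q. v a * f a) + \<tau>\<^sup>2 * F" for S
      by (simp add: F_def sum.distrib sum_subtractf sum_distrib_left sum_distrib_right algebra_simps)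
    then show ?thesis .
  qed
  \<comment> \<open>Completing the square: the last sum, dropped in the next step, vanishes at the
    posterior mean \<open>v a = \<tau> * f a / F\<close>.\<close>
  also have "\<dots> = \<tau>\<^sup>2 * F - \<tau>\<^sup>2 * (\<Sum>a<q. f a * f a / F) + (\<Sum>a<q. F * (v a - \<tau> * f a / F)\<^sup>2)"
  proof -
    have "F * (v a - \<tau> * f a / F)\<^sup>2 = F * (v a)\<^sup>2 - 2 * \<tau> * (v a * f a) + \<tau>\<^sup>2 * (f a * f a / F)" for a
      using F by (simp add: power2_eq_square field_simps)
    then have "(\<Sum>a<q. F * (v a - \<tau> * f a / F)\<^sup>2)
        = F * (\<Sum>c<q. (v c)\<^sup>2) - 2 * \<tau> * (\<Sum>a<q. v a * f a) + \<tau>\<^sup>2 * (\<Sum>a<q. f a * f a / F)"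
      by (simp only: sum.distrib sum_subtractf sum_distrib_left)
    then show ?thesis by simp
  qed
  also have "\<dots> \<ge> \<tau>\<^sup>2 * F - \<tau>\<^sup>2 * (\<Sum>a<q. f a * f a / F)"
    using F by (simp add: sum_nonneg)
  finally have "\<tau>\<^sup>2 * F - \<tau>\<^sup>2 * (\<Sum>a<q. f a * f a / F)
      \<le> (\<Sum>a<q. f a * (\<Sum>c<q. (v c - (if c = a then \<tau> else 0))\<^sup>2))" .
  moreover have "\<tau>\<^sup>2 * (\<Sum>a<q. f a * f a / F)
      \<le> \<tau>\<^sup>2 * (\<Sum>a<q. f a * (1 / (1 + real (card {b \<in> {..<q} - {a}. f a \<le> f b}))))"
    by (intro mult_left_mono sum_mono rank) auto
  ultimately show ?thesis unfolding F_def by linarith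
qed simp

section \<open>The block prior and its Bayes risk\<close>

definition spike_vec :: "nat \<Rightarrow> nat \<Rightarrow> nat \<Rightarrow> real \<Rightarrow> (nat \<Rightarrow> nat) \<Rightarrow> nat \<Rightarrow> real" where
  "spike_vec p k q \<tau> \<pi> = (\<lambda>j\<in>{..<p}. if j < k * q \<and> \<pi> (j div q) = j mod q then \<tau> else 0)"

lemma block_index:
  fixes m k c q :: nat
  assumes "m < k" "c < q"
  shows "m * q + c < k * q" "(m * q + c) div q = m" "(m * q + c) mod q = c"
proof -
  have "m * q + c < Suc m * q" using assms by simp
  also have "\<dots> \<le> k * q" using assms by (intro mult_right_mono) auto
  finally show "m * q + c < k * q" .
qed (use assms in auto)

lemma spike_vec_block:
  assumes "k * q \<le> p" "m < k" "c < q"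
  shows "spike_vec p k q \<tau> \<pi> (m * q + c) = (if c = \<pi> m then \<tau> else 0)"
  using assms block_index [OF assms(2,3)] by (auto simp: spike_vec_def)

lemma sum_blocks:
  fixes g :: "nat \<Rightarrow> real"
  shows "(\<Sum>j<k * q. g j) = (\<Sum>m<k. \<Sum>c<q. g (m * q + c))"
proof -
  have "(\<Sum>j<k * q. g j) = (\<Sum>m<k. \<Sum>j\<in>{m * q..<m * q + q}. g j)"
    by (rule sum.nat_group [symmetric])
  also have "\<dots> = (\<Sum>m<k. \<Sum>c<q. g (m * q + c))"
  proof (rule sum.cong [OF refl])
    fix m
    show "(\<Sum>j\<in>{m * q..<m * q + q}. g j) = (\<Sum>c<q. g (m * q + c))"
      using sum.shift_bounds_nat_ivl [of g 0 "m * q" q]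
      by (simp add: atLeast0LessThan add.commute)
  qed
  finally show ?thesis .
qed

lemma spike_vec_in_sparse_params:
  assumes kq: "k * q \<le> p" and \<pi>: "\<pi> \<in> {..<k} \<rightarrow>\<^sub>E {..<q}"
  shows "spike_vec p k q \<tau> \<pi> \<in> sparse_params p k \<tau>"
proof -
  let ?s = "spike_vec p k q \<tau> \<pi>"
  have zero: "?s j = 0" if "j < p" "\<not> j < k * q" for j
    using that by (simp add: spike_vec_def)
  have "{j \<in> {..<p}. ?s j \<noteq> 0} \<subseteq> (\<lambda>m. m * q + \<pi> m) ` {..<k}"
  proof
    fix j assume "j \<in> {j \<in> {..<p}. ?s j \<noteq> 0}"
    then have j: "j < k * q" "\<pi> (j div q) = j mod q" by (auto simp: spike_vec_def split: if_splits)
    then have "j = (j div q) * q + \<pi> (j div q)" by simp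
    moreover have "j div q < k" using j(1) by (simp add: less_mult_imp_div_less)
    ultimately show "j \<in> (\<lambda>m. m * q + \<pi> m) ` {..<k}" by blast
  qed
  then have "l0_norm p ?s \<le> card ((\<lambda>m. m * q + \<pi> m) ` {..<k})"
    unfolding l0_norm_def by (intro card_mono) auto
  also have "\<dots> \<le> k" using card_image_le [of "{..<k}"] by force
  finally have l0: "l0_norm p ?s \<le> k" .
  have "(l2_norm p ?s)\<^sup>2 = (\<Sum>j<p. (?s j)\<^sup>2)"
    by (simp add: l2_norm_def L2_set_def sum_nonneg)
  also have "\<dots> = (\<Sum>j<k * q. (?s j)\<^sup>2)"
    using kq zero by (intro sum.mono_neutral_right) auto
  also have "\<dots> = (\<Sum>m<k. \<Sum>c<q. (?s (m * q + c))\<^sup>2)" by (rule sum_blocks)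
  also have "\<dots> = (\<Sum>m<k. \<Sum>c<q. if c = \<pi> m then \<tau>\<^sup>2 else 0)"
    using kq by (intro sum.cong) (auto simp: spike_vec_block)
  also have "\<dots> = real k * \<tau>\<^sup>2"
  proof -
    have "(\<Sum>c<q. if c = \<pi> m then \<tau>\<^sup>2 else 0) = \<tau>\<^sup>2" if "m < k" for m
    proof -
      have "\<pi> m < q" using that \<pi> by (auto simp: PiE_iff)
      then show ?thesis by simp
    qed
    then show ?thesis by simp
  qed
  finally have "(l2_norm p ?s)\<^sup>2 = real k * \<tau>\<^sup>2" .
  then show ?thesis using l0 by (simp add: sparse_params_def spike_vec_def)
qed

text \<open>At the true vector the residual is the noise, and moving the spike of one block changes
  it by \<tau> times a difference of two columns. Hence \<open>confused\<close>, which knows nothing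
  of the other blocks, decides the comparison of likelihoods for every configuration
  \<open>\<pi>\<close> of them.\<close>

lemma spike_swap_loss:
  assumes kq: "k * q \<le> p" and m: "m < k" and a: "a < q" and b: "b < q" and ab: "a \<noteq> b" and n: "0 < n"
    and c: "confused n p \<sigma> \<tau> (m * q + a) (m * q + b) \<omega>" and \<sigma>: "0 < \<sigma>"
  shows "data_density n p \<sigma> (spike_vec p k q \<tau> (\<pi>(m := a))) (gauss_data n p \<sigma> (spike_vec p k q \<tau> (\<pi>(m := a))) \<omega>)
    \<le> data_density n p \<sigma> (spike_vec p k q \<tau> (\<pi>(m := b))) (gauss_data n p \<sigma> (spike_vec p k q \<tau> (\<pi>(m := a))) \<omega>)"
proof (rule data_density_mono [OF \<sigma>])
  let ?A = "spike_vec p k q \<tau> (\<pi>(m := a))" and ?B = "spike_vec p k q \<tau> (\<pi>(m := b))"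
  let ?d = "gauss_data n p \<sigma> ?A \<omega>"
  have ja: "m * q + a < p" and jb: "m * q + b < p"
    using block_index(1) [OF m a] block_index(1) [OF m b] kq by auto
  have diff: "?A j - ?B j = (if j = m * q + a then \<tau> else 0) - (if j = m * q + b then \<tau> else 0)"
    if j: "j < p" for j
  proof (cases "j < k * q \<and> j div q = m")
    case True
    then have jm: "j = m * q + j mod q" by (metis mult_div_mod_eq mult.commute)
    have jq: "j mod q < q" using a by simp
    have "?A j = (if j mod q = a then \<tau> else 0)" "?B j = (if j mod q = b then \<tau> else 0)"
      using spike_vec_block [OF kq m jq] jm by auto
    moreover have "j = m * q + a \<longleftrightarrow> j mod q = a" "j = m * q + b \<longleftrightarrow> j mod q = b"
      using jm a b by auto
    ultimately show ?thesis by simp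
  next
    case False
    then have "?A j = ?B j" using j by (auto simp: spike_vec_def)
    moreover have "j \<noteq> m * q + a" "j \<noteq> m * q + b"
      using False block_index [OF m a] block_index [OF m b] by auto
    ultimately show ?thesis by simp
  qed
  have resA: "fst (?d i) - (\<Sum>j<p. snd (?d i) j * ?A j) = \<sigma> * \<omega> (i, p)" if "i < n" for i
    using that by (simp add: gauss_data_def gauss_obs_def)
  have resB: "fst (?d i) - (\<Sum>j<p. snd (?d i) j * ?B j)
      = \<sigma> * \<omega> (i, p) + \<tau> * (\<omega> (i, m * q + a) / sqrt (real n) - \<omega> (i, m * q + b) / sqrt (real n))"
    if i: "i < n" for i
  proof -
    have "fst (?d i) - (\<Sum>j<p. snd (?d i) j * ?B j)
        = \<sigma> * \<omega> (i, p) + (\<Sum>j<p. \<omega> (i, j) / sqrt (real n) * (?A j - ?B j))"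
      using i by (simp add: gauss_data_def gauss_obs_def right_diff_distrib sum_subtractf)
    also have "(\<Sum>j<p. \<omega> (i, j) / sqrt (real n) * (?A j - ?B j))
        = (\<Sum>j<p. (if j = m * q + a then \<omega> (i, j) / sqrt (real n) * \<tau> else 0)
            - (if j = m * q + b then \<omega> (i, j) / sqrt (real n) * \<tau> else 0))"
      by (rule sum.cong) (auto simp: diff)
    also have "\<dots> = \<tau> * (\<omega> (i, m * q + a) / sqrt (real n) - \<omega> (i, m * q + b) / sqrt (real n))"
      using ja jb by (simp add: sum_subtractf right_diff_distrib mult.commute)
    finally show ?thesis .
  qed
  show "(\<Sum>i<n. (fst (?d i) - (\<Sum>j<p. snd (?d i) j * ?B j))\<^sup>2)
      \<le> (\<Sum>i<n. (fst (?d i) - (\<Sum>j<p. snd (?d i) j * ?A j))\<^sup>2)"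
    using c by (simp add: resA resB confused_def)
qed

text \<open>Resampling one block of a uniform configuration leaves it uniform: exchanging the entry
  \<open>\<pi> m\<close> with the new value \<open>a\<close> is an involution on the pairs.\<close>

lemma sum_PiE_resample:
  fixes F :: "(nat \<Rightarrow> nat) \<Rightarrow> ennreal"
  assumes m: "m < k"
  shows "(\<Sum>\<pi>\<in>{..<k} \<rightarrow>\<^sub>E {..<q}. \<Sum>a<q. F (\<pi>(m := a))) = of_nat q * (\<Sum>\<pi>\<in>{..<k} \<rightarrow>\<^sub>E {..<q}. F \<pi>)"
proof -
  let ?P = "{..<k} \<rightarrow>\<^sub>E {..<q}"
  have up: "\<pi>(m := a) \<in> ?P" if "\<pi> \<in> ?P" "a < q" for \<pi> a
    using that m by (auto simp: PiE_iff extensional_def)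
  have val: "\<pi> m < q" if "\<pi> \<in> ?P" for \<pi>
    using that m by (auto simp: PiE_iff)
  have "(\<Sum>\<pi>\<in>?P. \<Sum>a<q. F (\<pi>(m := a))) = (\<Sum>(\<pi>, a)\<in>?P \<times> {..<q}. F (\<pi>(m := a)))"
    by (rule sum.cartesian_product)
  also have "\<dots> = (\<Sum>(\<pi>, a)\<in>?P \<times> {..<q}. F \<pi>)"
    by (rule sum.reindex_bij_witness [where i = "\<lambda>(\<pi>, a). (\<pi>(m := a), \<pi> m)" and j = "\<lambda>(\<pi>, a). (\<pi>(m := a), \<pi> m)"])
      (use up val in auto)
  also have "\<dots> = (\<Sum>\<pi>\<in>?P. \<Sum>a<q. F \<pi>)" by (rule sum.cartesian_product [symmetric])
  also have "\<dots> = of_nat q * (\<Sum>\<pi>\<in>?P. F \<pi>)" by (simp add: sum_distrib_left)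
  finally show ?thesis .
qed

lemma data_space_component_measurable:
  assumes "est \<in> estimators n p" "j < p"
  shows "(\<lambda>d. est d j) \<in> borel_measurable (data_space n p)"
  using measurable_compose [OF assms(1) [unfolded estimators_def vec_space_def],
      OF measurable_component_singleton] assms(2) by auto

text \<open>All coordinates outside block \<open>m\<close> are given to the statistician for free.\<close>

lemma block_risk_lower:
  assumes n: "0 < n" and \<sigma>: "0 < \<sigma>" and \<tau>: "0 < \<tau>" and d: "0 < \<delta>" "\<delta> < 1"
    and K: "0 < K" and M: "1 \<le> M" and kq: "k * q \<le> p" and m: "m < k" and est: "est \<in> estimators n p"
  defines "loss \<equiv> \<lambda>\<pi> d. \<Sum>c<q. (est d (m * q + c) - (if c = \<pi> m then \<tau> else 0))\<^sup>2"
    and "\<kappa> \<equiv> confusion_bound n (q - 1) (\<tau> / \<sigma>) K \<delta> M"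
  shows "ennreal (real q * \<tau>\<^sup>2)
    \<le> (\<Sum>a<q. \<integral>\<^sup>+d. ennreal (loss (\<pi>(m := a)) d) \<partial>data_law n p \<sigma> (spike_vec p k q \<tau> (\<pi>(m := a))))
      + ennreal (real q * \<tau>\<^sup>2 * \<kappa>)"
proof (cases "q = 0")
  case False
  then have q: "0 < q" by simp
  have p: "0 < p" using block_index(1) [OF m q] kq by linarith
  define \<beta> where "\<beta> a = spike_vec p k q \<tau> (\<pi>(m := a))" for a
  define f where "f a = data_density n p \<sigma> (\<beta> a)" for a
  define N where "N a d = 1 / (1 + real (card {b \<in> {..<q} - {a}. f a d \<le> f b d}))" for a d
  have f0: "0 < f a d" for a d unfolding f_def by (rule data_density_pos [OF \<sigma>])
  have fm [measurable]: "f a \<in> borel_measurable (data_space n p)" for a unfolding f_def by measurable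
  have estm: "(\<lambda>d. est d (m * q + c)) \<in> borel_measurable (data_space n p)" if "c < q" for c
    using data_space_component_measurable [OF est] block_index(1) [OF m that] kq by simp
  have lm [measurable]: "loss \<rho> \<in> borel_measurable (data_space n p)" for \<rho>
    unfolding loss_def using estm
    by (intro borel_measurable_sum borel_measurable_power borel_measurable_diff) auto
  have Nm [measurable]: "N a \<in> borel_measurable (data_space n p)" for a
  proof -
    have "real (card {b \<in> {..<q} - {a}. f a d \<le> f b d}) = (\<Sum>b\<in>{..<q} - {a}. if f a d \<le> f b d then 1 else 0)" for d
      by (simp add: sum.If_cases Int_def)
    then show ?thesis unfolding N_def by (simp only:) measurable
  qed
  have N0: "0 \<le> N a d" for a d by (simp add: N_def)
  have loss0: "0 \<le> loss \<rho> d" for \<rho> d by (simp add: loss_def sum_nonneg)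
  \<comment> \<open>The weight \<open>f a\<close> turns the base measure into the law of the data
    with the spike at \<open>a\<close>. There every confused competitor is at least as likely as
    \<open>a\<close>, so \<open>N a\<close> is at most the reciprocal bounded in
    \<open>nn_integral_confused_le\<close>.\<close>
  have rank: "(\<integral>\<^sup>+d. ennreal (f a d) * ennreal (N a d) \<partial>data_base n p) \<le> ennreal \<kappa>" if a: "a < q" for a
  proof -
    let ?B = "(\<lambda>b. m * q + b) ` ({..<q} - {a})"
    have ja: "m * q + a < p" using block_index(1) [OF m a] kq by simp
    have B: "?B \<subseteq> {..<p} - {m * q + a}"
      using block_index(1) [OF m] kq by (auto intro: less_le_trans)
    have cB: "card ?B = q - 1" using a by (subst card_image) (auto simp: inj_on_def)
    have "(\<integral>\<^sup>+d. ennreal (f a d) * ennreal (N a d) \<partial>data_base n p) = (\<integral>\<^sup>+d. ennreal (N a d) \<partial>data_law n p \<sigma> (\<beta> a))"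
      unfolding f_def by (rule nn_integral_data_law_density [OF n p \<sigma>, symmetric]) measurable
    also have "\<dots> = (\<integral>\<^sup>+\<omega>. ennreal (N a (gauss_data n p \<sigma> (\<beta> a) \<omega>)) \<partial>gauss ({..<n} \<times> {..p}))"
      by (rule nn_integral_data_law [OF n p]) measurable
    also have "\<dots> \<le> (\<integral>\<^sup>+\<omega>. ennreal (1 / (1 + real (card {b\<in>?B. confused n p \<sigma> \<tau> (m * q + a) b \<omega>})))
        \<partial>gauss ({..<n} \<times> {..p}))"
    proof (intro nn_integral_mono ennreal_leI)
      fix \<omega>
      let ?d = "gauss_data n p \<sigma> (\<beta> a) \<omega>"
      have "{b\<in>?B. confused n p \<sigma> \<tau> (m * q + a) b \<omega>} \<subseteq> (\<lambda>b. m * q + b) ` {b \<in> {..<q} - {a}. f a ?d \<le> f b ?d}"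
        using spike_swap_loss [OF kq m a _ _ n _ \<sigma>] by (auto simp: f_def \<beta>_def)
      then have "card {b\<in>?B. confused n p \<sigma> \<tau> (m * q + a) b \<omega>} \<le> card {b \<in> {..<q} - {a}. f a ?d \<le> f b ?d}"
        by (intro surj_card_le [of _ _ "\<lambda>b. m * q + b"]) auto
      then show "N a ?d \<le> 1 / (1 + real (card {b\<in>?B. confused n p \<sigma> \<tau> (m * q + a) b \<omega>}))"
        unfolding N_def by (intro divide_left_mono) auto
    qed
    also have "\<dots> \<le> ennreal \<kappa>"
      using nn_integral_confused_le [OF n \<sigma> \<tau> refl d K M ja B] unfolding cB \<kappa>_def .
    finally show ?thesis .
  qed
  have "ennreal (real q * \<tau>\<^sup>2) = (\<Sum>a<q. ennreal (\<tau>\<^sup>2) * (\<integral>\<^sup>+d. ennreal (f a d) \<partial>data_base n p))"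
  proof -
    have "(\<integral>\<^sup>+d. ennreal (f a d) \<partial>data_base n p) = 1" for a
      using nn_integral_data_law_density [OF n p \<sigma>, of "\<lambda>_. 1" "\<beta> a"]
        prob_space.emeasure_space_1 [OF prob_space_data_law [OF n p, of \<sigma> "\<beta> a"]]
      by (simp add: f_def)
    then show ?thesis by (simp add: ennreal_mult ennreal_of_nat_eq_real_of_nat)
  qed
  also have "\<dots> = (\<integral>\<^sup>+d. ennreal (\<tau>\<^sup>2 * (\<Sum>a<q. f a d)) \<partial>data_base n p)"
    by (subst ennreal_mult) (auto simp: sum_nonneg less_imp_le [OF f0] nn_integral_cmult nn_integral_sum
        sum_ennreal [symmetric] sum_distrib_left simp del: sum_ennreal)
  also have "\<dots> \<le> (\<integral>\<^sup>+d. (\<Sum>a<q. ennreal (f a d) * ennreal (loss (\<pi>(m := a)) d))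
      + ennreal (\<tau>\<^sup>2) * (\<Sum>a<q. ennreal (f a d) * ennreal (N a d)) \<partial>data_base n p)"
  proof (rule nn_integral_mono)
    fix d
    have "\<tau>\<^sup>2 * (\<Sum>a<q. f a d) \<le> (\<Sum>a<q. f a d * loss (\<pi>(m := a)) d) + \<tau>\<^sup>2 * (\<Sum>a<q. f a d * N a d)"
      using spike_posterior_bound [of "\<lambda>a. f a d" \<tau> q "\<lambda>c. est d (m * q + c)"] f0
      by (simp add: loss_def N_def)
    then have "ennreal (\<tau>\<^sup>2 * (\<Sum>a<q. f a d))
        \<le> ennreal ((\<Sum>a<q. f a d * loss (\<pi>(m := a)) d) + \<tau>\<^sup>2 * (\<Sum>a<q. f a d * N a d))"
      by (rule ennreal_leI)
    also have "\<dots> = (\<Sum>a<q. ennreal (f a d) * ennreal (loss (\<pi>(m := a)) d))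
      + ennreal (\<tau>\<^sup>2) * (\<Sum>a<q. ennreal (f a d) * ennreal (N a d))"
      using less_imp_le [OF f0] N0 loss0
      by (simp add: ennreal_plus sum_nonneg ennreal_mult sum_ennreal [symmetric] del: sum_ennreal)
    finally show "ennreal (\<tau>\<^sup>2 * (\<Sum>a<q. f a d))
        \<le> (\<Sum>a<q. ennreal (f a d) * ennreal (loss (\<pi>(m := a)) d))
          + ennreal (\<tau>\<^sup>2) * (\<Sum>a<q. ennreal (f a d) * ennreal (N a d))" .
  qed
  also have "\<dots> = (\<Sum>a<q. \<integral>\<^sup>+d. ennreal (f a d) * ennreal (loss (\<pi>(m := a)) d) \<partial>data_base n p)
      + ennreal (\<tau>\<^sup>2) * (\<Sum>a<q. \<integral>\<^sup>+d. ennreal (f a d) * ennreal (N a d) \<partial>data_base n p)"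
    by (simp add: nn_integral_add nn_integral_cmult nn_integral_sum)
  also have "\<dots> \<le> (\<Sum>a<q. \<integral>\<^sup>+d. ennreal (f a d) * ennreal (loss (\<pi>(m := a)) d) \<partial>data_base n p)
      + ennreal (\<tau>\<^sup>2) * (\<Sum>a<q. ennreal \<kappa>)"
    by (intro add_left_mono mult_left_mono sum_mono rank) auto
  also have "ennreal (\<tau>\<^sup>2) * (\<Sum>a<q. ennreal \<kappa>) = ennreal (real q * \<tau>\<^sup>2 * \<kappa>)"
    using confusion_bound_nonneg [OF d] unfolding \<kappa>_def
    by (simp add: ennreal_of_nat_eq_real_of_nat ennreal_mult [symmetric] mult_ac)
  also have "(\<Sum>a<q. \<integral>\<^sup>+d. ennreal (f a d) * ennreal (loss (\<pi>(m := a)) d) \<partial>data_base n p)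
      = (\<Sum>a<q. \<integral>\<^sup>+d. ennreal (loss (\<pi>(m := a)) d) \<partial>data_law n p \<sigma> (\<beta> a))"
    unfolding f_def by (intro sum.cong refl nn_integral_data_law_density [OF n p \<sigma>, symmetric]) measurable
  finally show ?thesis unfolding \<beta>_def .
qed simp

text \<open>The supremum dominates the average over the \<open>q ^ k\<close> configurations, and the
  loss splits over the blocks. In each block the average is first resampled by
  \<open>sum_PiE_resample\<close>, so that \<open>block_risk_lower\<close> applies with the other
  blocks held fixed.\<close>

lemma minimax_risk_lower:
  assumes n: "0 < n" and \<sigma>: "0 < \<sigma>" and \<tau>: "0 < \<tau>" and d: "0 < \<delta>" "\<delta> < 1"
    and K: "0 < K" and M: "1 \<le> M" and kq: "k * q \<le> p" and q: "0 < q"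
  shows "ennreal (real k * \<tau>\<^sup>2 * (1 - confusion_bound n (q - 1) (\<tau> / \<sigma>) K \<delta> M))
    \<le> minimax_risk n p \<sigma> (sparse_params p k \<tau>)"
  unfolding minimax_risk_def
proof (rule INF_greatest)
  fix est assume est: "est \<in> estimators n p"
  define \<kappa> where "\<kappa> = confusion_bound n (q - 1) (\<tau> / \<sigma>) K \<delta> M"
  have \<kappa>0: "0 \<le> \<kappa>" unfolding \<kappa>_def by (rule confusion_bound_nonneg [OF d])
  define S where "S = (SUP \<beta>\<in>sparse_params p k \<tau>. risk n p \<sigma> est \<beta>)"
  let ?P = "{..<k} \<rightarrow>\<^sub>E {..<q}"
  let ?\<beta> = "\<lambda>\<pi>. spike_vec p k q \<tau> \<pi>"
  define loss where "loss m \<pi> d = (\<Sum>c<q. (est d (m * q + c) - (if c = \<pi> m then \<tau> else 0))\<^sup>2)" for m \<pi> d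
  define R where "R m \<pi> = (\<integral>\<^sup>+d. ennreal (loss m \<pi> d) \<partial>data_law n p \<sigma> (?\<beta> \<pi>))" for m \<pi>
  have finP: "finite ?P" by (rule finite_PiE) auto
  have cP: "card ?P = q ^ k" by (simp add: card_PiE)
  have lossm: "loss m \<pi> \<in> borel_measurable (data_space n p)" if m: "m < k" for m \<pi>
  proof -
    have "(\<lambda>d. est d (m * q + c)) \<in> borel_measurable (data_space n p)" if "c < q" for c
      using data_space_component_measurable [OF est] block_index(1) [OF m that] kq by simp
    then show ?thesis unfolding loss_def
      by (intro borel_measurable_sum borel_measurable_power borel_measurable_diff) auto
  qed
  have loss0: "0 \<le> loss m \<pi> d" for m \<pi> d by (simp add: loss_def sum_nonneg)
  have R_le: "(\<Sum>m<k. R m \<pi>) \<le> S" if \<pi>: "\<pi> \<in> ?P" for \<pi>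
  proof -
    have "(\<Sum>m<k. R m \<pi>) = (\<integral>\<^sup>+d. (\<Sum>m<k. ennreal (loss m \<pi> d)) \<partial>data_law n p \<sigma> (?\<beta> \<pi>))"
      unfolding R_def using lossm
      by (intro nn_integral_sum [symmetric] measurable_compose [OF _ measurable_ennreal])
        (auto cong: measurable_cong_sets)
    also have "\<dots> \<le> risk n p \<sigma> est (?\<beta> \<pi>)"
      unfolding risk_def
    proof (rule nn_integral_mono)
      fix d
      have "(\<Sum>m<k. ennreal (loss m \<pi> d)) = ennreal (\<Sum>m<k. loss m \<pi> d)"
        using loss0 by (simp add: sum_ennreal)
      also have "(\<Sum>m<k. loss m \<pi> d) = (\<Sum>m<k. \<Sum>c<q. (est d (m * q + c) - ?\<beta> \<pi> (m * q + c))\<^sup>2)"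
        unfolding loss_def using kq by (intro sum.cong) (auto simp: spike_vec_block)
      also have "\<dots> = (\<Sum>j<k * q. (est d j - ?\<beta> \<pi> j)\<^sup>2)" by (rule sum_blocks [symmetric])
      also have "ennreal \<dots> \<le> ennreal (\<Sum>j<p. (est d j - ?\<beta> \<pi> j)\<^sup>2)"
        using kq by (intro ennreal_leI sum_mono2) auto
      finally show "(\<Sum>m<k. ennreal (loss m \<pi> d)) \<le> ennreal ((l2_norm p (\<lambda>j. est d j - ?\<beta> \<pi> j))\<^sup>2)"
        by (simp add: l2_norm_def L2_set_def sum_nonneg)
    qed
    also have "\<dots> \<le> S" unfolding S_def
      by (rule SUP_upper) (rule spike_vec_in_sparse_params [OF kq \<pi>])
    finally show ?thesis .
  qed
  have block: "of_nat (q ^ k) * ennreal (\<tau>\<^sup>2) \<le> (\<Sum>\<pi>\<in>?P. R m \<pi>) + of_nat (q ^ k) * ennreal (\<tau>\<^sup>2 * \<kappa>)" if m: "m < k" for m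
  proof -
    have "ennreal (real q) * (of_nat (q ^ k) * ennreal (\<tau>\<^sup>2)) = (\<Sum>\<pi>\<in>?P. ennreal (real q * \<tau>\<^sup>2))"
      by (simp add: cP ennreal_mult mult_ac)
    also have "\<dots> \<le> (\<Sum>\<pi>\<in>?P. (\<Sum>a<q. R m (\<pi>(m := a))) + ennreal (real q * \<tau>\<^sup>2 * \<kappa>))"
      using block_risk_lower [OF n \<sigma> \<tau> d K M kq m est]
      unfolding R_def loss_def \<kappa>_def by (intro sum_mono) simp
    also have "\<dots> = ennreal (real q) * ((\<Sum>\<pi>\<in>?P. R m \<pi>) + of_nat (q ^ k) * ennreal (\<tau>\<^sup>2 * \<kappa>))"
      using \<kappa>0 by (simp add: sum.distrib sum_PiE_resample [OF m] cP ennreal_mult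
          ennreal_of_nat_eq_real_of_nat [of q] distrib_left mult_ac)
    finally show ?thesis using q by (subst (asm) ennreal_mult_le_mult_iff) auto
  qed
  have "of_nat (q ^ k) * ennreal (real k * \<tau>\<^sup>2) = (\<Sum>m<k. of_nat (q ^ k) * ennreal (\<tau>\<^sup>2))"
    by (simp add: ennreal_mult ennreal_of_nat_eq_real_of_nat [of k] mult_ac)
  also have "\<dots> \<le> (\<Sum>m<k. (\<Sum>\<pi>\<in>?P. R m \<pi>) + of_nat (q ^ k) * ennreal (\<tau>\<^sup>2 * \<kappa>))"
    by (intro sum_mono block) simp
  also have "\<dots> = (\<Sum>\<pi>\<in>?P. \<Sum>m<k. R m \<pi>) + of_nat (q ^ k) * ennreal (real k * \<tau>\<^sup>2 * \<kappa>)"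
    using \<kappa>0 by (subst sum.swap)
      (simp add: sum.distrib ennreal_mult ennreal_of_nat_eq_real_of_nat [of k] mult_ac)
  also have "\<dots> \<le> (\<Sum>\<pi>\<in>?P. S) + of_nat (q ^ k) * ennreal (real k * \<tau>\<^sup>2 * \<kappa>)"
    by (intro add_right_mono sum_mono R_le)
  also have "\<dots> = of_nat (q ^ k) * (S + ennreal (real k * \<tau>\<^sup>2 * \<kappa>))"
    by (simp add: cP distrib_left)
  finally have *: "ennreal (real k * \<tau>\<^sup>2) \<le> S + ennreal (real k * \<tau>\<^sup>2 * \<kappa>)"
    using q by (subst (asm) ennreal_mult_le_mult_iff) (auto simp: ennreal_of_nat_eq_real_of_nat)
  \<comment> \<open>The term with \<kappa> is subtracted in the reals. For infinite \<open>S\<close>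
    nothing is to be shown, and for \<kappa> above 1 the left side is 0.\<close>
  show "ennreal (real k * \<tau>\<^sup>2 * (1 - \<kappa>)) \<le> S"
  proof (cases S)
    case (real s)
    have "S + ennreal (real k * \<tau>\<^sup>2 * \<kappa>) = ennreal (s + real k * \<tau>\<^sup>2 * \<kappa>)"
      using real \<kappa>0 by (simp add: ennreal_plus)
    with * have "ennreal (real k * \<tau>\<^sup>2) \<le> ennreal (s + real k * \<tau>\<^sup>2 * \<kappa>)" by simp
    moreover have "0 \<le> s + real k * \<tau>\<^sup>2 * \<kappa>" using real(1) \<kappa>0 by simp
    ultimately have "real k * \<tau>\<^sup>2 \<le> s + real k * \<tau>\<^sup>2 * \<kappa>" by (simp only: ennreal_le_iff)
    then have "real k * \<tau>\<^sup>2 * (1 - \<kappa>) \<le> s" by (simp add: right_diff_distrib)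
    then show ?thesis unfolding real(2) by (rule ennreal_leI)
  qed simp
qed

section \<open>Thresholding after a pilot estimate\<close>

definition residual :: "nat \<Rightarrow> (nat \<Rightarrow> real) \<Rightarrow> real \<times> (nat \<Rightarrow> real) \<Rightarrow> real" where
  "residual p b r = fst r - (\<Sum>j<p. snd r j * b j)"

definition soft_threshold :: "real \<Rightarrow> real \<Rightarrow> real" where
  "soft_threshold l u = sgn u * max 0 (\<bar>u\<bar> - l)"

lemma abs_soft_threshold: "0 \<le> l \<Longrightarrow> \<bar>soft_threshold l u\<bar> = max 0 (\<bar>u\<bar> - l)"
  by (auto simp: soft_threshold_def abs_mult abs_sgn_eq)

lemma sum_Times_singleton: "(\<Sum>c\<in>I \<times> {j}. g c) = (\<Sum>i\<in>I. g (i, j))"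
proof -
  have "I \<times> {j} = (\<lambda>i. (i, j)) ` I" by auto
  then show ?thesis by (simp add: sum.reindex inj_on_def)
qed

lemma soft_threshold_diff: "0 \<le> l \<Longrightarrow> \<bar>soft_threshold l u - u\<bar> \<le> l"
  by (auto simp: soft_threshold_def sgn_if max_def)

text \<open>A debiased pilot: a product of column \<open>j\<close> with the residual has mean
  \<open>(\<beta> j - b j) / n\<close>, so for a vector \<open>b\<close> chosen independently of the
  observations in \<open>I\<close> the result is unbiased for \<open>\<beta> j\<close>.\<close>

definition corrected ::
  "nat \<Rightarrow> nat \<Rightarrow> nat set \<Rightarrow> (nat \<Rightarrow> real) \<Rightarrow> (nat \<Rightarrow> real \<times> (nat \<Rightarrow> real)) \<Rightarrow> nat \<Rightarrow> real" where
  "corrected n p I b d j = b j + real n / real (card I) * (\<Sum>i\<in>I. snd (d i) j * residual p b (d i))"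

definition threshold ::
  "nat \<Rightarrow> nat \<Rightarrow> nat set \<Rightarrow> real \<Rightarrow> (nat \<Rightarrow> real) \<Rightarrow> (nat \<Rightarrow> real \<times> (nat \<Rightarrow> real)) \<Rightarrow> real" where
  "threshold n p I L b d
     = L * (real n / real (card I)) * sqrt ((\<Sum>i\<in>I. (residual p b (d i))\<^sup>2) / real n)"

definition second_stage ::
  "nat \<Rightarrow> nat \<Rightarrow> nat set \<Rightarrow> real \<Rightarrow> (nat \<Rightarrow> real) \<Rightarrow> (nat \<Rightarrow> real \<times> (nat \<Rightarrow> real)) \<Rightarrow> nat \<Rightarrow> real" where
  "second_stage n p I L b d j = soft_threshold (threshold n p I L b d) (corrected n p I b d j)"

text \<open>The variance of the residual at \<open>b\<close>: for the second stage the error of the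
  pilot is just additional noise.\<close>

definition noise_level :: "nat \<Rightarrow> nat \<Rightarrow> real \<Rightarrow> (nat \<Rightarrow> real) \<Rightarrow> (nat \<Rightarrow> real) \<Rightarrow> real" where
  "noise_level n p \<sigma> \<beta> b = \<sigma>\<^sup>2 + (\<Sum>l<p. (\<beta> l - b l)\<^sup>2) / real n"

lemma noise_level_pos: "0 < \<sigma> \<Longrightarrow> 0 < noise_level n p \<sigma> \<beta> b"
  unfolding noise_level_def by (intro add_pos_nonneg divide_nonneg_nonneg sum_nonneg) auto

lemma measurable_residual [measurable]: "residual p b \<in> borel_measurable (obs_space p)"
  using measurable_obs_linear [where a=1 and p=p and c="\<lambda>l. - b l"]
  by (simp add: residual_def [abs_def] sum_negf)

lemma distr_residual:
  assumes n: "0 < n" and p: "0 < p" and \<sigma>: "0 < \<sigma>"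
  shows "distr (obs_law n p \<sigma> \<beta>) borel (residual p b) = normal_distribution 0 (noise_level n p \<sigma> \<beta> b)"
  using distr_obs_law_linear [OF n p, of "noise_level n p \<sigma> \<beta> b" 1 \<sigma> \<beta> "\<lambda>l. - b l"]
    noise_level_pos [OF \<sigma>, of n p \<beta> b]
  by (simp add: residual_def [abs_def] sum_negf noise_level_def)

lemma measurable_data_component:
  "i < n \<Longrightarrow> (\<lambda>d. d i) \<in> data_space n p \<rightarrow>\<^sub>M obs_space p"
  unfolding data_space_def by (rule measurable_component_singleton) simp

lemma measurable_data_residual:
  "i < n \<Longrightarrow> (\<lambda>d. residual p b (d i)) \<in> borel_measurable (data_space n p)"
  by (rule measurable_compose [OF measurable_data_component]) auto

lemma measurable_data_design:
  "i < n \<Longrightarrow> j < p \<Longrightarrow> (\<lambda>d. snd (d i) j) \<in> borel_measurable (data_space n p)"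
  by (rule measurable_compose [OF measurable_data_component measurable_obs_coord])

lemma measurable_corrected:
  assumes "I \<subseteq> {..<n}" "j < p"
  shows "(\<lambda>d. corrected n p I b d j) \<in> borel_measurable (data_space n p)"
  unfolding corrected_def using assms
  by (intro borel_measurable_add borel_measurable_times borel_measurable_const borel_measurable_sum
      measurable_data_design measurable_data_residual) auto

lemma measurable_threshold:
  assumes "I \<subseteq> {..<n}"
  shows "threshold n p I L b \<in> borel_measurable (data_space n p)"
proof -
  have [measurable]: "(\<lambda>d. \<Sum>i\<in>I. (residual p b (d i))\<^sup>2) \<in> borel_measurable (data_space n p)"
    using assms by (intro borel_measurable_sum borel_measurable_power measurable_data_residual) auto
  show ?thesis unfolding threshold_def [abs_def] by measurable
qed

lemma measurable_second_stage:
  assumes "I \<subseteq> {..<n}" "j < p"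
  shows "(\<lambda>d. second_stage n p I L b d j) \<in> borel_measurable (data_space n p)"
proof -
  note [measurable] = measurable_threshold [OF assms(1)] measurable_corrected [OF assms]
  show ?thesis unfolding second_stage_def soft_threshold_def by measurable
qed

lemma nn_integral_data_law_restrict:
  assumes n: "0 < n" and p: "0 < p" and I: "I \<subseteq> {..<n}"
    and [measurable]: "f \<in> borel_measurable (PiM I (\<lambda>_. obs_law n p \<sigma> \<beta>))"
  shows "(\<integral>\<^sup>+d. f (restrict d I) \<partial>data_law n p \<sigma> \<beta>) = (\<integral>\<^sup>+d. f d \<partial>PiM I (\<lambda>_. obs_law n p \<sigma> \<beta>))"
proof -
  let ?M = "\<lambda>_::nat. obs_law n p \<sigma> \<beta>"
  have "distr (PiM {..<n} ?M) (PiM I ?M) (\<lambda>d. \<lambda>i\<in>I. d i) = PiM I ?M"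
    using distr_PiM_reindex [of "{..<n}" ?M "\<lambda>i. i" I] I prob_space_obs_law [OF n p] by auto
  then have "(\<integral>\<^sup>+d. f d \<partial>PiM I ?M) = (\<integral>\<^sup>+d. f d \<partial>distr (PiM {..<n} ?M) (PiM I ?M) (\<lambda>d. \<lambda>i\<in>I. d i))"
    by simp
  also have "\<dots> = (\<integral>\<^sup>+d. f (restrict d I) \<partial>PiM {..<n} ?M)"
    using I by (intro nn_integral_distr measurable_restrict_subset) auto
  finally show ?thesis by (simp add: data_law_def)
qed

lemma nn_integral_data_residual_square:
  assumes n: "0 < n" and p: "0 < p" and \<sigma>: "0 < \<sigma>" and I: "I \<subseteq> {..<n}"
  shows "(\<integral>\<^sup>+d. ennreal (\<Sum>i\<in>I. (residual p b (d i))\<^sup>2) \<partial>data_law n p \<sigma> \<beta>)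
    = ennreal (real (card I) * noise_level n p \<sigma> \<beta> b)"
proof -
  let ?v = "noise_level n p \<sigma> \<beta> b"
  have v: "0 < ?v" by (rule noise_level_pos [OF \<sigma>])
  have one: "(\<integral>\<^sup>+d. ennreal ((residual p b (d i))\<^sup>2) \<partial>data_law n p \<sigma> \<beta>) = ennreal ?v" if i: "i \<in> I" for i
  proof -
    have "(\<integral>\<^sup>+d. ennreal ((residual p b (d i))\<^sup>2) \<partial>data_law n p \<sigma> \<beta>)
        = (\<integral>\<^sup>+r. ennreal ((residual p b r)\<^sup>2) \<partial>distr (data_law n p \<sigma> \<beta>) (obs_law n p \<sigma> \<beta>) (\<lambda>d. d i))"
      using i I by (subst nn_integral_distr) (auto simp: data_law_def intro!: measurable_component_singleton)
    also have "distr (data_law n p \<sigma> \<beta>) (obs_law n p \<sigma> \<beta>) (\<lambda>d. d i) = obs_law n p \<sigma> \<beta>"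
      unfolding data_law_def using i I prob_space_obs_law [OF n p] by (intro distr_PiM_component) auto
    also have "(\<integral>\<^sup>+r. ennreal ((residual p b r)\<^sup>2) \<partial>obs_law n p \<sigma> \<beta>) = ennreal ?v"
      by (rule normal_rv_moments(3) [OF _ distr_residual [OF n p \<sigma>] v]) simp
    finally show ?thesis .
  qed
  have m: "(\<lambda>d. ennreal ((residual p b (d i))\<^sup>2)) \<in> borel_measurable (data_law n p \<sigma> \<beta>)" if "i \<in> I" for i
    using measurable_data_residual [of i n] that I by (auto cong: measurable_cong_sets)
  have "(\<integral>\<^sup>+d. ennreal (\<Sum>i\<in>I. (residual p b (d i))\<^sup>2) \<partial>data_law n p \<sigma> \<beta>)
      = (\<Sum>i\<in>I. \<integral>\<^sup>+d. ennreal ((residual p b (d i))\<^sup>2) \<partial>data_law n p \<sigma> \<beta>)"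
    using m by (simp add: sum_ennreal [symmetric] nn_integral_sum del: sum_ennreal)
  then show ?thesis using v by (simp add: one ennreal_of_nat_eq_real_of_nat ennreal_mult)
qed

section \<open>Risk of the second stage for a fixed pilot vector\<close>

context
  fixes n p :: nat and \<sigma> L :: real and \<beta> b :: "nat \<Rightarrow> real" and I :: "nat set"
  assumes n: "0 < n" and \<sigma>: "0 < \<sigma>" and L: "0 \<le> L" and I: "I \<subseteq> {..<n}" "I \<noteq> {}"
begin

lemma card_I_pos: "0 < card I"
  using I by (simp add: card_gt_0_iff finite_subset)

lemma threshold_nonneg: "0 \<le> threshold n p I L b d"
  unfolding threshold_def using L by (auto intro!: mult_nonneg_nonneg divide_nonneg_nonneg sum_nonneg)

lemma threshold_square:
  "(threshold n p I L b d)\<^sup>2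
    = L\<^sup>2 * ((real n / real (card I))\<^sup>2 / real n) * (\<Sum>i\<in>I. (residual p b (d i))\<^sup>2)"
proof -
  have "0 \<le> (\<Sum>i\<in>I. (residual p b (d i))\<^sup>2) / real n" by (simp add: sum_nonneg)
  then show ?thesis
    by (simp only: threshold_def power_mult_distrib real_sqrt_pow2) simp
qed

lemma nn_integral_threshold_square:
  assumes p: "0 < p"
  shows "(\<integral>\<^sup>+d. ennreal ((threshold n p I L b d)\<^sup>2) \<partial>data_law n p \<sigma> \<beta>)
    = ennreal (L\<^sup>2 * (real n / real (card I) * noise_level n p \<sigma> \<beta> b))"
proof -
  have m: "(\<lambda>d. ennreal (\<Sum>i\<in>I. (residual p b (d i))\<^sup>2)) \<in> borel_measurable (data_law n p \<sigma> \<beta>)"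
    using measurable_data_residual I
    by (intro measurable_compose [OF _ measurable_ennreal] borel_measurable_sum borel_measurable_power)
      (auto cong: measurable_cong_sets)
  have "(\<integral>\<^sup>+d. ennreal ((threshold n p I L b d)\<^sup>2) \<partial>data_law n p \<sigma> \<beta>)
      = ennreal (L\<^sup>2 * ((real n / real (card I))\<^sup>2 / real n))
        * (\<integral>\<^sup>+d. ennreal (\<Sum>i\<in>I. (residual p b (d i))\<^sup>2) \<partial>data_law n p \<sigma> \<beta>)"
  proof -
    have "ennreal ((threshold n p I L b d)\<^sup>2)
        = ennreal (L\<^sup>2 * ((real n / real (card I))\<^sup>2 / real n)) * ennreal (\<Sum>i\<in>I. (residual p b (d i))\<^sup>2)" for d
      unfolding threshold_square by (rule ennreal_mult) (simp_all add: sum_nonneg)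
    then show ?thesis by (simp only: nn_integral_cmult [OF m])
  qed
  also have "\<dots> = ennreal (L\<^sup>2 * ((real n / real (card I))\<^sup>2 / real n) * (real (card I) * noise_level n p \<sigma> \<beta> b))"
    using noise_level_pos [OF \<sigma>, of n p \<beta> b]
    unfolding nn_integral_data_residual_square [OF n p \<sigma> I(1)]
    by (intro ennreal_mult [symmetric]) auto
  also have "L\<^sup>2 * ((real n / real (card I))\<^sup>2 / real n) * (real (card I) * noise_level n p \<sigma> \<beta> b)
      = L\<^sup>2 * (real n / real (card I) * noise_level n p \<sigma> \<beta> b)"
    using n card_I_pos by (simp add: power2_eq_square)
  finally show ?thesis .
qed

text \<open>By unbiasedness only the variance remains. The constant 3 is crude but harmless: the
  bound is applied on at most \<open>2 * k\<close> coordinates, and there it lacks the logarithmic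
  factor of the main term.\<close>

lemma nn_integral_corrected_error:
  assumes j: "j < p"
  shows "(\<integral>\<^sup>+d. ennreal ((corrected n p I b d j - \<beta> j)\<^sup>2) \<partial>data_law n p \<sigma> \<beta>)
    \<le> ennreal (3 * (real n / real (card I) * noise_level n p \<sigma> \<beta> b))"
proof -
  have p: "0 < p" using j by simp
  let ?s = "real n / real (card I)" and ?v = "noise_level n p \<sigma> \<beta> b"
  let ?L = "obs_law n p \<sigma> \<beta>"
  have finI: "finite I" using I finite_subset by blast
  define \<xi> where "\<xi> r = snd r j * (fst r - (\<Sum>l<p. snd r l * b l)) - (\<beta> j - b j) / real n" for r :: "real \<times> (nat \<Rightarrow> real)"
  note mom = obs_correlation_moments [OF n j \<sigma>, of ?v \<beta> b, folded \<xi>_def, OF noise_level_def]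
  have [measurable]: "\<xi> \<in> borel_measurable ?L" using mom(1) by auto
  have eq: "corrected n p I b d j - \<beta> j = ?s * (\<Sum>i\<in>I. \<xi> (restrict d I i))" for d
  proof -
    have "?s * (\<Sum>i\<in>I. \<xi> (restrict d I i)) = ?s * ((\<Sum>i\<in>I. snd (d i) j * residual p b (d i)) - real (card I) * ((\<beta> j - b j) / real n))"
      by (simp add: \<xi>_def residual_def sum_subtractf)
    also have "\<dots> = corrected n p I b d j - \<beta> j"
    proof -
      have "?s * (real (card I) * ((\<beta> j - b j) / real n)) = \<beta> j - b j" using n card_I_pos by simp
      then show ?thesis unfolding corrected_def by (simp only: right_diff_distrib [of ?s])
    qed
    finally show ?thesis ..
  qed
  have "(\<integral>\<^sup>+d. ennreal ((corrected n p I b d j - \<beta> j)\<^sup>2) \<partial>data_law n p \<sigma> \<beta>)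
      = (\<integral>\<^sup>+d. ennreal (?s\<^sup>2) * ennreal ((\<Sum>i\<in>I. \<xi> (d i))\<^sup>2) \<partial>PiM I (\<lambda>_. ?L))"
    unfolding eq power_mult_distrib ennreal_mult [OF zero_le_power2 zero_le_power2]
    by (rule nn_integral_data_law_restrict [OF n p I(1)]) measurable
  also have "\<dots> = ennreal (?s\<^sup>2) * (\<integral>\<^sup>+d. ennreal ((\<Sum>i\<in>I. \<xi> (d i))\<^sup>2) \<partial>PiM I (\<lambda>_. ?L))"
    by (rule nn_integral_cmult) measurable
  also have "\<dots> = ennreal (?s\<^sup>2) * (of_nat (card I) * (\<integral>\<^sup>+r. ennreal ((\<xi> r)\<^sup>2) \<partial>?L))"
    by (simp only: nn_integral_centered_sum_square [OF prob_space_obs_law [OF n p] mom(1-3) finI])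
  also have "\<dots> \<le> ennreal (?s\<^sup>2) * (of_nat (card I) * ennreal (3 * ?v / real n))"
    by (intro mult_left_mono mom(4)) auto
  also have "\<dots> = ennreal (?s\<^sup>2 * (real (card I) * (3 * ?v / real n)))"
  proof -
    have "0 \<le> 3 * ?v / real n" using noise_level_pos [OF \<sigma>, of n p \<beta> b] by simp
    then show ?thesis
      by (simp only: ennreal_of_nat_eq_real_of_nat ennreal_mult zero_le_power2 mult_nonneg_nonneg of_nat_0_le_iff)
  qed
  also have "?s\<^sup>2 * (real (card I) * (3 * ?v / real n)) = 3 * (?s * ?v)"
    using n card_I_pos by (simp add: power2_eq_square)
  finally show ?thesis .
qed

text \<open>Conditionally on the residuals, column \<open>j\<close> is independent of them, so the correlation is
  exactly Gaussian and the data-driven threshold is \<open>L\<close> of its standard deviations.\<close>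

lemma nn_integral_null_excess:
  assumes j: "j < p" and null: "\<beta> j = b j"
  shows "(\<integral>\<^sup>+d. ennreal ((max 0 (\<bar>corrected n p I b d j - b j\<bar> - threshold n p I L b d))\<^sup>2) \<partial>data_law n p \<sigma> \<beta>)
    \<le> ennreal (exp (- (L\<^sup>2) / 2) * (real n / real (card I) * noise_level n p \<sigma> \<beta> b))"
proof -
  have p: "0 < p" using j by simp
  let ?s = "real n / real (card I)" and ?v = "noise_level n p \<sigma> \<beta> b"
  have finI: "finite I" using I finite_subset by blast
  let ?G = "{..<n} \<times> {..p}" and ?K = "I \<times> {j}" and ?J = "{..<n} \<times> {..p} - I \<times> {j}"
  have JK: "?J \<inter> ?K = {}" "finite ?J" "finite ?K" "?J \<union> ?K = ?G"
    using finI I j by auto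
  let ?D = "\<lambda>\<omega>. gauss_data n p \<sigma> \<beta> \<omega>"
  define w where "w \<omega> i = residual p b (?D \<omega> i)" for \<omega> i
  define V where "V \<omega> = (\<Sum>i\<in>I. (?s * w \<omega> i / sqrt (real n))\<^sup>2)" for \<omega>
  define f where "f d = ennreal ((max 0 (\<bar>corrected n p I b d j - b j\<bar> - threshold n p I L b d))\<^sup>2)" for d
  note [measurable] = measurable_threshold [OF I(1)] measurable_corrected [OF I(1) j]
  have fm [measurable]: "f \<in> borel_measurable (data_space n p)" unfolding f_def by measurable
  have V_eq: "V \<omega> = ?s\<^sup>2 / real n * (\<Sum>i\<in>I. (residual p b (?D \<omega> i))\<^sup>2)" for \<omega>
    by (simp add: V_def w_def power_mult_distrib power_divide sum_distrib_left)
  have thr: "threshold n p I L b (?D \<omega>) = L * sqrt (V \<omega>)" for \<omega>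
    using L by (intro power2_eq_imp_eq [OF _ threshold_nonneg])
      (auto simp: threshold_square V_eq power_mult_distrib sum_nonneg)
  have cor: "corrected n p I b (?D \<omega>) j - b j = (\<Sum>c\<in>?K. ?s * w \<omega> (fst c) / sqrt (real n) * \<omega> c)" for \<omega>
  proof -
    have "(\<Sum>c\<in>?K. ?s * w \<omega> (fst c) / sqrt (real n) * \<omega> c) = (\<Sum>i\<in>I. ?s * w \<omega> i / sqrt (real n) * \<omega> (i, j))"
      by (rule sum_Times_singleton [THEN trans]) simp
    also have "\<dots> = ?s * (\<Sum>i\<in>I. snd (?D \<omega> i) j * residual p b (?D \<omega> i))"
      unfolding sum_distrib_left
      by (rule sum.cong) (use I j in \<open>auto simp: w_def gauss_data_def gauss_obs_def mult_ac\<close>)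
    finally show ?thesis by (simp add: corrected_def)
  qed
  \<comment> \<open>Because \<open>\<beta> j = b j\<close>, column \<open>j\<close> drops out of the
    residuals; they, and with them the threshold, are constant in the inner integral.\<close>
  have w_merge: "w (merge ?J ?K (x, y)) i = w (merge ?J ?K (x, y')) i" if i: "i \<in> I" for x y y' i
  proof -
    have wi: "w \<omega> i = (\<Sum>l\<in>{..<p} - {j}. \<omega> (i, l) / sqrt (real n) * (\<beta> l - b l)) + \<sigma> * \<omega> (i, p)" for \<omega>
    proof -
      have "w \<omega> i = (\<Sum>l<p. \<omega> (i, l) / sqrt (real n) * (\<beta> l - b l)) + \<sigma> * \<omega> (i, p)"
        using i I by (auto simp: w_def residual_def gauss_data_def gauss_obs_def right_diff_distrib sum_subtractf)
      also have "(\<Sum>l<p. \<omega> (i, l) / sqrt (real n) * (\<beta> l - b l))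
          = (\<Sum>l\<in>{..<p} - {j}. \<omega> (i, l) / sqrt (real n) * (\<beta> l - b l))"
        using null by (intro sum.mono_neutral_right) auto
      finally show ?thesis .
    qed
    have "merge ?J ?K (x, y) (i, l) = merge ?J ?K (x, y') (i, l)" if "l \<noteq> j" for l
      using that by (auto simp: merge_def)
    then show ?thesis unfolding wi using j by (auto intro!: sum.cong arg_cong2 [of _ _ _ _ "(+)"])
  qed
  have Vm: "(\<lambda>\<omega>. ennreal (V \<omega>)) \<in> borel_measurable (gauss ?G)"
  proof -
    have "(\<lambda>d. ?s\<^sup>2 / real n * (\<Sum>i\<in>I. (residual p b (d i))\<^sup>2)) \<in> borel_measurable (data_space n p)"
      using I by (intro borel_measurable_times borel_measurable_const borel_measurable_sum
          borel_measurable_power measurable_data_residual) auto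
    from measurable_compose [OF measurable_compose [OF measurable_gauss_data this] measurable_ennreal]
    show ?thesis by (simp add: V_eq)
  qed
  have "(\<integral>\<^sup>+d. f d \<partial>data_law n p \<sigma> \<beta>) = (\<integral>\<^sup>+\<omega>. f (?D \<omega>) \<partial>gauss ?G)"
    by (rule nn_integral_data_law [OF n p fm])
  also have "\<dots> = (\<integral>\<^sup>+x. (\<integral>\<^sup>+y. f (?D (merge ?J ?K (x, y))) \<partial>gauss ?K) \<partial>gauss ?J)"
    using nn_integral_gauss_fold [OF JK(1-3), of "\<lambda>\<omega>. f (?D \<omega>)"] measurable_compose [OF measurable_gauss_data fm]
    unfolding JK(4) .
  also have "\<dots> \<le> (\<integral>\<^sup>+x. (\<integral>\<^sup>+y. ennreal (exp (- (L\<^sup>2) / 2)) * ennreal (V (merge ?J ?K (x, y))) \<partial>gauss ?K) \<partial>gauss ?J)"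
  proof (rule nn_integral_mono)
    fix x :: "nat \<times> nat \<Rightarrow> real"
    define x0 where "x0 = merge ?J ?K (x, \<lambda>_. 0)"
    define c where "c a = ?s * w x0 (fst a) / sqrt (real n)" for a :: "nat \<times> nat"
    have V0: "V (merge ?J ?K (x, y)) = V x0" for y
      unfolding V_def x0_def by (rule sum.cong) (auto simp: w_merge [of _ x y "\<lambda>_. 0"])
    have Vc: "V x0 = (\<Sum>a\<in>?K. (c a)\<^sup>2)"
      by (simp add: V_def c_def sum_Times_singleton)
    have fy: "f (?D (merge ?J ?K (x, y))) = ennreal ((max 0 (\<bar>\<Sum>a\<in>?K. c a * y a\<bar> - L * sqrt (V x0)))\<^sup>2)" for y
    proof -
      have "(\<Sum>a\<in>?K. ?s * w (merge ?J ?K (x, y)) (fst a) / sqrt (real n) * merge ?J ?K (x, y) a) = (\<Sum>a\<in>?K. c a * y a)"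
      proof (rule sum.cong [OF refl])
        fix a assume a: "a \<in> ?K"
        then have "merge ?J ?K (x, y) a = y a" by (auto simp: merge_def)
        moreover have "w (merge ?J ?K (x, y)) (fst a) = w x0 (fst a)"
          unfolding x0_def by (rule w_merge) (use a in auto)
        ultimately show "?s * w (merge ?J ?K (x, y)) (fst a) / sqrt (real n) * merge ?J ?K (x, y) a = c a * y a"
          by (simp add: c_def)
      qed
      then show ?thesis by (simp add: f_def cor thr V0)
    qed
    show "(\<integral>\<^sup>+y. f (?D (merge ?J ?K (x, y))) \<partial>gauss ?K)
        \<le> (\<integral>\<^sup>+y. ennreal (exp (- (L\<^sup>2) / 2)) * ennreal (V (merge ?J ?K (x, y))) \<partial>gauss ?K)"
    proof (cases "0 < V x0")
      case True
      have "(\<integral>\<^sup>+y. f (?D (merge ?J ?K (x, y))) \<partial>gauss ?K)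
          = (\<integral>\<^sup>+t. ennreal ((max 0 (\<bar>t\<bar> - L * sqrt (V x0)))\<^sup>2) \<partial>normal_distribution 0 (V x0))"
        unfolding fy Vc by (rule nn_integral_gauss_linear) (use JK(3) True Vc in auto)
      also have "\<dots> \<le> ennreal (V x0 * exp (- (L\<^sup>2) / 2))" by (rule normal_excess_bound [OF True L])
      finally show ?thesis
        using True by (simp add: V0 prob_space.emeasure_space_1 [OF prob_space_gauss] ennreal_mult mult.commute)
    next
      case False
      then have "(\<Sum>a\<in>?K. (c a)\<^sup>2) = 0" using Vc by (simp add: sum_nonneg order_antisym)
      then have "c a = 0" if "a \<in> ?K" for a using that JK(3) by (auto simp: sum_nonneg_eq_0_iff)
      then have "(\<Sum>a\<in>?K. c a * y a) = 0" for y by (intro sum.neutral) auto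
      moreover have "V x0 = 0" using False by (simp add: Vc sum_nonneg order_antisym)
      ultimately show ?thesis by (simp add: fy)
    qed
  qed
  also have "\<dots> = (\<integral>\<^sup>+\<omega>. ennreal (exp (- (L\<^sup>2) / 2)) * ennreal (V \<omega>) \<partial>gauss ?G)"
    using nn_integral_gauss_fold [OF JK(1-3), of "\<lambda>\<omega>. ennreal (exp (- (L\<^sup>2) / 2)) * ennreal (V \<omega>)", symmetric] Vm
    unfolding JK(4) by simp
  also have "\<dots> = (\<integral>\<^sup>+\<omega>. ennreal (exp (- (L\<^sup>2) / 2) * (?s\<^sup>2 / real n)) * ennreal (\<Sum>i\<in>I. (residual p b (?D \<omega> i))\<^sup>2) \<partial>gauss ?G)"
    by (rule nn_integral_cong) (simp add: V_eq ennreal_mult [symmetric] sum_nonneg)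
  also have "\<dots> = (\<integral>\<^sup>+d. ennreal (exp (- (L\<^sup>2) / 2) * (?s\<^sup>2 / real n)) * ennreal (\<Sum>i\<in>I. (residual p b (d i))\<^sup>2) \<partial>data_law n p \<sigma> \<beta>)"
    using I by (intro nn_integral_data_law [OF n p, symmetric] borel_measurable_times_ennreal
        measurable_compose [OF _ measurable_ennreal] borel_measurable_const borel_measurable_sum
        borel_measurable_power measurable_data_residual) auto
  also have "\<dots> = ennreal (exp (- (L\<^sup>2) / 2) * (?s\<^sup>2 / real n)) * ennreal (real (card I) * ?v)"
    unfolding nn_integral_data_residual_square [OF n p \<sigma> I(1), symmetric]
    using I measurable_data_residual by (intro nn_integral_cmult measurable_compose [OF _ measurable_ennreal]
        borel_measurable_sum borel_measurable_power) (auto cong: measurable_cong_sets)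
  also have "\<dots> = ennreal (exp (- (L\<^sup>2) / 2) * (?s\<^sup>2 / real n) * (real (card I) * ?v))"
    using noise_level_pos [OF \<sigma>, of n p \<beta> b] by (intro ennreal_mult [symmetric]) auto
  also have "exp (- (L\<^sup>2) / 2) * (?s\<^sup>2 / real n) * (real (card I) * ?v) = exp (- (L\<^sup>2) / 2) * (?s * ?v)"
    using n card_I_pos by (simp add: power2_eq_square)
  finally show ?thesis unfolding f_def .
qed

text \<open>Outside both supports only the excess over the threshold contributes. Where just the
  pilot is nonzero, shrinking towards the true value 0 cannot increase the error. On the true
  support the error is at most the stochastic error plus the threshold, and only there does
  \<open>L\<^sup>2\<close> appear.\<close>

lemma second_stage_risk:
  assumes p: "0 < p" and a: "0 < a"
    and sparse: "card {j \<in> {..<p}. \<beta> j \<noteq> 0} \<le> k" "card {j \<in> {..<p}. b j \<noteq> 0} \<le> k"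
  shows "(\<integral>\<^sup>+d. ennreal (\<Sum>j<p. (second_stage n p I L b d j - \<beta> j)\<^sup>2) \<partial>data_law n p \<sigma> \<beta>)
    \<le> ennreal ((real k * ((1 + a) * L\<^sup>2 + 6 * (1 + 1 / a)) + real p * exp (- (L\<^sup>2) / 2))
        * (real n / real (card I) * noise_level n p \<sigma> \<beta> b))"
proof -
  let ?D = "data_law n p \<sigma> \<beta>"
  define W where "W = real n / real (card I) * noise_level n p \<sigma> \<beta> b"
  have W: "0 < W" unfolding W_def using n card_I_pos noise_level_pos [OF \<sigma>, of n p \<beta> b] by simp
  define e where "e = exp (- (L\<^sup>2) / 2)"
  define A where "A = (1 + a) * L\<^sup>2 + 3 * (1 + 1 / a)"
  define B where "B j = e + (if b j \<noteq> 0 then 3 else 0) + (if \<beta> j \<noteq> 0 then A else 0)" for j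
  have pos: "0 \<le> e" "0 \<le> A" using a by (simp_all add: e_def A_def)
  have Bpos: "0 \<le> B j" for j using pos by (simp add: B_def)
  have mt: "threshold n p I L b \<in> borel_measurable ?D"
    using measurable_threshold [OF I(1)] by (simp cong: measurable_cong_sets)
  have coord: "(\<integral>\<^sup>+d. ennreal ((second_stage n p I L b d j - \<beta> j)\<^sup>2) \<partial>?D) \<le> ennreal (B j * W)" if j: "j < p" for j
  proof -
    have mc [measurable]: "(\<lambda>d. corrected n p I b d j) \<in> borel_measurable ?D"
      using measurable_corrected [OF I(1) j] by (simp cong: measurable_cong_sets)
    note mt [measurable]
    let ?u = "\<lambda>d. corrected n p I b d j" and ?l = "\<lambda>d. threshold n p I L b d"
    consider "\<beta> j = 0" "b j = 0" | "\<beta> j = 0" "b j \<noteq> 0" | "\<beta> j \<noteq> 0" by blast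
    then show ?thesis
    proof cases
      case 1
      have eq: "(second_stage n p I L b d j - \<beta> j)\<^sup>2 = (max 0 (\<bar>?u d - b j\<bar> - ?l d))\<^sup>2" for d
        using abs_soft_threshold [OF threshold_nonneg, of d "?u d"] 1
        by (simp add: second_stage_def) (metis power2_abs)
      have "(\<integral>\<^sup>+d. ennreal ((second_stage n p I L b d j - \<beta> j)\<^sup>2) \<partial>?D) \<le> ennreal (e * W)"
        unfolding eq e_def W_def by (rule nn_integral_null_excess [OF j]) (use 1 in simp)
      then show ?thesis using 1 by (simp add: B_def)
    next
      case 2
      have le: "(second_stage n p I L b d j - \<beta> j)\<^sup>2 \<le> (?u d - \<beta> j)\<^sup>2" for d
      proof -
        have "\<bar>second_stage n p I L b d j\<bar> \<le> \<bar>?u d\<bar>"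
          using abs_soft_threshold [OF threshold_nonneg, of d "?u d"] threshold_nonneg [of d]
          by (simp add: second_stage_def)
        then show ?thesis using 2 by (simp add: abs_le_square_iff)
      qed
      have "(\<integral>\<^sup>+d. ennreal ((second_stage n p I L b d j - \<beta> j)\<^sup>2) \<partial>?D) \<le> (\<integral>\<^sup>+d. ennreal ((?u d - \<beta> j)\<^sup>2) \<partial>?D)"
        by (intro nn_integral_mono ennreal_leI le)
      also have "\<dots> \<le> ennreal (3 * W)" unfolding W_def by (rule nn_integral_corrected_error [OF j])
      also have "\<dots> \<le> ennreal (B j * W)"
        using 2 W pos by (intro ennreal_leI mult_right_mono) (auto simp: B_def)
      finally show ?thesis .
    next
      case 3
      have le: "(second_stage n p I L b d j - \<beta> j)\<^sup>2 \<le> (1 + 1 / a) * (?u d - \<beta> j)\<^sup>2 + (1 + a) * (?l d)\<^sup>2" for d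
      proof -
        define x where "x = \<bar>?u d - \<beta> j\<bar>"
        have "\<bar>second_stage n p I L b d j - \<beta> j\<bar> \<le> x + ?l d"
          using soft_threshold_diff [OF threshold_nonneg, of d "?u d"] unfolding second_stage_def x_def by linarith
        then have "(second_stage n p I L b d j - \<beta> j)\<^sup>2 \<le> (x + ?l d)\<^sup>2"
          by (metis abs_ge_zero power2_abs power_mono)
        also have "\<dots> \<le> (1 + 1 / a) * x\<^sup>2 + (1 + a) * (?l d)\<^sup>2"
        proof -
          \<comment> \<open>The cross term \<open>2 * x * ?l d\<close> is split with weight
            \<open>a\<close>, so that the squared threshold keeps a factor \<open>1 + a\<close>
            close to 1 and only the lower order error pays \<open>1 + 1 / a\<close>.\<close>
          have "0 \<le> (x / sqrt a - sqrt a * ?l d)\<^sup>2" by simp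
          also have "\<dots> = x\<^sup>2 / a + a * (?l d)\<^sup>2 - 2 * x * ?l d"
            using a by (simp add: power2_diff power_divide power_mult_distrib)
          finally show ?thesis by (simp add: power2_sum algebra_simps)
        qed
        finally show ?thesis by (simp add: x_def)
      qed
      have "(\<integral>\<^sup>+d. ennreal ((second_stage n p I L b d j - \<beta> j)\<^sup>2) \<partial>?D)
          \<le> (\<integral>\<^sup>+d. ennreal (1 + 1 / a) * ennreal ((?u d - \<beta> j)\<^sup>2) + ennreal (1 + a) * ennreal ((?l d)\<^sup>2) \<partial>?D)"
        using a le by (intro nn_integral_mono order_trans [OF ennreal_leI [OF le]])
          (simp add: ennreal_plus [symmetric] ennreal_mult [symmetric] del: ennreal_plus)
      also have "\<dots> = ennreal (1 + 1 / a) * (\<integral>\<^sup>+d. ennreal ((?u d - \<beta> j)\<^sup>2) \<partial>?D)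
          + ennreal (1 + a) * (\<integral>\<^sup>+d. ennreal ((?l d)\<^sup>2) \<partial>?D)"
        by (subst nn_integral_add) (simp_all add: nn_integral_cmult)
      also have "\<dots> \<le> ennreal (1 + 1 / a) * ennreal (3 * W) + ennreal (1 + a) * ennreal (L\<^sup>2 * W)"
        unfolding W_def nn_integral_threshold_square [OF p]
        by (intro add_mono mult_left_mono nn_integral_corrected_error [OF j]) auto
      also have "\<dots> = ennreal (A * W)"
        using a W by (simp add: ennreal_plus [symmetric] ennreal_mult [symmetric] A_def algebra_simps del: ennreal_plus)
      also have "\<dots> \<le> ennreal (B j * W)"
        using 3 W pos by (intro ennreal_leI mult_right_mono) (auto simp: B_def)
      finally show ?thesis .
    qed
  qed
  have ms: "(\<lambda>d. ennreal ((second_stage n p I L b d j - \<beta> j)\<^sup>2)) \<in> borel_measurable ?D" if "j < p" for j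
    using measurable_second_stage [OF I(1) that] by (auto cong: measurable_cong_sets)
  have "(\<integral>\<^sup>+d. ennreal (\<Sum>j<p. (second_stage n p I L b d j - \<beta> j)\<^sup>2) \<partial>?D)
      = (\<Sum>j<p. \<integral>\<^sup>+d. ennreal ((second_stage n p I L b d j - \<beta> j)\<^sup>2) \<partial>?D)"
    using ms by (subst nn_integral_sum [symmetric]) (auto simp: sum_ennreal)
  also have "\<dots> \<le> (\<Sum>j<p. ennreal (B j * W))" by (intro sum_mono coord) simp
  also have "\<dots> = ennreal ((\<Sum>j<p. B j) * W)"
    using Bpos W by (simp add: sum_distrib_right)
  also have "(\<Sum>j<p. B j) = real p * e + real (card {j \<in> {..<p}. b j \<noteq> 0}) * 3 + real (card {j \<in> {..<p}. \<beta> j \<noteq> 0}) * A"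
    by (simp add: B_def sum.distrib sum.If_cases Int_def)
  also have "ennreal (\<dots> * W) \<le> ennreal ((real k * ((1 + a) * L\<^sup>2 + 6 * (1 + 1 / a)) + real p * e) * W)"
  proof (intro ennreal_leI mult_right_mono)
    have "real (card {j \<in> {..<p}. b j \<noteq> 0}) * 3 \<le> real k * (3 * (1 + 1 / a))"
      using sparse(2) a by (intro mult_mono) auto
    moreover have "real (card {j \<in> {..<p}. \<beta> j \<noteq> 0}) * A \<le> real k * A"
      using sparse(1) pos by (intro mult_right_mono) auto
    moreover have "real k * ((1 + a) * L\<^sup>2 + 6 * (1 + 1 / a)) = real k * A + real k * (3 * (1 + 1 / a))"
      by (simp add: A_def algebra_simps)
    ultimately show "real p * e + real (card {j \<in> {..<p}. b j \<noteq> 0}) * 3 + real (card {j \<in> {..<p}. \<beta> j \<noteq> 0}) * A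
        \<le> real k * ((1 + a) * L\<^sup>2 + 6 * (1 + 1 / a)) + real p * e"
      by linarith
  qed (use W in simp)
  finally show ?thesis unfolding e_def W_def .
qed

end

section \<open>A pilot estimate by least squares on a finite lattice\<close>

lemma nn_integral_data_law_indep:
  fixes f g :: "(nat \<Rightarrow> real \<times> (nat \<Rightarrow> real)) \<Rightarrow> ennreal"
  assumes n: "0 < n" and p: "0 < p" and IJ: "I \<inter> J = {}" "I \<union> J = {..<n}"
    and f: "f \<in> borel_measurable (data_space n p)" and g: "g \<in> borel_measurable (data_space n p)"
    and fI: "\<And>d d'. (\<And>i. i \<in> I \<Longrightarrow> d i = d' i) \<Longrightarrow> f d = f d'"
    and gJ: "\<And>d d'. (\<And>i. i \<in> J \<Longrightarrow> d i = d' i) \<Longrightarrow> g d = g d'"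
  shows "(\<integral>\<^sup>+d. f d * g d \<partial>data_law n p \<sigma> \<beta>)
    = (\<integral>\<^sup>+d. f d \<partial>data_law n p \<sigma> \<beta>) * (\<integral>\<^sup>+d. g d \<partial>data_law n p \<sigma> \<beta>)"
proof -
  let ?M = "\<lambda>_::nat. obs_law n p \<sigma> \<beta>"
  have fin: "finite I" "finite J" using IJ(2) by (metis finite_Un finite_lessThan)+
  have D: "data_law n p \<sigma> \<beta> = PiM (I \<union> J) ?M" by (simp add: data_law_def IJ)
  have P: "prob_space (PiM A ?M)" for A by (rule prob_space_PiM) (rule prob_space_obs_law [OF n p])
  have sets: "sets (PiM (I \<union> J) ?M) = sets (data_space n p)" by (simp flip: D)
  have fm: "f \<in> borel_measurable (PiM (I \<union> J) ?M)" and gm: "g \<in> borel_measurable (PiM (I \<union> J) ?M)"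
    using f g by (simp_all add: measurable_cong_sets [OF sets refl])
  \<comment> \<open>Arbitrary points fill the coordinates on which \<open>f\<close> and
    \<open>g\<close> do not depend, which makes both into functions on the factors.\<close>
  obtain x0 where x0: "x0 \<in> space (PiM I ?M)" using prob_space.not_empty [OF P] by blast
  obtain y0 where y0: "y0 \<in> space (PiM J ?M)" using prob_space.not_empty [OF P] by blast
  have mX: "(\<lambda>x. merge I J (x, y0)) \<in> PiM I ?M \<rightarrow>\<^sub>M PiM (I \<union> J) ?M"
    using y0 by (intro measurable_compose [OF _ measurable_merge]) measurable
  have mY: "(\<lambda>y. merge I J (x0, y)) \<in> PiM J ?M \<rightarrow>\<^sub>M PiM (I \<union> J) ?M"
    using x0 by (intro measurable_compose [OF _ measurable_merge]) measurable
  define F where "F x = f (merge I J (x, y0))" for x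
  define G where "G y = g (merge I J (x0, y))" for y
  have Fm: "F \<in> borel_measurable (PiM I ?M)" unfolding F_def by (rule measurable_compose [OF mX fm])
  have Gm: "G \<in> borel_measurable (PiM J ?M)" unfolding G_def by (rule measurable_compose [OF mY gm])
  have fF: "f (merge I J (x, y)) = F x" for x y unfolding F_def by (rule fI) (simp add: merge_def)
  have gG: "g (merge I J (x, y)) = G y" for x y unfolding G_def by (rule gJ) (use IJ in \<open>auto simp: merge_def\<close>)
  note fold = product_sigma_finite.product_nn_integral_fold
    [OF product_sigma_finite_prob [OF prob_space_obs_law [OF n p]] IJ(1) fin]
  have one: "emeasure (PiM A ?M) (space (PiM A ?M)) = 1" for A by (rule prob_space.emeasure_space_1 [OF P])
  have "(\<integral>\<^sup>+d. f d \<partial>data_law n p \<sigma> \<beta>) = (\<integral>\<^sup>+x. F x \<partial>PiM I ?M)"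
    unfolding D by (subst fold [OF fm]) (simp add: fF one)
  moreover have "(\<integral>\<^sup>+d. g d \<partial>data_law n p \<sigma> \<beta>) = (\<integral>\<^sup>+y. G y \<partial>PiM J ?M)"
    unfolding D by (subst fold [OF gm]) (simp add: gG one)
  moreover have "(\<integral>\<^sup>+d. f d * g d \<partial>data_law n p \<sigma> \<beta>) = (\<integral>\<^sup>+x. F x * (\<integral>\<^sup>+y. G y \<partial>PiM J ?M) \<partial>PiM I ?M)"
    unfolding D by (subst fold [OF borel_measurable_times_ennreal [OF fm gm]])
      (simp add: fF gG nn_integral_cmult [OF Gm])
  ultimately show ?thesis by (simp add: nn_integral_multc [OF Fm])
qed

text \<open>Two residuals of one observation are correlated. Cauchy-Schwarz separates them without
  any knowledge of the joint law, at the price of doubling \<open>t\<close>; this is the origin of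
  \<open>4 * t\<close> and of the iterated square root.\<close>

lemma nn_integral_exp_difference:
  assumes M: "prob_space M"
    and A [measurable]: "A \<in> borel_measurable M" and B [measurable]: "B \<in> borel_measurable M"
    and lawA: "distr M borel A = normal_distribution 0 u" and lawB: "distr M borel B = normal_distribution 0 v"
    and pos: "0 < u" "0 < v" "0 < t" "4 * t * v < 1"
  shows "(\<integral>\<^sup>+y. ennreal (exp (t * ((B y)\<^sup>2 - (A y)\<^sup>2))) \<partial>M)
    \<le> ennreal (1 / sqrt (sqrt ((1 - 4 * t * v) * (1 + 4 * t * u))))"
proof -
  define x where "x = 1 / sqrt (1 - 4 * t * v)"
  define y where "y = 1 / sqrt (1 + 4 * t * u)"
  have "0 < t * u" using pos by simp
  then have "0 < 1 + 4 * t * u" by (simp add: mult.assoc)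
  then have x: "0 < x" and y: "0 < y" using pos(4) by (simp_all add: x_def y_def)
  \<comment> \<open>The weight for which the arithmetic-geometric mean inequality reproduces
    Cauchy-Schwarz, as both terms then have mean \<open>sqrt (x * y) / 2\<close>.\<close>
  define \<alpha> where "\<alpha> = sqrt (y / x)"
  have \<alpha>: "0 < \<alpha>" using x y by (simp add: \<alpha>_def)
  have eB: "(\<integral>\<^sup>+y. ennreal (exp (2 * t * (B y)\<^sup>2)) \<partial>M) = ennreal x"
    using nn_integral_exp_square_rv [OF B lawB, of "2 * t"] pos by (simp add: x_def mult_ac)
  have eA: "(\<integral>\<^sup>+y. ennreal (exp (- 2 * t * (A y)\<^sup>2)) \<partial>M) = ennreal y"
  proof -
    have "2 * (- 2 * t) * u < 1" using \<open>0 < 1 + 4 * t * u\<close> by simp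
    then show ?thesis
      using nn_integral_exp_square_rv [OF A lawA, of "- 2 * t"] pos by (simp add: y_def mult_ac)
  qed
  have le: "exp (t * ((B z)\<^sup>2 - (A z)\<^sup>2)) \<le> \<alpha> / 2 * exp (2 * t * (B z)\<^sup>2) + 1 / (2 * \<alpha>) * exp (- 2 * t * (A z)\<^sup>2)" for z
  proof -
    define P where "P = exp (t * (B z)\<^sup>2)"
    define Q where "Q = exp (- t * (A z)\<^sup>2)"
    have sq: "exp (2 * t * (B z)\<^sup>2) = P\<^sup>2" "exp (- 2 * t * (A z)\<^sup>2) = Q\<^sup>2"
      by (simp_all add: P_def Q_def exp_double [symmetric] mult_ac)
    have pr: "exp (t * ((B z)\<^sup>2 - (A z)\<^sup>2)) = P * Q"
      by (simp add: P_def Q_def exp_add [symmetric] algebra_simps)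
    have "0 \<le> (sqrt \<alpha> * P - Q / sqrt \<alpha>)\<^sup>2" by simp
    also have "\<dots> = \<alpha> * P\<^sup>2 + Q\<^sup>2 / \<alpha> - 2 * (P * Q)"
      using \<alpha> by (simp add: power2_diff power_mult_distrib power_divide)
    finally show ?thesis unfolding sq pr by simp
  qed
  have "(\<integral>\<^sup>+z. ennreal (exp (t * ((B z)\<^sup>2 - (A z)\<^sup>2))) \<partial>M)
      \<le> (\<integral>\<^sup>+z. ennreal (\<alpha> / 2) * ennreal (exp (2 * t * (B z)\<^sup>2)) + ennreal (1 / (2 * \<alpha>)) * ennreal (exp (- 2 * t * (A z)\<^sup>2)) \<partial>M)"
    using \<alpha> by (intro nn_integral_mono order_trans [OF ennreal_leI [OF le]])
      (simp add: ennreal_plus [symmetric] ennreal_mult [symmetric] del: ennreal_plus)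
  also have "\<dots> = ennreal (\<alpha> / 2) * ennreal x + ennreal (1 / (2 * \<alpha>)) * ennreal y"
  proof -
    have m: "(\<lambda>z. ennreal (exp (2 * t * (B z)\<^sup>2))) \<in> borel_measurable M"
        "(\<lambda>z. ennreal (exp (- 2 * t * (A z)\<^sup>2))) \<in> borel_measurable M"
      by measurable
    show ?thesis
      by (simp only: nn_integral_add nn_integral_cmult borel_measurable_times_ennreal
          borel_measurable_const m eA eB)
  qed
  also have "\<dots> = ennreal (\<alpha> / 2 * x + 1 / (2 * \<alpha>) * y)"
  proof -
    have "0 \<le> \<alpha> / 2" "0 \<le> 1 / (2 * \<alpha>)" "0 \<le> x" "0 \<le> y" using \<alpha> x y by simp_all
    then show ?thesis by (simp only: ennreal_mult ennreal_plus mult_nonneg_nonneg)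
  qed
  also have "\<alpha> / 2 * x + 1 / (2 * \<alpha>) * y = sqrt (x * y)"
  proof -
    define a where "a = sqrt x"
    define b where "b = sqrt y"
    have "0 < a" "0 < b" "x = a * a" "y = b * b" using x y by (simp_all add: a_def b_def)
    moreover have "\<alpha> = b / a" using x y by (simp add: \<alpha>_def a_def b_def real_sqrt_divide)
    ultimately show ?thesis by (simp add: real_sqrt_mult)
  qed
  also have "sqrt (x * y) = 1 / sqrt (sqrt ((1 - 4 * t * v) * (1 + 4 * t * u)))"
    by (simp add: x_def y_def real_sqrt_divide real_sqrt_mult)
  finally show ?thesis .
qed

definition rss :: "nat \<Rightarrow> nat set \<Rightarrow> (nat \<Rightarrow> real) \<Rightarrow> (nat \<Rightarrow> real \<times> (nat \<Rightarrow> real)) \<Rightarrow> real" where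
  "rss p I b d = (\<Sum>i\<in>I. (residual p b (d i))\<^sup>2)"

lemma measurable_rss:
  "I \<subseteq> {..<n} \<Longrightarrow> rss p I b \<in> borel_measurable (data_space n p)"
  unfolding rss_def [abs_def]
  by (intro borel_measurable_sum borel_measurable_power measurable_data_residual) auto

text \<open>Markov for the exponential of \<open>t\<close> times the difference of the two sums.
  Each observation contributes only a fourth root of \<open>1 / \<rho>\<close>, which is why they
  are counted in fours.\<close>

lemma rss_comparison_prob:
  assumes n: "0 < n" and p: "0 < p" and \<sigma>: "0 < \<sigma>" and I: "I \<subseteq> {..<n}" "card I = 4 * m"
    and t: "0 < t" "4 * t * noise_level n p \<sigma> \<beta> b' < 1"
    and \<rho>: "0 < \<rho>" "\<rho> \<le> (1 - 4 * t * noise_level n p \<sigma> \<beta> b') * (1 + 4 * t * noise_level n p \<sigma> \<beta> b)"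
  shows "emeasure (data_law n p \<sigma> \<beta>) {d \<in> space (data_law n p \<sigma> \<beta>). rss p I b d \<le> rss p I b' d}
    \<le> ennreal ((1 / \<rho>) ^ m)"
proof -
  let ?D = "data_law n p \<sigma> \<beta>" and ?L = "obs_law n p \<sigma> \<beta>"
  define h where "h r = ennreal (exp (t * ((residual p b' r)\<^sup>2 - (residual p b r)\<^sup>2)))" for r
  have finI: "finite I" using I finite_subset by blast
  have P: "prob_space ?L" by (rule prob_space_obs_law [OF n p])
  have hm [measurable]: "h \<in> borel_measurable ?L" unfolding h_def by measurable
  have row: "(\<integral>\<^sup>+r. h r \<partial>?L) \<le> ennreal (1 / sqrt (sqrt \<rho>))"
  proof -
    have "(\<integral>\<^sup>+r. h r \<partial>?L) \<le> ennreal (1 / sqrt (sqrt ((1 - 4 * t * noise_level n p \<sigma> \<beta> b') * (1 + 4 * t * noise_level n p \<sigma> \<beta> b))))"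
      unfolding h_def
      by (rule nn_integral_exp_difference [OF P _ _ distr_residual [OF n p \<sigma>] distr_residual [OF n p \<sigma>]])
        (use noise_level_pos [OF \<sigma>] t in auto)
    also have "\<dots> \<le> ennreal (1 / sqrt (sqrt \<rho>))"
      using \<rho> by (intro ennreal_leI divide_left_mono) auto
    finally show ?thesis .
  qed
  have [measurable]: "{d \<in> space ?D. rss p I b d \<le> rss p I b' d} \<in> sets ?D"
    using measurable_rss [OF I(1), of p b] measurable_rss [OF I(1), of p b']
    by (intro borel_measurable_le) (simp_all cong: measurable_cong_sets)
  have "emeasure ?D {d \<in> space ?D. rss p I b d \<le> rss p I b' d}
      = (\<integral>\<^sup>+d. indicator {d \<in> space ?D. rss p I b d \<le> rss p I b' d} d \<partial>?D)"
    by (rule nn_integral_indicator [symmetric]) measurable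
  also have "\<dots> \<le> (\<integral>\<^sup>+d. (\<Prod>i\<in>I. h (restrict d I i)) \<partial>?D)"
  proof (rule nn_integral_mono)
    fix d
    have eq: "(\<Prod>i\<in>I. h (restrict d I i)) = ennreal (exp (t * (rss p I b' d - rss p I b d)))"
      using finI by (simp add: h_def prod_ennreal exp_sum [symmetric] rss_def sum_subtractf sum_distrib_left right_diff_distrib)
    show "indicator {d \<in> space ?D. rss p I b d \<le> rss p I b' d} d \<le> (\<Prod>i\<in>I. h (restrict d I i))"
    proof (cases "rss p I b d \<le> rss p I b' d")
      case True
      then have "1 \<le> exp (t * (rss p I b' d - rss p I b d))" using t by simp
      then have "1 \<le> ennreal (exp (t * (rss p I b' d - rss p I b d)))"
        by (simp add: ennreal_1 [symmetric] ennreal_leI del: ennreal_1)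
      then show ?thesis unfolding eq by (auto split: split_indicator)
    qed simp
  qed
  also have "\<dots> = (\<integral>\<^sup>+d. (\<Prod>i\<in>I. h (d i)) \<partial>PiM I (\<lambda>_. ?L))"
    by (rule nn_integral_data_law_restrict [OF n p I(1)]) measurable
  also have "\<dots> = (\<integral>\<^sup>+r. h r \<partial>?L) ^ card I" by (rule nn_integral_PiM_prod [OF P finI hm])
  also have "\<dots> \<le> ennreal (1 / sqrt (sqrt \<rho>)) ^ card I" by (rule power_mono [OF row]) simp
  also have "\<dots> = ennreal ((1 / sqrt (sqrt \<rho>)) ^ (4 * m))" using \<rho> by (simp add: ennreal_power I(2))
  also have "(1 / sqrt (sqrt \<rho>)) ^ (4 * m) = (1 / \<rho>) ^ m"
  proof -
    have "(1 / sqrt (sqrt \<rho>)) ^ 4 = ((1 / sqrt (sqrt \<rho>))\<^sup>2)\<^sup>2" by (simp add: power_mult [symmetric])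
    also have "\<dots> = 1 / \<rho>" using \<rho> by (simp add: power_divide)
    finally show ?thesis by (simp add: power_mult)
  qed
  finally show ?thesis .
qed

text \<open>Ties are broken by an arbitrary enumeration, so that exactly one candidate is selected.\<close>

definition selected ::
  "nat \<Rightarrow> nat set \<Rightarrow> (nat \<Rightarrow> real) set \<Rightarrow> (nat \<Rightarrow> real) \<Rightarrow> (nat \<Rightarrow> real \<times> (nat \<Rightarrow> real)) \<Rightarrow> bool" where
  "selected p I S b d \<longleftrightarrow>
     (\<forall>c\<in>S. rss p I b d < rss p I c d \<or> rss p I b d = rss p I c d \<and> to_nat_on S b \<le> to_nat_on S c)"

lemma selected_unique:
  assumes S: "finite S" "S \<noteq> {}"
  shows "\<exists>!b. b \<in> S \<and> selected p I S b d"
proof -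
  let ?r = "\<lambda>b. rss p I b d"
  let ?T = "{b \<in> S. ?r b = Min (?r ` S)}"
  have "Min (?r ` S) \<in> ?r ` S" using S by (intro Min_in) auto
  then obtain b0 where "Min (?r ` S) = ?r b0" "b0 \<in> S" by (rule imageE)
  then have "b0 \<in> ?T" by simp
  then have "?T \<noteq> {}" by (metis empty_iff)
  moreover have "finite ?T" using S(1) by simp
  ultimately have T: "finite ?T" "?T \<noteq> {}" by simp_all
  have "Min (to_nat_on S ` ?T) \<in> to_nat_on S ` ?T" using T by (intro Min_in) auto
  then obtain b where b: "Min (to_nat_on S ` ?T) = to_nat_on S b" "b \<in> ?T" by (rule imageE)
  have "selected p I S b d"
    unfolding selected_def
  proof
    fix c assume c: "c \<in> S"
    then have "?r b \<le> ?r c" using b(2) S by simp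
    moreover have "to_nat_on S b \<le> to_nat_on S c" if "?r b = ?r c"
      unfolding b(1) [symmetric] using that b(2) c T by (intro Min_le) auto
    ultimately show "?r b < ?r c \<or> ?r b = ?r c \<and> to_nat_on S b \<le> to_nat_on S c" by auto
  qed
  moreover have "b1 = b2" if "b1 \<in> S \<and> selected p I S b1 d" "b2 \<in> S \<and> selected p I S b2 d" for b1 b2
  proof -
    have "to_nat_on S b1 = to_nat_on S b2" using that unfolding selected_def by (metis less_asym order_antisym less_irrefl)
    then show ?thesis using that S inj_on_to_nat_on [of S] by (auto simp: inj_on_def countable_finite)
  qed
  ultimately show ?thesis using b(2) by blast
qed

lemma sum_selected:
  fixes g :: "(nat \<Rightarrow> real) \<Rightarrow> 'a::comm_monoid_add"
  assumes "finite S" "b \<in> S" "selected p I S b d"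
  shows "(\<Sum>c\<in>S. if selected p I S c d then g c else 0) = g b"
proof -
  have "S \<noteq> {}" using assms(2) by auto
  then have "(if selected p I S c d then g c else 0) = (if c = b then g c else 0)" if "c \<in> S" for c
    using selected_unique [OF assms(1), of p I d] assms(2,3) that by auto
  then show ?thesis using assms by (simp cong: sum.cong)
qed

lemma selected_cong: "(\<And>i. i \<in> I \<Longrightarrow> d i = d' i) \<Longrightarrow> selected p I S b d = selected p I S b d'"
  by (simp add: selected_def rss_def cong: sum.cong)

lemma measurable_selected:
  assumes "I \<subseteq> {..<n}" "finite S"
  shows "Measurable.pred (data_space n p) (selected p I S b)"
proof -
  note [measurable] = measurable_rss [OF assms(1)]
  have eq: "selected p I S b d \<longleftrightarrow> (\<forall>c\<in>S. rss p I b d < rss p I c d \<or>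
      \<not> rss p I c d < rss p I b d \<and> to_nat_on S b \<le> to_nat_on S c)" for d
    unfolding selected_def by (intro ball_cong refl) (auto simp: not_less_iff_gr_or_eq)
  show ?thesis unfolding eq using assms(2) by measurable
qed

definition two_stage ::
  "nat \<Rightarrow> nat \<Rightarrow> nat set \<Rightarrow> nat set \<Rightarrow> (nat \<Rightarrow> real) set \<Rightarrow> real \<Rightarrow> (nat \<Rightarrow> real \<times> (nat \<Rightarrow> real)) \<Rightarrow> nat \<Rightarrow> real" where
  "two_stage n p I J S L d =
     (\<lambda>j\<in>{..<p}. \<Sum>b\<in>S. if selected p I S b d then second_stage n p J L b d j else 0)"

lemma two_stage_estimator:
  assumes "I \<subseteq> {..<n}" "J \<subseteq> {..<n}" "finite S"
  shows "two_stage n p I J S L \<in> estimators n p"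
proof -
  note measurable_selected [OF assms(1,3), measurable]
  have "(\<lambda>d. if selected p I S b d then second_stage n p J L b d j else 0) \<in> borel_measurable (data_space n p)"
    if "j < p" for b j
    using measurable_second_stage [OF assms(2) that] by measurable
  then show ?thesis
    unfolding estimators_def vec_space_def two_stage_def [abs_def]
    by (intro measurable_restrict borel_measurable_sum) auto
qed

text \<open>The two blocks of observations are independent, so the risk of the second stage is
  averaged over the law of the pilot estimate.\<close>

lemma two_stage_risk:
  assumes n: "0 < n" and p: "0 < p" and \<sigma>: "0 < \<sigma>" and IJ: "I \<inter> J = {}" "I \<union> J = {..<n}" "J \<noteq> {}"
    and S: "finite S" "S \<noteq> {}" and L: "0 \<le> L" and a: "0 < a"
    and sparse: "card {j \<in> {..<p}. \<beta> j \<noteq> 0} \<le> k" "\<And>b. b \<in> S \<Longrightarrow> card {j \<in> {..<p}. b j \<noteq> 0} \<le> k"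
    and \<gamma>: "0 \<le> \<gamma>" "\<And>b. b \<in> S \<Longrightarrow> noise_level n p \<sigma> \<beta> b \<le> \<sigma>\<^sup>2 * (1 + \<gamma>) + \<sigma>\<^sup>2 * g b"
    and g: "\<And>b. b \<in> S \<Longrightarrow> 0 \<le> g b" "\<And>b. b \<in> S \<Longrightarrow> 0 \<le> e b"
      "\<And>b. b \<in> S \<Longrightarrow> ennreal (g b) * emeasure (data_law n p \<sigma> \<beta>) {d \<in> space (data_law n p \<sigma> \<beta>). selected p I S b d} \<le> ennreal (e b)"
  shows "risk n p \<sigma> (two_stage n p I J S L) \<beta>
    \<le> ennreal ((real k * ((1 + a) * L\<^sup>2 + 6 * (1 + 1 / a)) + real p * exp (- (L\<^sup>2) / 2))
        * (real n / real (card J)) * \<sigma>\<^sup>2 * (1 + \<gamma> + (\<Sum>b\<in>S. e b)))"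
proof -
  let ?D = "data_law n p \<sigma> \<beta>"
  define Q where "Q = (real k * ((1 + a) * L\<^sup>2 + 6 * (1 + 1 / a)) + real p * exp (- (L\<^sup>2) / 2)) * (real n / real (card J))"
  have Q: "0 \<le> Q" unfolding Q_def using a by (intro mult_nonneg_nonneg add_nonneg_nonneg) auto
  have I: "I \<subseteq> {..<n}" and J: "J \<subseteq> {..<n}" using IJ by auto
  interpret D: prob_space ?D by (rule prob_space_data_law [OF n p])
  define loss where "loss b d = (\<Sum>j<p. (second_stage n p J L b d j - \<beta> j)\<^sup>2)" for b d
  define ind where "ind b d = (if selected p I S b d then 1 else 0 :: ennreal)" for b d
  define pr where "pr b = emeasure ?D {d \<in> space ?D. selected p I S b d}" for b
  have loss0: "0 \<le> loss b d" for b d by (simp add: loss_def sum_nonneg)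
  have sm [measurable]: "Measurable.pred (data_space n p) (selected p I S b)" for b
    by (rule measurable_selected [OF I S(1)])
  have im: "ind b \<in> borel_measurable (data_space n p)" for b unfolding ind_def by measurable
  have lm: "(\<lambda>d. ennreal (loss b d)) \<in> borel_measurable (data_space n p)" for b
    unfolding loss_def using measurable_second_stage [OF J]
    by (intro measurable_compose [OF _ measurable_ennreal] borel_measurable_sum borel_measurable_power
        borel_measurable_diff) auto
  have ind_pr: "(\<integral>\<^sup>+d. ind b d \<partial>?D) = pr b" for b
  proof -
    have s: "{d \<in> space ?D. selected p I S b d} \<in> sets ?D" by measurable
    have "(\<integral>\<^sup>+d. ind b d \<partial>?D) = (\<integral>\<^sup>+d. indicator {d \<in> space ?D. selected p I S b d} d \<partial>?D)"
      by (rule nn_integral_cong) (simp add: ind_def)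
    then show ?thesis using s by (simp add: pr_def)
  qed
  \<comment> \<open>The selection probabilities add up to 1, so the part \<open>1 + \<gamma>\<close>
    of the noise level common to all candidates is not multiplied by their number.\<close>
  have total: "(\<Sum>b\<in>S. pr b) = 1"
  proof -
    have "(\<Sum>b\<in>S. ind b d) = 1" for d
      using selected_unique [OF S, of p I d] sum_selected [OF S(1), of _ p I d "\<lambda>_. 1"]
      unfolding ind_def by blast
    then have "(\<integral>\<^sup>+d. (\<Sum>b\<in>S. ind b d) \<partial>?D) = 1" by (simp add: D.emeasure_space_1)
    moreover have "(\<integral>\<^sup>+d. (\<Sum>b\<in>S. ind b d) \<partial>?D) = (\<Sum>b\<in>S. pr b)"
      unfolding ind_pr [symmetric] using im by (intro nn_integral_sum) (simp cong: measurable_cong_sets)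
    ultimately show ?thesis by simp
  qed
  have "risk n p \<sigma> (two_stage n p I J S L) \<beta> = (\<integral>\<^sup>+d. (\<Sum>b\<in>S. ind b d * ennreal (loss b d)) \<partial>?D)"
    unfolding risk_def
  proof (rule nn_integral_cong)
    fix d
    obtain b where b: "b \<in> S" "selected p I S b d" using selected_unique [OF S, of p I d] by blast
    have "(\<Sum>b\<in>S. ind b d * ennreal (loss b d)) = (\<Sum>b\<in>S. if selected p I S b d then ennreal (loss b d) else 0)"
      by (rule sum.cong) (auto simp: ind_def)
    also have "\<dots> = ennreal (loss b d)" by (rule sum_selected [OF S(1) b])
    also have "loss b d = (l2_norm p (\<lambda>j. two_stage n p I J S L d j - \<beta> j))\<^sup>2"
      by (simp add: loss_def l2_norm_def L2_set_def sum_nonneg two_stage_def sum_selected [OF S(1) b])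
    finally show "ennreal ((l2_norm p (\<lambda>j. two_stage n p I J S L d j - \<beta> j))\<^sup>2) = (\<Sum>b\<in>S. ind b d * ennreal (loss b d))" ..
  qed
  also have "\<dots> = (\<Sum>b\<in>S. \<integral>\<^sup>+d. ind b d * ennreal (loss b d) \<partial>?D)"
    using im lm by (intro nn_integral_sum borel_measurable_times_ennreal) (simp_all cong: measurable_cong_sets)
  also have "\<dots> = (\<Sum>b\<in>S. pr b * (\<integral>\<^sup>+d. ennreal (loss b d) \<partial>?D))"
  proof (rule sum.cong [OF refl])
    fix b
    have "(\<integral>\<^sup>+d. ind b d * ennreal (loss b d) \<partial>?D) = (\<integral>\<^sup>+d. ind b d \<partial>?D) * (\<integral>\<^sup>+d. ennreal (loss b d) \<partial>?D)"
    proof (rule nn_integral_data_law_indep [OF n p IJ(1,2) im lm])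
      fix d d' :: "nat \<Rightarrow> real \<times> (nat \<Rightarrow> real)" assume "\<And>i. i \<in> I \<Longrightarrow> d i = d' i"
      then show "ind b d = ind b d'" unfolding ind_def by (simp cong: selected_cong)
    next
      fix d d' :: "nat \<Rightarrow> real \<times> (nat \<Rightarrow> real)" assume "\<And>i. i \<in> J \<Longrightarrow> d i = d' i"
      then show "ennreal (loss b d) = ennreal (loss b d')"
        by (simp add: loss_def second_stage_def threshold_def corrected_def cong: sum.cong)
    qed
    then show "(\<integral>\<^sup>+d. ind b d * ennreal (loss b d) \<partial>?D) = pr b * (\<integral>\<^sup>+d. ennreal (loss b d) \<partial>?D)"
      by (simp add: ind_pr)
  qed
  also have "\<dots> \<le> (\<Sum>b\<in>S. ennreal (Q * \<sigma>\<^sup>2) * (ennreal (1 + \<gamma>) * pr b + ennreal (e b)))"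
  proof (rule sum_mono)
    fix b assume b: "b \<in> S"
    have "(\<integral>\<^sup>+d. ennreal (loss b d) \<partial>?D) \<le> ennreal (Q * noise_level n p \<sigma> \<beta> b)"
      using second_stage_risk [OF n \<sigma> L J IJ(3) p a sparse(1) sparse(2) [OF b]]
      unfolding loss_def Q_def by (simp add: mult_ac)
    also have "\<dots> \<le> ennreal (Q * (\<sigma>\<^sup>2 * (1 + \<gamma>) + \<sigma>\<^sup>2 * g b))"
      using Q \<gamma>(2) [OF b] by (intro ennreal_leI mult_left_mono)
    also have "Q * (\<sigma>\<^sup>2 * (1 + \<gamma>) + \<sigma>\<^sup>2 * g b) = (Q * \<sigma>\<^sup>2) * (1 + \<gamma> + g b)"
      by (simp add: algebra_simps)
    also have "ennreal \<dots> = ennreal (Q * \<sigma>\<^sup>2) * (ennreal (1 + \<gamma>) + ennreal (g b))"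
    proof -
      have "0 \<le> Q * \<sigma>\<^sup>2" "0 \<le> 1 + \<gamma>" using Q \<gamma>(1) by simp_all
      then show ?thesis using g(1) [OF b] by (simp only: ennreal_mult ennreal_plus add_nonneg_nonneg)
    qed
    finally have "pr b * (\<integral>\<^sup>+d. ennreal (loss b d) \<partial>?D) \<le> pr b * (ennreal (Q * \<sigma>\<^sup>2) * (ennreal (1 + \<gamma>) + ennreal (g b)))"
      by (intro mult_left_mono) auto
    also have "\<dots> = ennreal (Q * \<sigma>\<^sup>2) * (ennreal (1 + \<gamma>) * pr b + ennreal (g b) * pr b)"
      by (simp only: distrib_left distrib_right mult_ac)
    also have "\<dots> \<le> ennreal (Q * \<sigma>\<^sup>2) * (ennreal (1 + \<gamma>) * pr b + ennreal (e b))"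
      using g(3) [OF b] unfolding pr_def by (intro mult_left_mono add_left_mono) auto
    finally show "pr b * (\<integral>\<^sup>+d. ennreal (loss b d) \<partial>?D) \<le> ennreal (Q * \<sigma>\<^sup>2) * (ennreal (1 + \<gamma>) * pr b + ennreal (e b))" .
  qed
  also have "\<dots> = ennreal (Q * \<sigma>\<^sup>2) * (ennreal (1 + \<gamma>) * (\<Sum>b\<in>S. pr b) + (\<Sum>b\<in>S. ennreal (e b)))"
    by (simp only: sum_distrib_left [symmetric] sum.distrib)
  also have "\<dots> = ennreal (Q * \<sigma>\<^sup>2 * (1 + \<gamma> + (\<Sum>b\<in>S. e b)))"
  proof -
    have e0: "0 \<le> (\<Sum>b\<in>S. e b)" using g(2) by (rule sum_nonneg)
    have "(\<Sum>b\<in>S. ennreal (e b)) = ennreal (\<Sum>b\<in>S. e b)" using g(2) by (rule sum_ennreal)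
    moreover have "0 \<le> Q * \<sigma>\<^sup>2" "0 \<le> 1 + \<gamma>" using Q \<gamma>(1) by simp_all
    ultimately show ?thesis using e0 by (simp only: total mult_1_right ennreal_mult ennreal_plus add_nonneg_nonneg)
  qed
  finally show ?thesis unfolding Q_def .
qed

section \<open>Summation over the lattice, uniformly in its width\<close>

lemma sum_inverse_square_nat: "(\<Sum>i<N. 1 / (1 + (real i)\<^sup>2)) \<le> 4 - 4 / (real N + 1)"
proof (induction N)
  case (Suc N)
  \<comment> \<open>This is \<open>4 * (1 + (real N)\<^sup>2)\<close> minus
    \<open>(real N + 1) * (real N + 2)\<close>. Its sign bounds the summand by
    \<open>4 / ((real N + 1) * (real N + 2))\<close>, which telescopes.\<close>
  have "0 \<le> 3 * (real N - 1 / 2)\<^sup>2 + 5 / 4" by simp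
  then have q: "(real N + 1) * (real N + 2) \<le> 4 * (1 + (real N)\<^sup>2)"
    by (simp add: power2_eq_square algebra_simps)
  have "1 / (1 + (real N)\<^sup>2) = 4 / (4 * (1 + (real N)\<^sup>2))"
    by (metis mult_divide_mult_cancel_left mult.right_neutral zero_neq_numeral)
  also have "\<dots> \<le> 4 / ((real N + 1) * (real N + 2))"
    using q by (intro divide_left_mono mult_pos_pos) (auto simp: add_pos_nonneg)
  also have "\<dots> = 4 / (real N + 1) - 4 / (real N + 2)" by (simp add: divide_simps)
  finally show ?case using Suc by (simp add: add.commute)
qed simp

lemma sum_inverse_square_int:
  fixes Z :: "int set"
  assumes "finite Z"
  shows "(\<Sum>z\<in>Z. 1 / (1 + (real_of_int z)\<^sup>2)) \<le> 8"
proof -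
  have half: "(\<Sum>z\<in>A. 1 / (1 + (real_of_int z)\<^sup>2)) \<le> 4"
    if A: "finite A" "inj_on (\<lambda>z. nat \<bar>z\<bar>) A" for A
  proof -
    define N where "N = Suc (Max ((\<lambda>z. nat \<bar>z\<bar>) ` A))"
    have "(\<Sum>z\<in>A. 1 / (1 + (real_of_int z)\<^sup>2)) = (\<Sum>i\<in>(\<lambda>z. nat \<bar>z\<bar>) ` A. 1 / (1 + (real i)\<^sup>2))"
      by (subst sum.reindex [OF A(2)]) simp
    also have "\<dots> \<le> (\<Sum>i<N. 1 / (1 + (real i)\<^sup>2))"
      using A(1) by (intro sum_mono2) (auto simp: N_def less_Suc_eq_le)
    also have "\<dots> \<le> 4" by (rule order_trans [OF sum_inverse_square_nat]) simp
    finally show ?thesis .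
  qed
  have "Z = {z\<in>Z. 0 \<le> z} \<union> {z\<in>Z. z < 0}" by auto
  then have "(\<Sum>z\<in>Z. 1 / (1 + (real_of_int z)\<^sup>2))
      = (\<Sum>z\<in>{z\<in>Z. 0 \<le> z}. 1 / (1 + (real_of_int z)\<^sup>2)) + (\<Sum>z\<in>{z\<in>Z. z < 0}. 1 / (1 + (real_of_int z)\<^sup>2))"
    using assms by (subst sum.union_disjoint [symmetric]) auto
  also have "\<dots> \<le> 4 + 4" using assms by (intro add_mono half) (auto simp: inj_on_def)
  finally show ?thesis by simp
qed

text \<open>Replacing \<open>u\<close> by its integer part costs a factor 3 and leaves the sum over
  the integers. The bound involves neither \<open>u\<close> nor \<open>Z\<close>; this is what frees
  the pilot from \<tau>, which determines the width of the lattice.\<close>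

lemma lattice_row_sum:
  fixes Z :: "int set"
  assumes Z: "finite Z" and c: "0 < c" "c \<le> 1"
  shows "(\<Sum>z\<in>Z. 1 / (1 + c * (u - real_of_int z)\<^sup>2)) \<le> 24 / c"
proof -
  define f where "f = \<lfloor>u\<rfloor>"
  have bound: "1 / (1 + c * (u - real_of_int z)\<^sup>2) \<le> 3 / c * (1 / (1 + (real_of_int (z - f))\<^sup>2))" for z
  proof -
    define x where "x = u - real_of_int z"
    define y where "y = real_of_int (z - f)"
    have "\<bar>y + x\<bar> \<le> 1" using floor_correct [of u] unfolding x_def y_def f_def by simp linarith
    then have "\<bar>y\<bar> \<le> \<bar>x\<bar> + 1" by linarith
    then have "y\<^sup>2 \<le> (\<bar>x\<bar> + 1)\<^sup>2" by (metis abs_ge_zero power2_abs power_mono)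
    also have "\<dots> \<le> 2 * x\<^sup>2 + 2"
      using zero_le_power2 [of "\<bar>x\<bar> - 1"] by (simp add: power2_eq_square algebra_simps)
    finally have "1 + y\<^sup>2 \<le> 3 * (1 + x\<^sup>2)" using zero_le_power2 [of x] unfolding distrib_left by linarith
    then have "c * (1 + y\<^sup>2) \<le> c * (3 * (1 + x\<^sup>2))" using c by (intro mult_left_mono) auto
    also have "\<dots> \<le> 3 * (1 + c * x\<^sup>2)" using c by (simp add: algebra_simps)
    finally have *: "c * (1 + y\<^sup>2) / 3 \<le> 1 + c * x\<^sup>2" by simp
    have "1 / (1 + c * x\<^sup>2) \<le> 1 / (c * (1 + y\<^sup>2) / 3)"
      using * c by (intro divide_left_mono mult_pos_pos) (auto simp: add_pos_nonneg)
    then show ?thesis unfolding x_def y_def by simp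
  qed
  have "(\<Sum>z\<in>Z. 1 / (1 + c * (u - real_of_int z)\<^sup>2)) \<le> (\<Sum>z\<in>Z. 3 / c * (1 / (1 + (real_of_int (z - f))\<^sup>2)))"
    by (intro sum_mono bound)
  also have "\<dots> = 3 / c * (\<Sum>z\<in>(\<lambda>z. z - f) ` Z. 1 / (1 + (real_of_int z)\<^sup>2))"
    by (subst sum.reindex) (auto simp: inj_on_def sum_distrib_left)
  also have "\<dots> \<le> 3 / c * 8"
    using c Z by (intro mult_left_mono sum_inverse_square_int) auto
  finally show ?thesis by simp
qed

definition lattice :: "nat \<Rightarrow> nat \<Rightarrow> real set \<Rightarrow> (nat \<Rightarrow> real) set" where
  "lattice p k V = {b \<in> {..<p} \<rightarrow>\<^sub>E V. card {j \<in> {..<p}. b j \<noteq> 0} \<le> k}"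

lemma finite_lattice: "finite V \<Longrightarrow> finite (lattice p k V)"
  unfolding lattice_def by (rule finite_subset [OF _ finite_PiE [of "{..<p}" "\<lambda>_. V"]]) auto

text \<open>The factor \<open>p ^ k\<close> pays for the choice of the support: it is at least \<open>p\<close> to the size of it,
  and the sum over all supports then factorizes.\<close>

lemma sum_lattice_weights:
  fixes h :: "nat \<Rightarrow> real \<Rightarrow> real"
  assumes p: "0 < p" and V: "finite V" and h: "\<And>j v. 0 \<le> h j v" and H: "\<And>j. j < p \<Longrightarrow> (\<Sum>v\<in>V. h j v) \<le> H"
  shows "(\<Sum>b\<in>lattice p k V. \<Prod>j\<in>{j \<in> {..<p}. b j \<noteq> 0}. h j (b j)) \<le> real p ^ k * exp H"
proof -
  define g where "g j v = (if v = 0 then 1 else h j v / real p)" for j v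
  have g0: "0 \<le> g j v" for j v using h by (simp add: g_def)
  have weight: "(\<Prod>j\<in>{j \<in> {..<p}. b j \<noteq> 0}. h j (b j)) \<le> real p ^ k * (\<Prod>j<p. g j (b j))"
    if b: "b \<in> lattice p k V" for b
  proof -
    let ?s = "{j \<in> {..<p}. b j \<noteq> 0}"
    have "(\<Prod>j<p. g j (b j)) = (\<Prod>j\<in>?s. g j (b j))"
      by (intro prod.mono_neutral_right) (auto simp: g_def)
    also have "\<dots> = (\<Prod>j\<in>?s. h j (b j)) / real p ^ card ?s"
      by (simp add: g_def prod_dividef)
    finally have "(\<Prod>j\<in>?s. h j (b j)) = real p ^ card ?s * (\<Prod>j<p. g j (b j))" using p by simp
    also have "\<dots> \<le> real p ^ k * (\<Prod>j<p. g j (b j))"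
      using b p g0 by (intro mult_right_mono power_increasing prod_nonneg) (auto simp: lattice_def)
    finally show ?thesis .
  qed
  have "(\<Sum>b\<in>lattice p k V. \<Prod>j\<in>{j \<in> {..<p}. b j \<noteq> 0}. h j (b j))
      \<le> (\<Sum>b\<in>lattice p k V. real p ^ k * (\<Prod>j<p. g j (b j)))"
    by (rule sum_mono) (rule weight)
  also have "\<dots> \<le> (\<Sum>b\<in>{..<p} \<rightarrow>\<^sub>E V. real p ^ k * (\<Prod>j<p. g j (b j)))"
    using V g0 by (intro sum_mono2 finite_PiE) (auto simp: lattice_def intro!: prod_nonneg mult_nonneg_nonneg)
  also have "\<dots> = real p ^ k * (\<Prod>j<p. \<Sum>v\<in>V. g j v)"
    using V by (subst prod_sum_PiE) (auto simp: sum_distrib_left)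
  also have "\<dots> \<le> real p ^ k * (\<Prod>j<p. 1 + H / real p)"
  proof (intro mult_left_mono prod_mono conjI)
    fix j assume "j \<in> {..<p}"
    then have Hj: "(\<Sum>v\<in>V. h j v) \<le> H" by (intro H) simp
    show "0 \<le> (\<Sum>v\<in>V. g j v)" by (intro sum_nonneg g0)
    have "(\<Sum>v\<in>V. g j v) \<le> (\<Sum>v\<in>V. (if v = 0 then 1 else 0) + h j v / real p)"
      using h by (intro sum_mono) (auto simp: g_def)
    also have "\<dots> = (\<Sum>v\<in>V. if v = 0 then 1 else 0) + (\<Sum>v\<in>V. h j v) / real p"
      by (simp add: sum.distrib sum_divide_distrib)
    also have "\<dots> \<le> 1 + H / real p"
      using Hj V by (intro add_mono divide_right_mono) auto
    finally show "(\<Sum>v\<in>V. g j v) \<le> 1 + H / real p" .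
  qed simp
  also have "\<dots> \<le> real p ^ k * exp H"
  proof (intro mult_left_mono)
    have "0 \<le> H" using H [OF p] sum_nonneg [of V "h 0"] h by (meson order_trans)
    then have "(1 + H / real p) ^ p \<le> exp (H / real p) ^ p"
      by (intro power_mono exp_ge_add_one_self) (auto intro: add_nonneg_nonneg)
    also have "\<dots> = exp H" using p by (simp add: exp_of_nat_mult [symmetric])
    finally show "(\<Prod>j<p. 1 + H / real p) \<le> exp H" by simp
  qed simp
  finally show ?thesis .
qed

text \<open>Here \<open>D\<close> is the squared error of a candidate in units of
  \<open>n * \<sigma>\<^sup>2\<close>, \<open>D'\<close> that of the rounded truth, and \<theta> is
  \<open>4 * t * \<sigma>\<^sup>2\<close> for the Chernoff parameter \<open>t\<close>. The product
  is \<open>1 + \<theta> * (D - D')\<close> minus a term with factor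
  \<open>\<theta> * \<theta>\<close>; for \<open>D\<close> at least \<open>12 * \<theta>\<close> all
  losses together stay below three quarters of \<open>\<theta> * D\<close>.\<close>

lemma pilot_rate:
  fixes \<theta> D D' :: real
  assumes "0 < \<theta>" "\<theta> \<le> 1 / 4" "12 * \<theta> \<le> D" "0 \<le> D'" "D' \<le> \<theta>"
  shows "1 + \<theta> * D / 4 \<le> (1 - \<theta> * (1 + D')) * (1 + \<theta> * (1 + D))" "\<theta> * (1 + D') < 1"
proof -
  have "\<theta> * (1 + D') \<le> \<theta> * (1 + \<theta>)" using assms by (intro mult_left_mono) auto
  moreover have \<theta>2: "\<theta> * \<theta> \<le> \<theta> / 4" using mult_left_mono [of \<theta> "1/4" \<theta>] assms by simp
  ultimately have le: "\<theta> * (1 + D') \<le> \<theta> + \<theta> * \<theta>" by (simp add: algebra_simps)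
  then show "\<theta> * (1 + D') < 1" using \<theta>2 assms by linarith
  have "1 + \<theta> * D / 4 \<le> (1 - (\<theta> + \<theta> * \<theta>)) * (1 + \<theta> * (1 + D))"
  proof -
    define q where "q = \<theta> * \<theta>"
    have q: "0 \<le> q" "q \<le> \<theta> / 4" using \<theta>2 assms by (simp_all add: q_def)
    have qD: "12 * q \<le> \<theta> * D" using mult_left_mono [OF assms(3), of \<theta>] assms by (simp add: q_def mult_ac)
    have tq: "\<theta> * q \<le> q / 4" using mult_right_mono [OF assms(2) q(1)] by simp
    define E where "E = \<theta> * D"
    have E0: "0 \<le> E" using qD q unfolding E_def by linarith
    have tE: "\<theta> * E \<le> E / 4" using mult_right_mono [OF assms(2) E0] by simp
    have qE: "q * E \<le> E / 16"
    proof -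
      have "q * E \<le> (1 / 16) * E" using q assms(2) E0 by (intro mult_right_mono) auto
      then show ?thesis by simp
    qed
    have "(1 - (\<theta> + \<theta> * \<theta>)) * (1 + \<theta> * (1 + D)) = 1 - 2 * q - \<theta> * q + E - \<theta> * E - q * E"
      by (simp add: q_def E_def algebra_simps)
    moreover have "2 * q + \<theta> * q + \<theta> * E + q * E \<le> 3 / 4 * E"
      using tq tE qE qD q unfolding E_def [symmetric] by linarith
    ultimately show ?thesis unfolding E_def by linarith
  qed
  also have "\<dots> \<le> (1 - \<theta> * (1 + D')) * (1 + \<theta> * (1 + D))"
    using le assms by (intro mult_right_mono) auto
  finally show "1 + \<theta> * D / 4 \<le> (1 - \<theta> * (1 + D')) * (1 + \<theta> * (1 + D))" .
qed

text \<open>In units of \<open>n * \<sigma>\<^sup>2\<close>: errors below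
  \<open>12 * \<theta>\<close> are tolerated, and the other term bounds the mean error from the
  remaining candidates. Its factor \<open>4 / \<theta>\<close> comes from one Chernoff factor, the
  power \<open>r\<close> from the decay, and the bracket from the sum over the lattice.\<close>

definition pilot_error :: "nat \<Rightarrow> nat \<Rightarrow> nat \<Rightarrow> real \<Rightarrow> real" where
  "pilot_error p k r \<theta>
     = 12 * \<theta> + 4 / \<theta> * (1 / (1 + 3 * \<theta>\<^sup>2)) ^ r * (real p ^ k * exp (96 * real k / \<theta>\<^sup>2))"

text \<open>The exponent \<open>m = r + 1 + k\<close> of \<open>1 / \<rho>\<close> is spent in three
  ways: one factor compensates the possibly huge error \<open>D b\<close> of a wrong candidate,
  \<open>k\<close> factors become weights that are summable over the lattice, and \<open>r\<close>
  factors are left for exponential decay.\<close>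

lemma minimax_risk_upper:
  assumes k: "1 \<le> k" "k \<le> p" and \<sigma>: "0 < \<sigma>" and \<theta>: "0 < \<theta>" "\<theta> \<le> 1 / 4"
    and m: "m = r + 1 + k" "4 * m < n" and L: "0 \<le> L" and a: "0 < a"
  shows "minimax_risk n p \<sigma> (sparse_params p k \<tau>)
    \<le> ennreal ((real k * ((1 + a) * L\<^sup>2 + 6 * (1 + 1 / a)) + real p * exp (- (L\<^sup>2) / 2))
        * (real n / real (n - 4 * m)) * \<sigma>\<^sup>2 * (1 + pilot_error p k r \<theta>))"
proof -
  have n: "0 < n" and p: "0 < p" using m k by auto
  let ?I = "{..<4 * m}" and ?J = "{4 * m..<n}"
  have IJ: "?I \<inter> ?J = {}" "?I \<union> ?J = {..<n}" "?J \<noteq> {}" and I: "?I \<subseteq> {..<n}" using m(2) by auto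
  have cJ: "card ?J = n - 4 * m" by simp
  \<comment> \<open>The mesh is chosen so that rounding \<open>k\<close> entries costs at most
    \<open>k * \<eta>\<^sup>2 = \<theta> * n * \<sigma>\<^sup>2\<close>.\<close>
  define \<eta> where "\<eta> = \<sigma> * sqrt (\<theta> * real n / real k)"
  have \<eta>: "0 < \<eta>" and \<eta>2: "\<eta>\<^sup>2 = \<sigma>\<^sup>2 * (\<theta> * real n / real k)"
    using \<sigma> \<theta> n k by (simp_all add: \<eta>_def power_mult_distrib)
  \<comment> \<open>The only place where \<tau> enters: the range has to contain the rounded truth.
    The added 1 covers rounding down of negative entries.\<close>
  define N where "N = \<lceil>sqrt (real k * \<tau>\<^sup>2) / \<eta>\<rceil> + 1"
  define V where "V = (\<lambda>z. \<eta> * real_of_int z) ` {- N..N}"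
  define S where "S = lattice p k V"
  have V: "finite V" by (simp add: V_def)
  have finS: "finite S" unfolding S_def by (rule finite_lattice [OF V])
  have "risk n p \<sigma> (two_stage n p ?I ?J S L) \<beta>
      \<le> ennreal ((real k * ((1 + a) * L\<^sup>2 + 6 * (1 + 1 / a)) + real p * exp (- (L\<^sup>2) / 2))
        * (real n / real (n - 4 * m)) * \<sigma>\<^sup>2 * (1 + pilot_error p k r \<theta>))"
    if \<beta>: "\<beta> \<in> sparse_params p k \<tau>" for \<beta>
  proof -
    have l0: "card {j \<in> {..<p}. \<beta> j \<noteq> 0} \<le> k"
      using \<beta> by (simp add: sparse_params_def l0_norm_def)
    have l2: "(\<Sum>j<p. (\<beta> j)\<^sup>2) \<le> real k * \<tau>\<^sup>2"
      using \<beta> by (simp add: sparse_params_def l2_norm_def L2_set_def sum_nonneg)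
    \<comment> \<open>Rounding down fixes 0, so the rounded truth is as sparse as \<beta> and
      belongs to the lattice.\<close>
    define b' where "b' = (\<lambda>j\<in>{..<p}. \<eta> * real_of_int \<lfloor>\<beta> j / \<eta>\<rfloor>)"
    have zero': "b' j = 0" if "\<beta> j = 0" "j < p" for j using that by (simp add: b'_def)
    have b'S: "b' \<in> S"
    proof -
      have "b' j \<in> V" if j: "j < p" for j
      proof -
        have "(\<beta> j)\<^sup>2 \<le> (\<Sum>j<p. (\<beta> j)\<^sup>2)" using j by (intro member_le_sum) auto
        then have "\<bar>\<beta> j\<bar> \<le> sqrt (real k * \<tau>\<^sup>2)" using l2 by (intro real_le_rsqrt) simp
        then have "\<bar>\<beta> j / \<eta>\<bar> \<le> sqrt (real k * \<tau>\<^sup>2) / \<eta>"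
          using \<eta> by (simp add: divide_right_mono)
        then have "\<lfloor>\<beta> j / \<eta>\<rfloor> \<in> {- N..N}" unfolding N_def by (simp, linarith)
        then show ?thesis using j unfolding b'_def V_def by (simp only: restrict_apply' lessThan_iff) (rule imageI)
      qed
      moreover have "card {j \<in> {..<p}. b' j \<noteq> 0} \<le> card {j \<in> {..<p}. \<beta> j \<noteq> 0}"
        using zero' by (intro card_mono) auto
      ultimately show ?thesis using l0 by (auto simp: S_def lattice_def PiE_iff b'_def)
    qed
    define D where "D b = (\<Sum>l<p. (\<beta> l - b l)\<^sup>2) / (real n * \<sigma>\<^sup>2)" for b
    have D0: "0 \<le> D b" for b by (simp add: D_def sum_nonneg)
    have noise: "noise_level n p \<sigma> \<beta> b = \<sigma>\<^sup>2 * (1 + D b)" for b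
      using \<sigma> n by (simp add: noise_level_def D_def distrib_left)
    have D': "D b' \<le> \<theta>"
    proof -
      have "(\<Sum>l<p. (\<beta> l - b' l)\<^sup>2) = (\<Sum>l\<in>{j \<in> {..<p}. \<beta> j \<noteq> 0}. (\<beta> l - b' l)\<^sup>2)"
        using zero' by (intro sum.mono_neutral_right) auto
      also have "\<dots> \<le> (\<Sum>l\<in>{j \<in> {..<p}. \<beta> j \<noteq> 0}. \<eta>\<^sup>2)"
      proof (rule sum_mono)
        fix l assume "l \<in> {j \<in> {..<p}. \<beta> j \<noteq> 0}"
        then have "\<beta> l - b' l = \<eta> * (\<beta> l / \<eta> - real_of_int \<lfloor>\<beta> l / \<eta>\<rfloor>)"
          using \<eta> by (simp add: b'_def right_diff_distrib)
        moreover have "\<bar>\<beta> l / \<eta> - real_of_int \<lfloor>\<beta> l / \<eta>\<rfloor>\<bar> \<le> 1" by linarith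
        ultimately have "\<bar>\<beta> l - b' l\<bar> \<le> \<eta>" using \<eta> by (simp add: abs_mult mult_left_le)
        then show "(\<beta> l - b' l)\<^sup>2 \<le> \<eta>\<^sup>2" by (simp add: abs_le_square_iff [symmetric])
      qed
      also have "\<dots> \<le> real k * \<eta>\<^sup>2" using l0 by (simp add: mult_right_mono)
      also have "\<dots> = \<theta> * (real n * \<sigma>\<^sup>2)" using k by (simp add: \<eta>2)
      finally show ?thesis unfolding D_def using n \<sigma> by (simp add: pos_divide_le_eq)
    qed
    define h where "h j v = 1 / (1 + \<theta> * (\<beta> j - v)\<^sup>2 / (4 * real n * \<sigma>\<^sup>2))" for j v
    have h0: "0 \<le> h j v" for j v using \<theta> by (simp add: h_def)
    define w where "w b = (\<Prod>j\<in>{j \<in> {..<p}. b j \<noteq> 0}. h j (b j))" for b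
    have w0: "0 \<le> w b" for b unfolding w_def by (intro prod_nonneg h0 ballI)
    \<comment> \<open>Errors below \<open>12 * \<theta>\<close> are charged to the common level, and
      only larger ones are weighted with a selection probability.\<close>
    define g where "g b = (if 12 * \<theta> \<le> D b then D b else 0)" for b
    define e where "e b = 4 / \<theta> * (1 / (1 + 3 * \<theta>\<^sup>2)) ^ r * w b" for b
    have e0: "0 \<le> e b" for b using \<theta> w0 by (simp add: e_def)
    have sel: "ennreal (g b) * emeasure (data_law n p \<sigma> \<beta>) {d \<in> space (data_law n p \<sigma> \<beta>). selected p ?I S b d} \<le> ennreal (e b)"
      if b: "b \<in> S" for b
    proof (cases "12 * \<theta> \<le> D b")
      case True
      define \<rho> where "\<rho> = 1 + \<theta> * D b / 4"
      have \<rho>1: "1 + 3 * \<theta>\<^sup>2 \<le> \<rho>"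
        using mult_left_mono [OF True, of \<theta>] \<theta> by (simp add: \<rho>_def power2_eq_square)
      have \<rho>0: "1 \<le> \<rho>" using \<rho>1 zero_le_power2 [of \<theta>] by linarith
      \<comment> \<open>Scaled so that \<open>4 * t\<close> times a noise level becomes
        \<open>\<theta> * (1 + D c)\<close>, the form treated in \<open>pilot_rate\<close>.\<close>
      define t where "t = \<theta> / (4 * \<sigma>\<^sup>2)"
      have t: "0 < t" "4 * t * noise_level n p \<sigma> \<beta> c = \<theta> * (1 + D c)" for c
        using \<theta> \<sigma> by (simp_all add: t_def noise)
      have "emeasure (data_law n p \<sigma> \<beta>) {d \<in> space (data_law n p \<sigma> \<beta>). selected p ?I S b d}
          \<le> emeasure (data_law n p \<sigma> \<beta>) {d \<in> space (data_law n p \<sigma> \<beta>). rss p ?I b d \<le> rss p ?I b' d}"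
      proof (rule emeasure_mono)
        show "{d \<in> space (data_law n p \<sigma> \<beta>). selected p ?I S b d} \<subseteq> {d \<in> space (data_law n p \<sigma> \<beta>). rss p ?I b d \<le> rss p ?I b' d}"
          using b'S by (auto simp: selected_def)
        show "{d \<in> space (data_law n p \<sigma> \<beta>). rss p ?I b d \<le> rss p ?I b' d} \<in> sets (data_law n p \<sigma> \<beta>)"
          using measurable_rss [OF I, of p b] measurable_rss [OF I, of p b']
          by (intro borel_measurable_le) (simp_all cong: measurable_cong_sets)
      qed
      also have "\<dots> \<le> ennreal ((1 / \<rho>) ^ m)"
        by (rule rss_comparison_prob [OF n p \<sigma> I _ t(1)])
          (use pilot_rate [OF \<theta> True D0 D'] \<rho>0 in \<open>simp_all add: t(2) \<rho>_def\<close>)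
      finally have "ennreal (g b) * emeasure (data_law n p \<sigma> \<beta>) {d \<in> space (data_law n p \<sigma> \<beta>). selected p ?I S b d}
          \<le> ennreal (D b) * ennreal ((1 / \<rho>) ^ m)"
        using True by (simp add: g_def mult_left_mono)
      also have "\<dots> = ennreal ((D b / \<rho>) * (1 / \<rho>) ^ r * (1 / \<rho>) ^ k)"
        using D0 \<rho>0 by (simp add: ennreal_mult [symmetric] m power_add mult_ac)
      also have "\<dots> \<le> ennreal (e b)"
        unfolding e_def
      proof (intro ennreal_leI mult_mono)
        show "D b / \<rho> \<le> 4 / \<theta>"
          using \<rho>0 \<theta> by (simp add: \<rho>_def field_simps)
        show "(1 / \<rho>) ^ r \<le> (1 / (1 + 3 * \<theta>\<^sup>2)) ^ r"
          using \<rho>1 \<rho>0 by (intro power_mono divide_left_mono mult_pos_pos) (auto intro: add_pos_nonneg)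
        have supp: "card {j \<in> {..<p}. b j \<noteq> 0} \<le> k" using b by (simp add: S_def lattice_def)
        have "(1 / \<rho>) ^ k \<le> (1 / \<rho>) ^ card {j \<in> {..<p}. b j \<noteq> 0}"
          using supp \<rho>0 by (intro power_decreasing) auto
        also have "\<dots> = (\<Prod>j\<in>{j \<in> {..<p}. b j \<noteq> 0}. 1 / \<rho>)" by simp
        also have "\<dots> \<le> w b"
          unfolding w_def
        proof (intro prod_mono conjI)
          fix j assume "j \<in> {j \<in> {..<p}. b j \<noteq> 0}"
          then have j: "j < p" by simp
          have "(\<beta> j - b j)\<^sup>2 \<le> (\<Sum>l<p. (\<beta> l - b l)\<^sup>2)" using j by (intro member_le_sum) auto
          then have "\<theta> * (\<beta> j - b j)\<^sup>2 / (4 * real n * \<sigma>\<^sup>2) \<le> \<theta> * (\<Sum>l<p. (\<beta> l - b l)\<^sup>2) / (4 * real n * \<sigma>\<^sup>2)"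
            using \<theta> by (intro divide_right_mono mult_left_mono) auto
          also have "\<dots> = \<theta> * D b / 4" by (simp add: D_def)
          finally show "1 / \<rho> \<le> h j (b j)"
            unfolding h_def \<rho>_def using \<theta> D0 by (intro divide_left_mono mult_pos_pos) (auto intro!: add_pos_nonneg)
        qed (use \<rho>0 in simp)
        finally show "(1 / \<rho>) ^ k \<le> w b" .
      qed (use \<theta> \<rho>0 in auto)
      finally show ?thesis .
    qed (simp add: g_def)
    have "(\<Sum>b\<in>S. e b) = 4 / \<theta> * (1 / (1 + 3 * \<theta>\<^sup>2)) ^ r * (\<Sum>b\<in>S. w b)"
      by (simp add: e_def sum_distrib_left)
    also have "\<dots> \<le> 4 / \<theta> * (1 / (1 + 3 * \<theta>\<^sup>2)) ^ r * (real p ^ k * exp (96 * real k / \<theta>\<^sup>2))"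
    proof (intro mult_left_mono)
      show "(\<Sum>b\<in>S. w b) \<le> real p ^ k * exp (96 * real k / \<theta>\<^sup>2)"
        unfolding S_def w_def
      proof (rule sum_lattice_weights [OF p V h0])
        fix j
        \<comment> \<open>At mesh \<eta> the factors \<open>n\<close> and
          \<open>\<sigma>\<^sup>2\<close> cancel, so the decay of the weights along the integers
          depends on \<theta> and \<open>k\<close> only. The row sum is then at most
          \<open>24 / c\<close>, which explains the 96 in \<open>pilot_error\<close>.\<close>
        define c where "c = \<theta>\<^sup>2 / (4 * real k)"
        have c: "0 < c" "c \<le> 1"
        proof -
          show "0 < c" using \<theta> k by (simp add: c_def)
          have "\<theta>\<^sup>2 \<le> 1" using \<theta> by (simp add: power_le_one)
          then show "c \<le> 1" using k by (simp add: c_def field_simps)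
        qed
        have eq: "h j (\<eta> * real_of_int z) = 1 / (1 + c * (\<beta> j / \<eta> - real_of_int z)\<^sup>2)" for z
        proof -
          have "(\<beta> j - \<eta> * real_of_int z)\<^sup>2 = \<eta>\<^sup>2 * (\<beta> j / \<eta> - real_of_int z)\<^sup>2"
            using \<eta> by (simp add: power_mult_distrib [symmetric] right_diff_distrib)
          moreover have "\<theta> * (\<eta>\<^sup>2 * x) / (4 * real n * \<sigma>\<^sup>2) = c * x" for x
            using n \<sigma> k unfolding \<eta>2 c_def by (simp add: power2_eq_square)
          ultimately show ?thesis by (simp add: h_def)
        qed
        have "(\<Sum>v\<in>V. h j v) = (\<Sum>z\<in>{- N..N}. 1 / (1 + c * (\<beta> j / \<eta> - real_of_int z)\<^sup>2))"
          unfolding V_def using \<eta> by (subst sum.reindex) (auto simp: inj_on_def eq)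
        also have "\<dots> \<le> 24 / c" using c by (intro lattice_row_sum) auto
        also have "24 / c = 96 * real k / \<theta>\<^sup>2" by (simp add: c_def)
        finally show "(\<Sum>v\<in>V. h j v) \<le> 96 * real k / \<theta>\<^sup>2" .
      qed
    qed (use \<theta> in auto)
    finally have sum_e: "12 * \<theta> + (\<Sum>b\<in>S. e b) \<le> pilot_error p k r \<theta>" by (simp add: pilot_error_def)
    have "risk n p \<sigma> (two_stage n p ?I ?J S L) \<beta>
        \<le> ennreal ((real k * ((1 + a) * L\<^sup>2 + 6 * (1 + 1 / a)) + real p * exp (- (L\<^sup>2) / 2))
          * (real n / real (card ?J)) * \<sigma>\<^sup>2 * (1 + 12 * \<theta> + (\<Sum>b\<in>S. e b)))"
    proof (rule two_stage_risk [where g = g, OF n p \<sigma> IJ finS _ L a l0])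
      show "S \<noteq> {}" using b'S by auto
      show "card {j \<in> {..<p}. b j \<noteq> 0} \<le> k" if "b \<in> S" for b
        using that by (simp add: S_def lattice_def)
      show "0 \<le> 12 * \<theta>" using \<theta> by simp
      show "noise_level n p \<sigma> \<beta> b \<le> \<sigma>\<^sup>2 * (1 + 12 * \<theta>) + \<sigma>\<^sup>2 * g b" for b
        using \<theta> \<sigma> by (auto simp: noise g_def distrib_left [symmetric] intro!: mult_left_mono)
      show "0 \<le> g b" "0 \<le> e b" for b using D0 e0 by (simp_all add: g_def)
    qed (rule sel)
    also have "\<dots> \<le> ennreal ((real k * ((1 + a) * L\<^sup>2 + 6 * (1 + 1 / a)) + real p * exp (- (L\<^sup>2) / 2))
        * (real n / real (n - 4 * m)) * \<sigma>\<^sup>2 * (1 + pilot_error p k r \<theta>))"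
      unfolding cJ using sum_e a by (intro ennreal_leI mult_left_mono mult_nonneg_nonneg add_nonneg_nonneg) auto
    finally show ?thesis .
  qed
  then have "(SUP \<beta>\<in>sparse_params p k \<tau>. risk n p \<sigma> (two_stage n p ?I ?J S L) \<beta>)
      \<le> ennreal ((real k * ((1 + a) * L\<^sup>2 + 6 * (1 + 1 / a)) + real p * exp (- (L\<^sup>2) / 2))
        * (real n / real (n - 4 * m)) * \<sigma>\<^sup>2 * (1 + pilot_error p k r \<theta>))"
    by (rule SUP_least)
  then show ?thesis
    unfolding minimax_risk_def
    by (rule INF_lower2 [OF two_stage_estimator [OF I _ finS], rotated]) auto
qed

lemma minimax_risk_le_zero_estimator:
  assumes n: "0 < n" and p: "0 < p"
  shows "minimax_risk n p \<sigma> (sparse_params p k \<tau>) \<le> ennreal (real k * \<tau>\<^sup>2)"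
proof -
  let ?z = "\<lambda>_ :: nat \<Rightarrow> real \<times> (nat \<Rightarrow> real). \<lambda>j\<in>{..<p}. 0 :: real"
  have z: "?z \<in> estimators n p" unfolding estimators_def vec_space_def by (rule measurable_restrict) simp
  have "risk n p \<sigma> ?z \<beta> \<le> ennreal (real k * \<tau>\<^sup>2)" if "\<beta> \<in> sparse_params p k \<tau>" for \<beta>
  proof -
    have "(l2_norm p (\<lambda>j. ?z d j - \<beta> j))\<^sup>2 = (l2_norm p \<beta>)\<^sup>2" for d
      by (simp add: l2_norm_def L2_set_def sum_nonneg)
    then have "risk n p \<sigma> ?z \<beta> = ennreal ((l2_norm p \<beta>)\<^sup>2)"
      by (simp add: risk_def prob_space.emeasure_space_1 [OF prob_space_data_law [OF n p]])
    then show ?thesis using that by (simp add: sparse_params_def ennreal_leI)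
  qed
  then have "(SUP \<beta>\<in>sparse_params p k \<tau>. risk n p \<sigma> ?z \<beta>) \<le> ennreal (real k * \<tau>\<^sup>2)" by (rule SUP_least)
  then show ?thesis unfolding minimax_risk_def by (rule INF_lower2 [OF z])
qed

lemma minimax_risk_mono:
  "\<Theta> \<subseteq> \<Theta>' \<Longrightarrow> minimax_risk n p \<sigma> \<Theta> \<le> minimax_risk n p \<sigma> \<Theta>'"
  unfolding minimax_risk_def by (intro INF_mono' SUP_subset_mono) auto

section \<open>The three regimes\<close>

lemma one_plus_o1_timesI:
  assumes pos: "\<forall>\<^sub>F n in sequentially. 0 < a n"
    and lower: "\<And>\<epsilon>. 0 < \<epsilon> \<Longrightarrow> \<epsilon> < 1 \<Longrightarrow> \<forall>\<^sub>F n in sequentially. ennreal (a n * (1 - \<epsilon>)) \<le> R n"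
    and upper: "\<And>\<epsilon>. 0 < \<epsilon> \<Longrightarrow> \<epsilon> < 1 \<Longrightarrow> \<forall>\<^sub>F n in sequentially. R n \<le> ennreal (a n * (1 + \<epsilon>))"
  shows "one_plus_o1_times R a"
proof -
  \<comment> \<open>For infinite \<open>R n\<close> this would be the meaningless value
    \<open>- 1\<close>, as \<open>enn2real\<close> is then 0. The upper bound excludes the case for
    large \<open>n\<close>.\<close>
  define \<delta> where "\<delta> n = enn2real (R n) / a n - 1" for n
  have small: "\<forall>\<^sub>F n in sequentially. \<bar>\<delta> n\<bar> \<le> \<epsilon> \<and> R n = ennreal (a n * (1 + \<delta> n))"
    if e: "0 < \<epsilon>" "\<epsilon> < 1" for \<epsilon>
    using pos lower [OF e] upper [OF e]
  proof eventually_elim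
    case (elim n)
    obtain r where r: "0 \<le> r" "R n = ennreal r"
      using elim(3) by (cases "R n") (auto simp: top_unique)
    have "r \<le> a n * (1 + \<epsilon>)" "a n * (1 - \<epsilon>) \<le> r"
      using elim e r by (simp_all add: ennreal_le_iff)
    then have "- \<epsilon> \<le> r / a n - 1" "r / a n - 1 \<le> \<epsilon>"
      using elim(1) by (simp_all add: field_simps)
    moreover have "\<delta> n = r / a n - 1" using r by (simp add: \<delta>_def)
    ultimately show ?case using elim(1) r(2) by simp
  qed
  have "\<delta> \<longlonglongrightarrow> 0"
  proof (rule tendstoI)
    fix e :: real assume e: "0 < e"
    define m where "m = min (e / 2) (1 / 2)"
    have m: "0 < m" "m < 1" "m < e" using e by (auto simp: m_def min_def)
    show "\<forall>\<^sub>F n in sequentially. dist (\<delta> n) 0 < e"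
      using small [OF m(1,2)] by eventually_elim (use m(3) in simp)
  qed
  then have "\<delta> \<in> o(\<lambda>_. 1 :: real)" by (intro smalloI_tendsto) auto
  moreover have "\<forall>\<^sub>F n in sequentially. R n = ennreal (a n * (1 + \<delta> n))"
    using small [of "1 / 2"] by (auto elim!: eventually_mono)
  ultimately show ?thesis unfolding one_plus_o1_times_def by blast
qed

lemma sparse_params_mono: "0 \<le> s \<Longrightarrow> s \<le> \<tau> \<Longrightarrow> sparse_params p k s \<subseteq> sparse_params p k \<tau>"
  using mult_left_mono [OF power_mono [of s \<tau> 2], of "real k"]
  unfolding sparse_params_def by fastforce

section \<open>Asymptotics under the growth conditions\<close>

context
  fixes p k :: "nat \<Rightarrow> nat" and \<sigma> :: "nat \<Rightarrow> real"
  assumes k_pos: "\<And>n. 1 \<le> k n" and k_le_p: "\<And>n. k n \<le> p n" and sigma_pos: "\<And>n. 0 < \<sigma> n"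
    and sparsity: "(\<lambda>n. real (k n) / real (p n)) \<longlonglongrightarrow> 0"
    and sample_size: "(\<lambda>n. real (k n) * ln (real (p n)) / real n) \<longlonglongrightarrow> 0"
begin

lemma p_pos: "0 < p n"
  using k_pos [of n] k_le_p [of n] by simp

lemma ratio_at_top: "filterlim (\<lambda>n. real (p n) / real (k n)) at_top sequentially"
proof -
  have "filterlim (\<lambda>n. inverse (real (k n) / real (p n))) at_top sequentially"
    using k_pos p_pos by (intro filterlim_inverse_at_top [OF sparsity]) (auto intro!: always_eventually divide_pos_pos simp: Suc_le_eq)
  then show ?thesis by simp
qed

lemma log_ratio_at_top: "filterlim (\<lambda>n. ln (real (p n) / real (k n))) at_top sequentially"
  by (rule filterlim_compose [OF ln_at_top ratio_at_top])

lemma ratio_le_p: "real (p n) / real (k n) \<le> real (p n)"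
  using k_pos [of n] by (simp add: divide_le_eq mult_le_cancel_left1)

lemma log_p_at_top: "filterlim (\<lambda>n. ln (real (p n))) at_top sequentially"
  by (rule filterlim_compose [OF ln_at_top], rule filterlim_at_top_mono [OF ratio_at_top])
    (simp add: ratio_le_p)

lemma exponent_eventually_le:
  assumes "0 < c"
  shows "\<forall>\<^sub>F n in sequentially. real (k n) * ln (real (p n)) \<le> c * real n"
proof -
  have "\<forall>\<^sub>F n in sequentially. real (k n) * ln (real (p n)) / real n < c"
    using order_tendstoD(2) [OF sample_size assms] .
  then show ?thesis using eventually_gt_at_top [of 0]
    by eventually_elim (simp add: pos_divide_less_eq)
qed

text \<open>Since \<open>ln (p / k) \<le> k * ln p = o(n)\<close>, a quantity exponentially small in
  \<open>n\<close> falls below every fixed power of \<open>k / p\<close>. The power 2 is enough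
  against the tail \<open>(p / k) powr (- c2)\<close> with \<open>c2 < 1\<close> used next.\<close>

lemma chisq_rate_power_le:
  assumes "- 1 < \<delta>" "\<delta> \<noteq> 0"
  shows "\<forall>\<^sub>F n in sequentially. chisq_rate \<delta> ^ n \<le> (real (p n) / real (k n)) powr (- 2)"
proof -
  define r where "r = chisq_rate \<delta>"
  have r: "0 < r" "r < 1" using assms chisq_rate_less_1 [of \<delta>] by (simp_all add: r_def chisq_rate_def)
  define c where "c = - ln r / 2"
  have c: "0 < c" using r by (simp add: c_def)
  show ?thesis
    using exponent_eventually_le [OF c]
  proof eventually_elim
    case (elim n)
    have X: "0 < real (p n) / real (k n)" using p_pos [of n] k_pos [of n] by simp
    have "ln (real (p n) / real (k n)) \<le> ln (real (p n))" using X ratio_le_p [of n] by (subst ln_le_cancel_iff) auto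
    also have "\<dots> \<le> real (k n) * ln (real (p n))" using k_pos [of n] p_pos [of n] by (simp add: mult_le_cancel_right1)
    finally have "ln (real (p n) / real (k n)) \<le> - (real n * ln r) / 2"
      using elim by (simp add: c_def mult.commute)
    then have "real n * ln r \<le> - 2 * ln (real (p n) / real (k n))" by linarith
    moreover have "r ^ n = exp (real n * ln r)" using r by (simp add: exp_of_nat_mult)
    ultimately show ?case using p_pos [of n] k_pos [of n] by (simp add: r_def [symmetric] powr_def)
  qed
qed

text \<open>With \<open>X = p / k\<close>, a competitor is confused with probability about
  \<open>X powr (- c2)\<close>, and each block holds about \<open>X\<close> of them, so their
  expected number diverges because \<open>c2 < 1\<close>. \<open>K\<close>, \<open>M\<close> and
  \<delta> depend only on \<epsilon> and \<open>c\<close>, and each term of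
  \<open>confusion_bound\<close> becomes at most \<open>\<epsilon> / 5\<close>.\<close>

lemma minimax_risk_lower_eventually:
  assumes c: "0 < c" "c < 1" and \<epsilon>: "0 < \<epsilon>"
    and s: "\<forall>\<^sub>F n in sequentially. 0 < s n \<and> s n / \<sigma> n \<le> c * sqrt (2 * ln (real (p n) / real (k n)))"
  shows "\<forall>\<^sub>F n in sequentially. ennreal (real (k n) * (s n)\<^sup>2 * (1 - \<epsilon>))
    \<le> minimax_risk n (p n) (\<sigma> n) (sparse_params (p n) (k n) (s n))"
proof -
  define X where "X n = real (p n) / real (k n)" for n
  define K where "K = sqrt (15 / \<epsilon>)"
  have K: "0 < K" "3 / K\<^sup>2 = \<epsilon> / 5" using \<epsilon> by (simp_all add: K_def)
  obtain M :: nat where M: "5 / \<epsilon> < real M" using reals_Archimedean2 by blast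
  have M1: "1 \<le> M" "1 / real M \<le> \<epsilon> / 5"
  proof -
    have "0 < real M" using M \<epsilon> by (meson divide_pos_pos less_trans zero_less_numeral)
    then show "1 \<le> M" "1 / real M \<le> \<epsilon> / 5" using M \<epsilon> by (simp_all add: field_simps)
  qed
  \<comment> \<open>Small enough that inflating \<open>c\<close> by
    \<open>(1 + \<delta>) / (1 - \<delta>)\<close> stays below \<open>c1\<close>, the midpoint
    between \<open>c\<close> and 1.\<close>
  define \<delta> where "\<delta> = (1 - c) / 8"
  have \<delta>: "0 < \<delta>" "\<delta> < 1" "\<delta> \<le> 1 / 8" using c by (simp_all add: \<delta>_def)
  define c1 where "c1 = (1 + c) / 2"
  have c1: "0 < c1" "c1 < 1" using c by (simp_all add: c1_def)
  have slope: "c * (1 + \<delta>) / sqrt (1 - \<delta>) \<le> c1"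
  proof -
    have "(1 - \<delta>)\<^sup>2 \<le> 1 - \<delta>" using \<delta> by (simp add: power2_eq_square mult_left_le)
    then have "1 - \<delta> \<le> sqrt (1 - \<delta>)" by (rule real_le_rsqrt)
    then have "c * (1 + \<delta>) / sqrt (1 - \<delta>) \<le> c * (1 + \<delta>) / (1 - \<delta>)"
      using c \<delta> by (intro divide_left_mono mult_pos_pos) auto
    also have "\<dots> \<le> c1"
    proof -
      have "0 \<le> (1 - c) * (7 - 3 * c)" using c by (intro mult_nonneg_nonneg) auto
      then have "c * (1 + \<delta>) \<le> c1 * (1 - \<delta>)" unfolding c1_def \<delta>_def by (simp add: field_simps)
      then show ?thesis using \<delta> by (simp add: divide_le_eq)
    qed
    finally show ?thesis .
  qed
  define K' where "K' = K / sqrt (1 - \<delta>) + 1"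
  \<comment> \<open>A second midpoint, squared for the Gaussian exponent. The gap above
    \<open>c1\<close> absorbs the constant \<open>K'\<close>, which is of lower order than
    \<open>sqrt (2 * ln (X n))\<close>.\<close>
  define c2 where "c2 = ((1 + c1) / 2)\<^sup>2"
  have c2: "0 < c2" "c2 < 1" using c1 by (simp_all add: c2_def power_less_one_iff)
  have lt: "filterlim X at_top sequentially" unfolding X_def by (rule ratio_at_top)
  \<comment> \<open>A lower bound for the exponent in the last term of
    \<open>confusion_bound\<close>. A block has \<open>q - 1\<close> competitors, and
    \<open>X n \<le> q + 1\<close> gives at least \<open>X n - 2\<close> of them.\<close>
  define G where "G x = (x - 2) * (x powr (- c2) / sqrt (2 * pi) - x powr (- 2)) / 2" for x :: real
  have "filterlim G at_top at_top" unfolding G_def using c2 by real_asymp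
  then have GX: "filterlim (\<lambda>n. G (X n)) at_top sequentially" by (rule filterlim_compose [OF _ lt])
  have "\<forall>\<^sub>F x in at_top. 0 \<le> (x :: real) powr (- c2) / sqrt (2 * pi) - x powr (- 2)"
    using c2 by real_asymp
  then have gX: "\<forall>\<^sub>F n in sequentially. 0 \<le> X n powr (- c2) / sqrt (2 * pi) - X n powr (- 2)"
    using lt by (rule eventually_compose_filterlim)
  have rate: "\<forall>\<^sub>F n in sequentially. chisq_rate d ^ n \<le> \<epsilon> / 5" if "- 1 < d" "d \<noteq> 0" for d
  proof -
    have "(\<lambda>n. chisq_rate d ^ n) \<longlonglongrightarrow> 0"
      using that chisq_rate_less_1 [of d] by (intro LIMSEQ_power_zero) (simp add: chisq_rate_nonneg)
    from order_tendstoD(2) [OF this, of "\<epsilon> / 5"] \<epsilon> show ?thesis by (auto elim: eventually_mono)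
  qed
  have e2M: "\<forall>\<^sub>F n in sequentially. - ln (\<epsilon> / 5 / 2 ^ M) \<le> G (X n)"
    using GX by (simp add: filterlim_at_top)
  have lin: "\<forall>\<^sub>F n in sequentially. K' \<le> (1 - c1) / 2 * sqrt (2 * ln (X n))"
  proof -
    have "filterlim (\<lambda>x :: real. (1 - c1) / 2 * sqrt (2 * ln x)) at_top at_top" using c1 by real_asymp
    from filterlim_compose [OF this lt] show ?thesis by (simp add: filterlim_at_top)
  qed
  have X2: "\<forall>\<^sub>F n in sequentially. 2 \<le> X n" using lt by (simp add: filterlim_at_top)
  have rates: "\<forall>\<^sub>F n in sequentially. chisq_rate \<delta> ^ n \<le> \<epsilon> / 5"
      "\<forall>\<^sub>F n in sequentially. chisq_rate (- \<delta>) ^ n \<le> \<epsilon> / 5"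
      "\<forall>\<^sub>F n in sequentially. chisq_rate \<delta> ^ n \<le> X n powr (- 2)"
    using \<delta> rate [of \<delta>] rate [of "- \<delta>"] chisq_rate_power_le [of \<delta>] by (simp_all add: X_def)
  show ?thesis
    using s eventually_gt_at_top [of 0] gX rates(1,2) e2M lin X2 rates(3)
  proof eventually_elim
    case (elim n)
    define \<mu> where "\<mu> = s n / \<sigma> n"
    define l where "l = sqrt (2 * ln (X n))"
    define q where "q = p n div k n"
    have l0: "0 \<le> l" "l\<^sup>2 = 2 * ln (X n)" using elim(8) by (simp_all add: l_def)
    have \<mu>: "0 \<le> \<mu>" "\<mu> \<le> c * l" using elim(1) sigma_pos [of n] by (simp_all add: \<mu>_def l_def X_def)
    have q: "X n \<le> real q + 1" "0 < q" "k n * q \<le> p n"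
    proof -
      have "real (p n) = real (k n) * real q + real (p n mod k n)"
        unfolding q_def by (metis mult_div_mod_eq of_nat_add of_nat_mult)
      moreover have "real (p n mod k n) \<le> real (k n)" using k_pos [of n] by (simp add: less_imp_le)
      ultimately show "X n \<le> real q + 1" using k_pos [of n] by (simp add: X_def divide_le_eq algebra_simps)
      then show "0 < q" using elim(8) by linarith
      show "k n * q \<le> p n" by (simp add: q_def)
    qed
    have prob: "X n powr (- c2) / sqrt (2 * pi) - X n powr (- 2) \<le> confusion_prob n \<mu> K \<delta>"
    proof -
      let ?t = "(K + \<mu> * (1 + \<delta>)) / sqrt (1 - \<delta>) + 1"
      have "?t = K' + \<mu> * ((1 + \<delta>) / sqrt (1 - \<delta>))" by (simp add: K'_def add_divide_distrib [of K])
      also have "\<dots> \<le> K' + c * l * ((1 + \<delta>) / sqrt (1 - \<delta>))"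
        using \<mu> \<delta> by (intro add_left_mono mult_right_mono) auto
      also have "\<dots> = K' + (c * (1 + \<delta>) / sqrt (1 - \<delta>)) * l" by simp
      also have "\<dots> \<le> (1 - c1) / 2 * l + c1 * l"
        using elim(7) slope l0 unfolding l_def by (intro add_mono mult_right_mono) auto
      also have "\<dots> = (1 + c1) / 2 * l" by (simp add: field_simps)
      finally have "?t \<le> (1 + c1) / 2 * l" .
      moreover have "0 \<le> ?t" using K \<mu> \<delta> by (intro add_nonneg_nonneg divide_nonneg_nonneg) auto
      ultimately have "?t\<^sup>2 \<le> ((1 + c1) / 2 * l)\<^sup>2" by (intro power_mono)
      also have "\<dots> = c2 * (2 * ln (X n))" by (simp only: power_mult_distrib c2_def l0(2))
      finally have "- c2 * ln (X n) \<le> - (?t\<^sup>2) / 2" by simp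
      then have "X n powr (- c2) \<le> exp (- (?t\<^sup>2) / 2)" using elim(8) by (simp add: powr_def)
      then have "X n powr (- c2) / sqrt (2 * pi) \<le> exp (- (?t\<^sup>2) / 2) / sqrt (2 * pi)" by (rule divide_right_mono) simp
      moreover have "chisq_rate \<delta> ^ n \<le> X n powr (- 2)" by (rule elim(9))
      ultimately show ?thesis unfolding confusion_prob_def by linarith
    qed
    have "G (X n) \<le> real (q - 1) * confusion_prob n \<mu> K \<delta> / 2"
      unfolding G_def using prob elim(3,8) q by (intro divide_right_mono mult_mono) auto
    then have "- (real (q - 1) * confusion_prob n \<mu> K \<delta> / 2) \<le> ln (\<epsilon> / 5 / 2 ^ M)" using elim(6) by linarith
    then have "exp (- (real (q - 1) * confusion_prob n \<mu> K \<delta> / 2)) \<le> \<epsilon> / 5 / 2 ^ M"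
      using \<epsilon> by (subst ln_ge_iff [symmetric]) auto
    then have "2 ^ M * exp (- (real (q - 1) * confusion_prob n \<mu> K \<delta> / 2)) \<le> \<epsilon> / 5"
      by (simp add: field_simps)
    then have "confusion_bound n (q - 1) \<mu> K \<delta> M \<le> \<epsilon>"
      unfolding confusion_bound_def using K(2) M1(2) elim(4,5) \<delta> by simp
    then have "real (k n) * (s n)\<^sup>2 * (1 - \<epsilon>) \<le> real (k n) * (s n)\<^sup>2 * (1 - confusion_bound n (q - 1) \<mu> K \<delta> M)"
      by (intro mult_left_mono) auto
    then have "ennreal (real (k n) * (s n)\<^sup>2 * (1 - \<epsilon>)) \<le> ennreal (real (k n) * (s n)\<^sup>2 * (1 - confusion_bound n (q - 1) \<mu> K \<delta> M))"
      by (rule ennreal_leI)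
    also have "\<dots> \<le> minimax_risk n (p n) (\<sigma> n) (sparse_params (p n) (k n) (s n))"
      unfolding \<mu>_def using elim(1,2)
      by (intro minimax_risk_lower sigma_pos \<delta>(1,2) K(1) M1(1) q) auto
    finally show ?case .
  qed
qed

text \<open>The decay has an exponent linear in \<open>n\<close>, as \<open>r = n div B\<close>
  does. The lattice contributes \<open>k * ln p\<close> and a multiple of \<open>k\<close>, and both
  are \<open>o(n)\<close> because \<open>ln p\<close> is eventually at least 1.\<close>

lemma pilot_error_eventually:
  assumes \<theta>: "0 < \<theta>" and B: "0 < B"
  shows "\<forall>\<^sub>F n in sequentially. pilot_error (p n) (k n) (n div B) \<theta> \<le> 13 * \<theta>"
proof -
  define \<kappa> where "\<kappa> = ln (1 + 3 * \<theta>\<^sup>2)"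
  have \<kappa>: "0 < \<kappa>" using \<theta> by (simp add: \<kappa>_def ln_gt_zero)
  define C where "C = 1 + 96 / \<theta>\<^sup>2"
  have C: "0 < C" by (simp add: C_def add_pos_nonneg)
  \<comment> \<open>Chosen so that the lattice, of size at most \<open>C * k * ln p\<close> in the
    exponent, uses up just half of the available \<open>\<kappa> * n / B\<close>.\<close>
  define c where "c = \<kappa> / (2 * real B * C)"
  have c: "0 < c" using \<kappa> C B by (simp add: c_def)
  have "filterlim (\<lambda>n. \<kappa> / (2 * real B) * real n) at_top sequentially"
    using \<kappa> B by (intro filterlim_tendsto_pos_mult_at_top [OF tendsto_const] filterlim_real_sequentially) auto
  then have big: "\<forall>\<^sub>F n in sequentially. \<kappa> - ln (\<theta>\<^sup>2 / 4) \<le> \<kappa> / (2 * real B) * real n"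
    by (simp add: filterlim_at_top)
  have lp: "\<forall>\<^sub>F n in sequentially. 1 \<le> ln (real (p n))"
    using log_p_at_top by (simp add: filterlim_at_top)
  show ?thesis
    using big lp exponent_eventually_le [OF c]
  proof eventually_elim
    case (elim n)
    have r: "real n / real B - 1 \<le> real (n div B)"
    proof -
      have "real n = real B * real (n div B) + real (n mod B)"
        by (metis mult_div_mod_eq of_nat_add of_nat_mult)
      moreover have "real (n mod B) \<le> real B" using B by (simp add: less_imp_le)
      ultimately show ?thesis using B by (simp add: divide_le_eq algebra_simps)
    qed
    have e1: "(1 / (1 + 3 * \<theta>\<^sup>2)) ^ (n div B) = exp (- (real (n div B) * \<kappa>))"
    proof -
      have "1 / (1 + 3 * \<theta>\<^sup>2) = exp (- \<kappa>)" using \<theta> by (simp add: \<kappa>_def exp_minus add_pos_nonneg inverse_eq_divide)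
      then show ?thesis by (simp add: exp_of_nat_mult [symmetric])
    qed
    have e2: "real (p n) ^ k n = exp (real (k n) * ln (real (p n)))"
      using p_pos [of n] by (simp add: exp_of_nat_mult)
    have kC: "real (k n) * ln (real (p n)) + 96 * real (k n) / \<theta>\<^sup>2 \<le> C * (real (k n) * ln (real (p n)))"
    proof -
      have "real (k n) * (96 / \<theta>\<^sup>2) \<le> (real (k n) * ln (real (p n))) * (96 / \<theta>\<^sup>2)"
        using elim(2) by (intro mult_right_mono) (auto simp: mult_le_cancel_left1)
      then show ?thesis by (simp add: C_def algebra_simps)
    qed
    also have "\<dots> \<le> C * (c * real n)" using elim(3) C by (intro mult_left_mono) auto
    also have "\<dots> = \<kappa> / (2 * real B) * real n" using C by (simp add: c_def)
    finally have up: "real (k n) * ln (real (p n)) + 96 * real (k n) / \<theta>\<^sup>2 \<le> \<kappa> / (2 * real B) * real n" .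
    have "(real n / real B - 1) * \<kappa> \<le> real (n div B) * \<kappa>" using r \<kappa> by (intro mult_right_mono) auto
    then have "\<kappa> / (2 * real B) * real n + \<kappa> / (2 * real B) * real n - \<kappa> \<le> real (n div B) * \<kappa>"
      by (simp add: algebra_simps)
    then have "- (real (n div B) * \<kappa>) + (real (k n) * ln (real (p n)) + 96 * real (k n) / \<theta>\<^sup>2) \<le> ln (\<theta>\<^sup>2 / 4)"
      using up elim(1) by linarith
    then have "exp (- (real (n div B) * \<kappa>) + (real (k n) * ln (real (p n)) + 96 * real (k n) / \<theta>\<^sup>2)) \<le> exp (ln (\<theta>\<^sup>2 / 4))"
      by simp
    moreover have "exp (ln (\<theta>\<^sup>2 / 4)) = \<theta>\<^sup>2 / 4" using \<theta> by (intro exp_ln) simp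
    ultimately have "(1 / (1 + 3 * \<theta>\<^sup>2)) ^ (n div B) * (real (p n) ^ k n * exp (96 * real (k n) / \<theta>\<^sup>2)) \<le> \<theta>\<^sup>2 / 4"
      by (simp only: e1 e2 exp_add [symmetric])
    then have "4 / \<theta> * ((1 / (1 + 3 * \<theta>\<^sup>2)) ^ (n div B) * (real (p n) ^ k n * exp (96 * real (k n) / \<theta>\<^sup>2))) \<le> 4 / \<theta> * (\<theta>\<^sup>2 / 4)"
      using \<theta> by (intro mult_left_mono) auto
    also have "\<dots> = \<theta>" using \<theta> by (simp add: power2_eq_square)
    finally show ?case by (simp add: pilot_error_def mult.assoc)
  qed
qed

text \<open>The excess over the main term is collected in three factors: \<open>1 + 2 * a\<close>
  for the cross terms and the terms of order \<open>k\<close>, \<open>1 + a\<close> for the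
  observations spent on the pilot, and \<open>1 + 13 * a\<close> for its error.\<close>

lemma minimax_risk_upper_eventually:
  assumes \<epsilon>: "0 < \<epsilon>" "\<epsilon> < 1"
  shows "\<forall>\<^sub>F n in sequentially. minimax_risk n (p n) (\<sigma> n) (sparse_params (p n) (k n) (\<tau> n))
    \<le> ennreal (2 * (\<sigma> n)\<^sup>2 * real (k n) * ln (real (p n) / real (k n)) * (1 + \<epsilon>))"
proof -
  define a where "a = \<epsilon> / 100"
  have a: "0 < a" "a \<le> 1 / 100" using \<epsilon> by (simp_all add: a_def)
  \<comment> \<open>The pilot uses \<open>4 * (r + 1 + k)\<close> observations. This
    \<open>B\<close> makes \<open>r\<close> at most \<open>a * n / 16\<close>, and 1 and
    \<open>k\<close> obey the same bound for large \<open>n\<close>, so at most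
    \<open>3 / 4 * a * n\<close> observations are lost.\<close>
  obtain B :: nat where B0: "16 / a < real B" using reals_Archimedean2 by blast
  have B: "0 < B"
  proof -
    have "0 < real B" using B0 a by (meson divide_pos_pos less_trans zero_less_numeral)
    then show ?thesis by simp
  qed
  have aB: "16 < a * real B" using B0 a by (simp add: divide_less_eq mult.commute)
  have logk: "\<forall>\<^sub>F n in sequentially. (6 * (1 + 1 / a) + 1) / (2 * a) \<le> ln (real (p n) / real (k n))"
    using log_ratio_at_top by (simp add: filterlim_at_top)
  have lp: "\<forall>\<^sub>F n in sequentially. 1 \<le> ln (real (p n))"
    using log_p_at_top by (simp add: filterlim_at_top)
  have lX: "\<forall>\<^sub>F n in sequentially. 1 \<le> ln (real (p n) / real (k n))"
    using log_ratio_at_top by (simp add: filterlim_at_top)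
  have nB: "\<forall>\<^sub>F n in sequentially. 1 / (a / 16) \<le> real n"
    using filterlim_real_sequentially by (simp add: filterlim_at_top)
  have a16: "0 < a / 16" using a by simp
  show ?thesis
    using logk lp lX nB exponent_eventually_le [OF a16] pilot_error_eventually [OF a(1) B]
  proof eventually_elim
    case (elim n)
    define \<Lambda> where "\<Lambda> = ln (real (p n) / real (k n))"
    define r where "r = n div B"
    define m where "m = r + 1 + k n"
    have X: "0 < real (p n) / real (k n)" using p_pos [of n] k_pos [of n] by simp
    have n1: "1 \<le> a / 16 * real n" using elim(4) a by (simp add: divide_le_eq mult.commute)
    then have n0: "0 < real n" by (cases "n = 0") auto
    have kn: "real (k n) \<le> a / 16 * real n"
    proof -
      have "real (k n) \<le> real (k n) * ln (real (p n))" using elim(2) by (simp add: mult_le_cancel_left1)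
      then show ?thesis using elim(5) by linarith
    qed
    have rn: "real r \<le> a / 16 * real n"
    proof -
      have "real r * real B \<le> real n" unfolding r_def by (metis div_times_less_eq_dividend of_nat_le_iff of_nat_mult)
      moreover have "real r * 16 \<le> real r * (a * real B)" using aB by (intro mult_left_mono) auto
      moreover have "a * (real r * real B) \<le> a * real n" using calculation(1) a by (intro mult_left_mono) auto
      ultimately show ?thesis by (simp add: mult_ac)
    qed
    have m4: "4 * real m \<le> 3 / 4 * a * real n" using n1 kn rn by (simp add: m_def)
    have "4 * real m < real n"
    proof -
      have "3 / 4 * a * real n < 1 * real n" using a n0 by (intro mult_strict_right_mono) auto
      then show ?thesis using m4 by linarith
    qed
    then have mn: "4 * m < n" by linarith
    have ratio: "real n / real (n - 4 * m) \<le> 1 + a"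
    proof -
      have "(1 + a) * (1 - 3 / 4 * a) = 1 + a * (1 / 4 - 3 / 4 * a)" by (simp add: field_simps)
      moreover have "0 \<le> a * (1 / 4 - 3 / 4 * a)" using a by (intro mult_nonneg_nonneg) auto
      ultimately have "1 \<le> (1 + a) * (1 - 3 / 4 * a)" by linarith
      then have "real n \<le> (1 + a) * (1 - 3 / 4 * a) * real n"
        using n0 by (simp add: mult_le_cancel_right1)
      also have "\<dots> \<le> (1 + a) * (real n - 4 * real m)"
        using m4 a by (simp only: mult.assoc) (intro mult_left_mono, auto simp: algebra_simps)
      finally have "real n \<le> (1 + a) * real (n - 4 * m)" using mn by (simp add: of_nat_diff)
      then show ?thesis using mn by (simp add: divide_le_eq)
    qed
    \<comment> \<open>The universal threshold for sparsity \<open>k\<close>: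
      \<open>p * exp (- (L\<^sup>2) / 2)\<close> becomes exactly \<open>k\<close>, so the
      coordinates outside the supports cost no more than order \<open>k\<close>.\<close>
    define L where "L = sqrt (2 * \<Lambda>)"
    have L: "0 \<le> L" "L\<^sup>2 = 2 * \<Lambda>" using elim(3) by (simp_all add: L_def \<Lambda>_def)
    have pe: "real (p n) * exp (- (L\<^sup>2) / 2) = real (k n)"
      using X p_pos [of n] k_pos [of n] by (simp add: L(2) \<Lambda>_def exp_minus inverse_eq_divide)
    have main: "real (k n) * ((1 + a) * L\<^sup>2 + 6 * (1 + 1 / a)) + real (p n) * exp (- (L\<^sup>2) / 2)
        \<le> (1 + 2 * a) * (2 * real (k n) * \<Lambda>)"
    proof -
      have "6 * (1 + 1 / a) + 1 \<le> 2 * a * \<Lambda>"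
        using elim(1) a by (simp add: \<Lambda>_def pos_divide_le_eq mult.commute)
      then have "real (k n) * (6 * (1 + 1 / a) + 1) \<le> real (k n) * (2 * a * \<Lambda>)" by (intro mult_left_mono) auto
      then show ?thesis unfolding pe unfolding L(2) by (simp add: algebra_simps)
    qed
    have pil: "1 + pilot_error (p n) (k n) r a \<le> 1 + 13 * a" using elim(6) by (simp add: r_def)
    have coeff: "(1 + 2 * a) * (1 + a) * (1 + 13 * a) \<le> 1 + \<epsilon>"
    proof -
      have "a * a \<le> a / 100" using mult_left_mono [OF a(2), of a] a by simp
      moreover have "a * a * a \<le> a / 100"
        using mult_mono [OF \<open>a * a \<le> a / 100\<close>, of a 1] a by simp
      moreover have "(1 + 2 * a) * (1 + a) * (1 + 13 * a) = 1 + 16 * a + 41 * (a * a) + 26 * (a * a * a)"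
        by (simp add: algebra_simps)
      moreover have "\<epsilon> = 100 * a" by (simp add: a_def)
      ultimately show ?thesis using a by linarith
    qed
    have pos: "0 \<le> pilot_error (p n) (k n) r a" using a by (simp add: pilot_error_def)
    have "minimax_risk n (p n) (\<sigma> n) (sparse_params (p n) (k n) (\<tau> n))
        \<le> ennreal ((real (k n) * ((1 + a) * L\<^sup>2 + 6 * (1 + 1 / a)) + real (p n) * exp (- (L\<^sup>2) / 2))
          * (real n / real (n - 4 * m)) * (\<sigma> n)\<^sup>2 * (1 + pilot_error (p n) (k n) r a))"
      using a by (intro minimax_risk_upper k_pos k_le_p sigma_pos m_def mn L) auto
    also have "\<dots> \<le> ennreal (((1 + 2 * a) * (2 * real (k n) * \<Lambda>)) * (1 + a) * (\<sigma> n)\<^sup>2 * (1 + 13 * a))"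
      using main ratio pil pos a elim(3) unfolding \<Lambda>_def
      by (intro ennreal_leI mult_mono mult_nonneg_nonneg add_nonneg_nonneg) auto
    also have "((1 + 2 * a) * (2 * real (k n) * \<Lambda>)) * (1 + a) * (\<sigma> n)\<^sup>2 * (1 + 13 * a)
        = 2 * (\<sigma> n)\<^sup>2 * real (k n) * \<Lambda> * ((1 + 2 * a) * (1 + a) * (1 + 13 * a))"
      by (simp only: mult_ac)
    also have "ennreal \<dots> \<le> ennreal (2 * (\<sigma> n)\<^sup>2 * real (k n) * \<Lambda> * (1 + \<epsilon>))"
      using elim(3) coeff unfolding \<Lambda>_def by (intro ennreal_leI mult_left_mono mult_nonneg_nonneg) auto
    finally show ?case by (simp add: \<Lambda>_def)
  qed
qed

text \<open>Serves regimes I and II together, as both keep \<open>\<tau> / \<sigma>\<close> below a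
  fixed fraction of \<open>sqrt (2 * ln (p / k))\<close>.\<close>

lemma low_signal_regime:
  assumes tau_pos: "\<And>n. 0 < \<tau> n"
    and c: "0 < c" "c < 1"
    and small: "\<forall>\<^sub>F n in sequentially. \<tau> n / \<sigma> n \<le> c * sqrt (2 * ln (real (p n) / real (k n)))"
  shows "one_plus_o1_times (\<lambda>n. minimax_risk n (p n) (\<sigma> n) (sparse_params (p n) (k n) (\<tau> n)))
    (\<lambda>n. real (k n) * (\<tau> n)\<^sup>2)"
proof (rule one_plus_o1_timesI)
  show "\<forall>\<^sub>F n in sequentially. 0 < real (k n) * (\<tau> n)\<^sup>2"
    using k_pos tau_pos by (intro always_eventually allI mult_pos_pos zero_less_power) (auto simp: Suc_le_eq)
  fix \<epsilon> :: real assume \<epsilon>: "0 < \<epsilon>" "\<epsilon> < 1"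
  show "\<forall>\<^sub>F n in sequentially. ennreal (real (k n) * (\<tau> n)\<^sup>2 * (1 - \<epsilon>))
      \<le> minimax_risk n (p n) (\<sigma> n) (sparse_params (p n) (k n) (\<tau> n))"
    using small tau_pos by (intro minimax_risk_lower_eventually [OF c \<epsilon>(1)]) (auto elim: eventually_mono)
  show "\<forall>\<^sub>F n in sequentially. minimax_risk n (p n) (\<sigma> n) (sparse_params (p n) (k n) (\<tau> n))
      \<le> ennreal (real (k n) * (\<tau> n)\<^sup>2 * (1 + \<epsilon>))"
    using eventually_gt_at_top [of 0]
  proof eventually_elim
    case (elim n)
    have "minimax_risk n (p n) (\<sigma> n) (sparse_params (p n) (k n) (\<tau> n)) \<le> ennreal (real (k n) * (\<tau> n)\<^sup>2)"
      by (rule minimax_risk_le_zero_estimator [OF elim p_pos])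
    also have "\<dots> \<le> ennreal (real (k n) * (\<tau> n)\<^sup>2 * (1 + \<epsilon>))"
      using \<epsilon> mult_left_mono [of 1 "1 + \<epsilon>" "real (k n) * (\<tau> n)\<^sup>2"] by (intro ennreal_leI) simp
    finally show ?case .
  qed
qed

text \<open>The upper bound does not see \<tau>. The lower bound is taken at a smaller radius
  \<open>s\<close> just under the critical one and passes to \<tau> because the parameter sets are
  nested.\<close>

lemma high_signal_regime:
  assumes tau_pos: "\<And>n. 0 < \<tau> n"
    and large: "\<forall>\<^sub>F n in sequentially. sqrt (2 * ln (real (p n) / real (k n))) \<le> \<tau> n / \<sigma> n"
  shows "one_plus_o1_times (\<lambda>n. minimax_risk n (p n) (\<sigma> n) (sparse_params (p n) (k n) (\<tau> n)))
    (\<lambda>n. 2 * (\<sigma> n)\<^sup>2 * real (k n) * ln (real (p n) / real (k n)))"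
proof (rule one_plus_o1_timesI)
  have l1: "\<forall>\<^sub>F n in sequentially. 1 \<le> ln (real (p n) / real (k n))"
    using log_ratio_at_top by (simp add: filterlim_at_top)
  show "\<forall>\<^sub>F n in sequentially. 0 < 2 * (\<sigma> n)\<^sup>2 * real (k n) * ln (real (p n) / real (k n))"
    using l1
  proof eventually_elim
    case (elim n)
    then show ?case using sigma_pos [of n] k_pos [of n] by (intro mult_pos_pos zero_less_power) auto
  qed
  fix \<epsilon> :: real assume \<epsilon>: "0 < \<epsilon>" "\<epsilon> < 1"
  show "\<forall>\<^sub>F n in sequentially. minimax_risk n (p n) (\<sigma> n) (sparse_params (p n) (k n) (\<tau> n))
      \<le> ennreal (2 * (\<sigma> n)\<^sup>2 * real (k n) * ln (real (p n) / real (k n)) * (1 + \<epsilon>))"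
    by (rule minimax_risk_upper_eventually [OF \<epsilon>])
  \<comment> \<open>Then \<open>c\<^sup>2\<close> is at least \<open>1 - \<epsilon> / 2\<close>. A
    second loss of \<open>1 - \<epsilon> / 2\<close> comes from the lower bound, and the product is
    at least \<open>1 - \<epsilon>\<close>.\<close>
  define c where "c = 1 - \<epsilon> / 4"
  have c: "0 < c" "c < 1" using \<epsilon> by (simp_all add: c_def)
  define s where "s n = c * \<sigma> n * sqrt (2 * ln (real (p n) / real (k n)))" for n
  have "\<forall>\<^sub>F n in sequentially. 0 < s n \<and> s n / \<sigma> n \<le> c * sqrt (2 * ln (real (p n) / real (k n)))"
    using l1
  proof eventually_elim
    case (elim n)
    then show ?case using c sigma_pos [of n] by (simp add: s_def)
  qed
  then have "\<forall>\<^sub>F n in sequentially. ennreal (real (k n) * (s n)\<^sup>2 * (1 - \<epsilon> / 2))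
      \<le> minimax_risk n (p n) (\<sigma> n) (sparse_params (p n) (k n) (s n))"
    using \<epsilon> by (intro minimax_risk_lower_eventually [OF c]) auto
  then show "\<forall>\<^sub>F n in sequentially. ennreal (2 * (\<sigma> n)\<^sup>2 * real (k n) * ln (real (p n) / real (k n)) * (1 - \<epsilon>))
      \<le> minimax_risk n (p n) (\<sigma> n) (sparse_params (p n) (k n) (\<tau> n))"
    using l1 large
  proof eventually_elim
    case (elim n)
    let ?\<Lambda> = "ln (real (p n) / real (k n))"
    have s2: "real (k n) * (s n)\<^sup>2 = 2 * (\<sigma> n)\<^sup>2 * real (k n) * ?\<Lambda> * c\<^sup>2"
      using elim(2) by (simp add: s_def power_mult_distrib)
    have "1 - \<epsilon> \<le> c\<^sup>2 * (1 - \<epsilon> / 2)"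
    proof -
      have "1 - \<epsilon> / 2 \<le> c\<^sup>2" by (simp add: c_def power2_eq_square algebra_simps)
      then have "(1 - \<epsilon> / 2) * (1 - \<epsilon> / 2) \<le> c\<^sup>2 * (1 - \<epsilon> / 2)" using \<epsilon> by (intro mult_right_mono) auto
      moreover have "1 - \<epsilon> \<le> (1 - \<epsilon> / 2) * (1 - \<epsilon> / 2)" by (simp add: algebra_simps)
      ultimately show ?thesis by linarith
    qed
    then have "2 * (\<sigma> n)\<^sup>2 * real (k n) * ?\<Lambda> * (1 - \<epsilon>) \<le> 2 * (\<sigma> n)\<^sup>2 * real (k n) * ?\<Lambda> * (c\<^sup>2 * (1 - \<epsilon> / 2))"
      using elim(2) by (intro mult_left_mono) auto
    also have "\<dots> = real (k n) * (s n)\<^sup>2 * (1 - \<epsilon> / 2)" unfolding s2 by (simp only: mult.assoc)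
    finally have "ennreal (2 * (\<sigma> n)\<^sup>2 * real (k n) * ?\<Lambda> * (1 - \<epsilon>)) \<le> ennreal (real (k n) * (s n)\<^sup>2 * (1 - \<epsilon> / 2))"
      by (rule ennreal_leI)
    also have "\<dots> \<le> minimax_risk n (p n) (\<sigma> n) (sparse_params (p n) (k n) (s n))" by (rule elim(1))
    also have "\<dots> \<le> minimax_risk n (p n) (\<sigma> n) (sparse_params (p n) (k n) (\<tau> n))"
    proof (intro minimax_risk_mono sparse_params_mono)
      show "0 \<le> s n" using c sigma_pos [of n] elim(2) by (simp add: s_def)
      have "sqrt (2 * ?\<Lambda>) * \<sigma> n \<le> \<tau> n" using elim(3) sigma_pos [of n] by (simp add: pos_le_divide_eq)
      moreover have "c * (\<sigma> n * sqrt (2 * ?\<Lambda>)) \<le> 1 * (\<sigma> n * sqrt (2 * ?\<Lambda>))"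
        using c sigma_pos [of n] elim(2) by (intro mult_right_mono) auto
      ultimately show "s n \<le> \<tau> n" by (simp add: s_def mult_ac)
    qed
    finally show ?case .
  qed
qed

end

theorem theorem2:
  fixes p k :: "nat \<Rightarrow> nat" and \<sigma> \<tau> :: "nat \<Rightarrow> real"
  defines "\<mu> \<equiv> \<lambda>n. \<tau> n / \<sigma> n"
    and "R \<equiv> \<lambda>n. minimax_risk n (p n) (\<sigma> n) (sparse_params (p n) (k n) (\<tau> n))"
  assumes k_pos: "\<And>n. 1 \<le> k n" and k_le_p: "\<And>n. k n \<le> p n"
    and sigma_pos: "\<And>n. 0 < \<sigma> n" and tau_pos: "\<And>n. 0 < \<tau> n"
    and sparsity: "(\<lambda>n. real (k n) / real (p n)) \<longlonglongrightarrow> 0"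
    and sample_size: "(\<lambda>n. real (k n) * ln (real (p n)) / real n) \<longlonglongrightarrow> 0"
  shows
    "(\<mu> \<longlonglongrightarrow> 0 \<longrightarrow> one_plus_o1_times R (\<lambda>n. real (k n) * (\<tau> n)\<^sup>2)) \<and>
     (filterlim \<mu> at_top sequentially \<and>
        \<mu> \<in> o(\<lambda>n. sqrt (ln (real (p n) / real (k n)))) \<longrightarrow>
      one_plus_o1_times R (\<lambda>n. real (k n) * (\<tau> n)\<^sup>2)) \<and>
     (\<mu> \<in> \<omega>(\<lambda>n. sqrt (ln (real (p n) / real (k n)))) \<longrightarrow>
      one_plus_o1_times R
        (\<lambda>n. 2 * (\<sigma> n)\<^sup>2 * real (k n) * ln (real (p n) / real (k n))))"
proof -
  let ?\<Lambda> = "\<lambda>n. ln (real (p n) / real (k n))"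
  note ctxt = k_pos k_le_p sigma_pos sparsity sample_size
  have l1: "\<forall>\<^sub>F n in sequentially. 1 \<le> ?\<Lambda> n"
    using log_ratio_at_top [OF ctxt] by (simp add: filterlim_at_top)
  have half: "0 < 1 / (2 :: real)" by simp
  have \<mu>0: "0 < \<mu> n" for n using sigma_pos tau_pos by (simp add: \<mu>_def)
  \<comment> \<open>The fraction \<open>c = 1 / 2\<close> is arbitrary below 1. In regime I the
    right side eventually exceeds a constant, in regime II it has the order against which the signal
    is negligible.\<close>
  have low: "one_plus_o1_times R (\<lambda>n. real (k n) * (\<tau> n)\<^sup>2)"
    if "\<forall>\<^sub>F n in sequentially. \<mu> n \<le> 1 / 2 * sqrt (2 * ?\<Lambda> n)"
    unfolding R_def by (rule low_signal_regime [OF ctxt tau_pos _ _ that [unfolded \<mu>_def]]) simp_all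
  have "\<forall>\<^sub>F n in sequentially. \<mu> n \<le> 1 / 2 * sqrt (2 * ?\<Lambda> n)" if "\<mu> \<longlonglongrightarrow> 0"
    using order_tendstoD(2) [OF that half] l1
  proof eventually_elim
    case (elim n)
    have "1 \<le> sqrt (2 * ?\<Lambda> n)" using elim(2) by simp
    then show ?case using elim(1) by linarith
  qed
  moreover have "\<forall>\<^sub>F n in sequentially. \<mu> n \<le> 1 / 2 * sqrt (2 * ?\<Lambda> n)" if "\<mu> \<in> o(\<lambda>n. sqrt (?\<Lambda> n))"
    using landau_o.smallD [OF that half] l1
  proof eventually_elim
    case (elim n)
    have "\<mu> n \<le> 1 / 2 * sqrt (?\<Lambda> n)" using elim(1,2) \<mu>0 [of n] by simp
    moreover have "sqrt (?\<Lambda> n) \<le> sqrt (2 * ?\<Lambda> n)" using elim(2) by simp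
    ultimately show ?case by linarith
  qed
  moreover have "one_plus_o1_times R (\<lambda>n. 2 * (\<sigma> n)\<^sup>2 * real (k n) * ?\<Lambda> n)" if "\<mu> \<in> \<omega>(\<lambda>n. sqrt (?\<Lambda> n))"
  proof -
    \<comment> \<open>The omega condition is used with the constant 2, which exceeds the
      \<open>sqrt 2\<close> in the critical level.\<close>
    have "\<forall>\<^sub>F n in sequentially. sqrt (2 * ?\<Lambda> n) \<le> \<mu> n"
      using landau_omega.smallD [OF that zero_less_numeral [of "num.Bit0 num.One"]] l1
    proof eventually_elim
      case (elim n)
      have "sqrt (2 * ?\<Lambda> n) \<le> sqrt (4 * ?\<Lambda> n)" using elim(2) by simp
      also have "\<dots> = 2 * sqrt (?\<Lambda> n)" by (simp add: real_sqrt_mult)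
      finally show ?case using elim \<mu>0 [of n] by simp
    qed
    then show ?thesis unfolding R_def \<mu>_def by (rule high_signal_regime [OF ctxt tau_pos])
  qed
  ultimately show ?thesis using low by blast
qed

end
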